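(* Let $\alpha \in (0,1)$, let $\mathcal{G}$ be a compact connected metric graph with vertex set $\mathcal{V}$ and a nonempty set $\mathcal{V}_D\subseteq\mathcal{V}$ of Dirichlet vertices, and let $\mathcal{G}'$ be the graph obtained from $\mathcal{G}$ by gluing two distinct vertices $v_1, v_2 \in \mathcal{V}$, where the Dirichlet vertices of $\mathcal{G}'$ are the images of the vertices in $\mathcal{V}_D$. Then $$T_{\alpha}(\mathcal{G}') \leq T_{\alpha}(\mathcal{G}).$$
   Context: A compact metric graph $\mathcal{G}$ is obtained from a finite graph with vertex set $\mathcal{V}$ and edge set $\mathcal{E}$ (loops and parallel edges allowed) by identifying each edge $e$ with an interval $[0,\ell_e]$, $0<\ell_e<\infty$, and gluing endpoints according to the graph structure. A nonempty set $\mathcal{V}_D\subseteq\mathcal{V}$ of Dirichlet vertices is fixed. $L^2(\mathcal{G})=\bigoplus_{e}L^2(0,\ell_e)$ with inner product $\langle\cdot,\cdot\rangle$. The Laplacian $-\Delta_{\mathcal{G}}$ acts as $-f_e''$ on each edge, with domain the edgewise $H^2$ functions that are continuous at every vertex, vanish at every $v\in\mathcal{V}_D$, and at every $v\in\mathcal{V}\setminus\mathcal{V}_D$ satisfy the Kirchhoff condition: the sum, over all edge ends incident to $v$, of the derivatives at $v$ taken in the direction pointing into $v$, is zero. It is self-adjoint with compact resolvent, with eigenvalues $0<\lambda_1\le\lambda_2\le\cdots\to\infty$ (with multiplicity) and an $L^2$-orthonormal basis of eigenfunctions $\varphi_n$. For $\alpha\in(0,1)$, $(-\Delta_{\mathcal{G}})^\alpha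 f=\sum_n\lambda_n^\alpha\langle f,\varphi_n\rangle\varphi_n$ on the domain $\{f\in L^2(\mathcal{G}):\sum_n\lambda_n^{2\alpha}|\langle f,\varphi_n\rangle|^2<\infty\}$. The fractional torsion function $u_\alpha$ is the unique solution of $(-\Delta_{\mathcal{G}})^\alpha u_\alpha=1$, i.e. $u_\alpha=\sum_n\lambda_n^{-\alpha}\langle 1,\varphi_n\rangle\varphi_n$, and the fractional torsional rigidity is $T_\alpha(\mathcal{G})=\int_{\mathcal{G}}u_\alpha\,dx=\sum_n\lambda_n^{-\alpha}|\langle1,\varphi_n\rangle|^2$. Gluing vertices means identifying them to a single vertex, leaving the edges and their lengths unchanged. *)

theory Defs
  imports "Graph_Theory.Digraph_Component" "HOL-Analysis.Analysis"
begin

text \<open>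
  The directions of the arcs only fix how an edge is identified with an interval:
  the arc \<open>e\<close> is the interval from \<open>0\<close> (glued to its tail) to \<open>len G e\<close> (glued to its head).
\<close>

record ('v, 'e) metric_graph =
  skeleton :: "('v, 'e) pre_digraph"
  len :: "'e \<Rightarrow> real"
  dirichlet :: "'v set"

definition compact_metric_graph :: "('v, 'e) metric_graph \<Rightarrow> bool" where
  "compact_metric_graph G \<longleftrightarrow>
     fin_digraph (skeleton G) \<and> (\<forall>e\<in>arcs (skeleton G). 0 < len G e) \<and>
     dirichlet G \<subseteq> verts (skeleton G)"

text \<open>\<open>Digraph_Component.connected\<close> ignores the directions of the arcs.\<close>

definition connected_metric_graph :: "('v, 'e) metric_graph \<Rightarrow> bool" where
  "connected_metric_graph G \<longleftrightarrow> Digraph_Component.connected (skeleton G)"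

text \<open>The vertex obtained by identifying \<open>v1\<close> and \<open>v2\<close> keeps the name \<open>v1\<close>.\<close>

definition glue :: "'v \<Rightarrow> 'v \<Rightarrow> ('v, 'e) metric_graph \<Rightarrow> ('v, 'e) metric_graph" where
  "glue v1 v2 G = (let q = id(v2 := v1); H = skeleton G in
     \<lparr> skeleton = \<lparr> verts = q ` verts H, arcs = arcs H, tail = q \<circ> tail H, head = q \<circ> head H \<rparr>,
       len = len G,
       dirichlet = q ` dirichlet G \<rparr>)"

text \<open>
  A real function on the graph is a family \<open>f\<close> with \<open>f e x\<close> its value at the point \<open>x\<close> of the
  edge \<open>e\<close>; values for \<open>e\<close> not an arc or \<open>x\<close> outside \<open>{0..len G e}\<close> are irrelevant.
  Elements of \<open>L\<^sup>2\<close> are represented by functions, equality in \<open>L\<^sup>2\<close> being equality almost everywhere.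
\<close>

definition L2_interval :: "real \<Rightarrow> (real \<Rightarrow> real) set" where
  "L2_interval l = {f. f \<in> borel_measurable (lebesgue_on {0..l}) \<and>
                       integrable (lebesgue_on {0..l}) (\<lambda>x. (f x)\<^sup>2)}"

definition L2_graph :: "('v, 'e) metric_graph \<Rightarrow> ('e \<Rightarrow> real \<Rightarrow> real) set" where
  "L2_graph G = {f. \<forall>e\<in>arcs (skeleton G). f e \<in> L2_interval (len G e)}"

definition graph_integral :: "('v, 'e) metric_graph \<Rightarrow> ('e \<Rightarrow> real \<Rightarrow> real) \<Rightarrow> real" where
  "graph_integral G f = (\<Sum>e\<in>arcs (skeleton G). \<integral>x. f e x \<partial>lebesgue_on {0..len G e})"

definition L2_inner :: "('v, 'e) metric_graph \<Rightarrow> ('e \<Rightarrow> real \<Rightarrow> real) \<Rightarrow> ('e \<Rightarrow> real \<Rightarrow> real) \<Rightarrow> real" where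
  "L2_inner G f g = graph_integral G (\<lambda>e x. f e x * g e x)"

definition L2_norm :: "('v, 'e) metric_graph \<Rightarrow> ('e \<Rightarrow> real \<Rightarrow> real) \<Rightarrow> real" where
  "L2_norm G f = sqrt (L2_inner G f f)"

definition L2_series_converges ::
  "('v, 'e) metric_graph \<Rightarrow> (nat \<Rightarrow> 'e \<Rightarrow> real \<Rightarrow> real) \<Rightarrow> ('e \<Rightarrow> real \<Rightarrow> real) \<Rightarrow> bool" where
  "L2_series_converges G s f \<longleftrightarrow>
     (\<lambda>N. L2_norm G (\<lambda>e x. f e x - (\<Sum>n<N. s n e x))) \<longlonglongrightarrow> 0"

text \<open>
  \<open>f\<close> is (the \<open>C\<^sup>1\<close> representative of) an \<open>H\<^sup>2\<close> function on the interval \<open>(0, l)\<close>, with first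
  derivative \<open>f'\<close>, which is absolutely continuous, and second weak derivative \<open>f''\<close> in \<open>L\<^sup>2\<close>.
\<close>

definition H2_interval :: "real \<Rightarrow> (real \<Rightarrow> real) \<Rightarrow> (real \<Rightarrow> real) \<Rightarrow> (real \<Rightarrow> real) \<Rightarrow> bool" where
  "H2_interval l f f' f'' \<longleftrightarrow>
     (\<forall>x\<in>{0..l}. (f has_real_derivative f' x) (at x within {0..l})) \<and>
     f'' \<in> L2_interval l \<and>
     (\<forall>x\<in>{0..l}. f' x = f' 0 + (\<integral>t. f'' t \<partial>lebesgue_on {0..x}))"

definition vertex_continuous :: "('v, 'e) metric_graph \<Rightarrow> ('e \<Rightarrow> real \<Rightarrow> real) \<Rightarrow> bool" where
  "vertex_continuous G f \<longleftrightarrow>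
     (\<exists>val. (\<forall>e\<in>arcs (skeleton G). f e 0 = val (tail (skeleton G) e) \<and>
                                  f e (len G e) = val (head (skeleton G) e)) \<and>
            (\<forall>v\<in>dirichlet G. val v = 0))"

text \<open>
  The derivative pointing into the vertex is \<open>f' e (len G e)\<close> at the head of \<open>e\<close> and \<open>- f' e 0\<close> at its
  tail. A loop at \<open>v\<close> occurs in both sums.
\<close>

definition kirchhoff :: "('v, 'e) metric_graph \<Rightarrow> ('e \<Rightarrow> real \<Rightarrow> real) \<Rightarrow> bool" where
  "kirchhoff G f' \<longleftrightarrow>
     (\<forall>v\<in>verts (skeleton G) - dirichlet G.
        (\<Sum>e\<in>{e\<in>arcs (skeleton G). head (skeleton G) e = v}. f' e (len G e)) +
        (\<Sum>e\<in>{e\<in>arcs (skeleton G). tail (skeleton G) e = v}. - f' e 0) = 0)"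

text \<open>\<open>f\<close> belongs to the domain of the Laplacian and \<open>- \<Delta> f = h\<close> in \<open>L\<^sup>2\<close>.\<close>

definition neg_laplacian ::
  "('v, 'e) metric_graph \<Rightarrow> ('e \<Rightarrow> real \<Rightarrow> real) \<Rightarrow> ('e \<Rightarrow> real \<Rightarrow> real) \<Rightarrow> bool" where
  "neg_laplacian G f h \<longleftrightarrow>
     (\<exists>f' f''. (\<forall>e\<in>arcs (skeleton G). H2_interval (len G e) (f e) (f' e) (f'' e)) \<and>
        vertex_continuous G f \<and> kirchhoff G f' \<and>
        (\<forall>e\<in>arcs (skeleton G). AE x in lebesgue_on {0..len G e}. h e x = - f'' e x))"

definition orthonormal_basis :: "('v, 'e) metric_graph \<Rightarrow> (nat \<Rightarrow> 'e \<Rightarrow> real \<Rightarrow> real) \<Rightarrow> bool" where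
  "orthonormal_basis G \<phi> \<longleftrightarrow>
     (\<forall>n. \<phi> n \<in> L2_graph G) \<and>
     (\<forall>m n. L2_inner G (\<phi> m) (\<phi> n) = (if m = n then 1 else 0)) \<and>
     (\<forall>f\<in>L2_graph G. L2_series_converges G (\<lambda>n e x. L2_inner G f (\<phi> n) * \<phi> n e x) f)"

definition eigensystem ::
  "('v, 'e) metric_graph \<Rightarrow> (nat \<Rightarrow> real) \<Rightarrow> (nat \<Rightarrow> 'e \<Rightarrow> real \<Rightarrow> real) \<Rightarrow> bool" where
  "eigensystem G \<mu> \<phi> \<longleftrightarrow>
     (\<forall>n. 0 < \<mu> n) \<and> incseq \<mu> \<and> filterlim \<mu> at_top sequentially \<and>
     orthonormal_basis G \<phi> \<and>
     (\<forall>n. neg_laplacian G (\<phi> n) (\<lambda>e x. \<mu> n * \<phi> n e x))"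

text \<open>
  An arbitrary but fixed eigensystem (indices start at \<open>0\<close>); the fractional powers of the Laplacian
  defined below do not depend on the choice.
\<close>

definition chosen_eigensystem ::
  "('v, 'e) metric_graph \<Rightarrow> (nat \<Rightarrow> real) \<times> (nat \<Rightarrow> 'e \<Rightarrow> real \<Rightarrow> real)" where
  "chosen_eigensystem G = (SOME p. eigensystem G (fst p) (snd p))"

definition eigval :: "('v, 'e) metric_graph \<Rightarrow> nat \<Rightarrow> real" where
  "eigval G = fst (chosen_eigensystem G)"

definition eigfun :: "('v, 'e) metric_graph \<Rightarrow> nat \<Rightarrow> 'e \<Rightarrow> real \<Rightarrow> real" where
  "eigfun G = snd (chosen_eigensystem G)"

text \<open>\<open>f\<close> belongs to the domain of \<open>(- \<Delta>)\<^sup>\<alpha>\<close> and \<open>(- \<Delta>)\<^sup>\<alpha> f = h\<close> in \<open>L\<^sup>2\<close>.\<close>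

definition frac_laplacian ::
  "('v, 'e) metric_graph \<Rightarrow> real \<Rightarrow> ('e \<Rightarrow> real \<Rightarrow> real) \<Rightarrow> ('e \<Rightarrow> real \<Rightarrow> real) \<Rightarrow> bool" where
  "frac_laplacian G \<alpha> f h \<longleftrightarrow>
     f \<in> L2_graph G \<and>
     summable (\<lambda>n. eigval G n powr (2 * \<alpha>) * \<bar>L2_inner G f (eigfun G n)\<bar>\<^sup>2) \<and>
     h \<in> L2_graph G \<and>
     L2_series_converges G
       (\<lambda>n e x. eigval G n powr \<alpha> * L2_inner G f (eigfun G n) * eigfun G n e x) h"

text \<open>The solution is unique up to equality almost everywhere.\<close>

definition frac_torsion_function :: "('v, 'e) metric_graph \<Rightarrow> real \<Rightarrow> 'e \<Rightarrow> real \<Rightarrow> real" where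
  "frac_torsion_function G \<alpha> = (SOME u. frac_laplacian G \<alpha> u (\<lambda>e x. 1))"

definition frac_torsional_rigidity :: "real \<Rightarrow> ('v, 'e) metric_graph \<Rightarrow> real" where
  "frac_torsional_rigidity \<alpha> G = graph_integral G (frac_torsion_function G \<alpha>)"

end

theory Submission
  imports Defs "HOL-Library.Function_Algebras" "HOL-Complex_Analysis.Great_Picard"
begin

text \<open>
  The Green operator of the Dirichlet problem is compact, symmetric and positive, so the spectral
  theorem gives an eigensystem, and the rigidity is the sum of \<open>\<mu>\<^sub>n\<^sup>-\<^sup>\<alpha> c\<^sub>n\<^sup>2\<close>, where \<open>c\<^sub>n\<close> is the coefficient
  of the constant \<open>1\<close>. Up to a positive constant, \<open>\<mu>\<^sup>-\<^sup>\<alpha>\<close> is the integral of \<open>t\<^sup>-\<^sup>\<alpha> / (\<mu> + t)\<close> over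
  \<open>t > 0\<close>, so it suffices to compare the resolvent sums of \<open>c\<^sub>n\<^sup>2 / (\<mu>\<^sub>n + t)\<close>. Such a sum is the supremum of
  \<open>\<langle>1, u\<rangle>\<^sup>2 / (\<parallel>u'\<parallel>\<^sup>2 + t \<parallel>u\<parallel>\<^sup>2)\<close> over the form domain. Gluing leaves the edges, hence \<open>L\<^sup>2\<close> and the
  energy, unchanged and only shrinks the form domain, because a function that is continuous on the
  glued graph is continuous on the original one.
\<close>

section \<open>Compact positive operators on semi-inner product spaces\<close>

text \<open>Eigenvalues and coefficients of 1 change together under gluing, so the two series cannot
  be compared term by term. Nor does a variational formula for \<mu>^-\<alpha> itself help: it
  involves the fractional energy, which depends on the spectral data of each graph, whereas the
  quotient for the resolvent uses only integrals over the edges, which both graphs share.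
  Integrating against the positive weight t^-\<alpha> preserves the inequality, and the weight
  integral converges because 0 < \<alpha> < 1. The rigidity is defined through an arbitrary choice
  of eigensystem and of torsion function, so the existence of both is established before any formula
  for it. Elements of L^2 are functions that are not identified when equal almost everywhere. The
  inner product is therefore only semidefinite, and the abstract spectral theory expresses equality
  by a null difference. Edgewise C^1 functions stand in for the form domain: truncated eigenfunction
  expansions belong to them and approach the supremum.\<close>

locale semi_inner_space =
  fixes V :: "'a::real_vector set" and B :: "'a \<Rightarrow> 'a \<Rightarrow> real"
  assumes subspace_V: "subspace V"
    and B_add: "\<lbrakk>x \<in> V; y \<in> V; z \<in> V\<rbrakk> \<Longrightarrow> B (x + y) z = B x z + B y z"
    and B_scale: "\<lbrakk>x \<in> V; z \<in> V\<rbrakk> \<Longrightarrow> B (c *\<^sub>R x) z = c * B x z"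
    and B_commute: "\<lbrakk>x \<in> V; y \<in> V\<rbrakk> \<Longrightarrow> B x y = B y x"
    and B_nonneg: "x \<in> V \<Longrightarrow> 0 \<le> B x x"
begin

lemma V_closed [simp]:
  "0 \<in> V" "\<lbrakk>x \<in> V; y \<in> V\<rbrakk> \<Longrightarrow> x + y \<in> V" "\<lbrakk>x \<in> V; y \<in> V\<rbrakk> \<Longrightarrow> x - y \<in> V"
  "x \<in> V \<Longrightarrow> c *\<^sub>R x \<in> V"
  using subspace_V by (auto simp: subspace_0 subspace_add subspace_diff subspace_scale)

lemma V_sum [simp]: "(\<And>i. i \<in> I \<Longrightarrow> f i \<in> V) \<Longrightarrow> sum f I \<in> V"
  using subspace_V by (rule subspace_sum)

lemma B_add_right: "\<lbrakk>x \<in> V; y \<in> V; z \<in> V\<rbrakk> \<Longrightarrow> B z (x + y) = B z x + B z y"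
  by (metis B_add B_commute V_closed(2))

lemma B_scale_right: "\<lbrakk>x \<in> V; z \<in> V\<rbrakk> \<Longrightarrow> B z (c *\<^sub>R x) = c * B z x"
  by (metis B_scale B_commute V_closed(4))

lemma B_diff: "\<lbrakk>x \<in> V; y \<in> V; z \<in> V\<rbrakk> \<Longrightarrow> B (x - y) z = B x z - B y z"
  using B_add[of "x - y" y z] by simp

lemma B_diff_right: "\<lbrakk>x \<in> V; y \<in> V; z \<in> V\<rbrakk> \<Longrightarrow> B z (x - y) = B z x - B z y"
  using B_add_right[of "x - y" y z] by simp

lemma B_zero [simp]: "z \<in> V \<Longrightarrow> B 0 z = 0"
  using B_scale[of 0 z 0] by simp

lemma B_sum: "(\<And>i. i \<in> I \<Longrightarrow> f i \<in> V) \<Longrightarrow> z \<in> V \<Longrightarrow> B (sum f I) z = (\<Sum>i\<in>I. B (f i) z)"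
  by (induction I rule: infinite_finite_induct) (auto simp: B_add)

lemmas B_linear = B_add B_add_right B_scale B_scale_right B_diff B_diff_right

lemma Cauchy_Schwarz: 
  assumes "x \<in> V" "y \<in> V"
  shows "(B x y)\<^sup>2 \<le> B x x * B y y"
proof -
  have pos: "0 \<le> B x x + 2 * t * B x y + t\<^sup>2 * B y y" for t
    using B_nonneg[of "x + t *\<^sub>R y"] assms B_commute[of y x]
    by (simp add: B_linear algebra_simps power2_eq_square)
  show ?thesis
  proof (cases "B y y = 0")
    case True
    have "B x y = 0"
    proof (rule ccontr)
      assume "B x y \<noteq> 0"
      \<comment> \<open>With B y y = 0 the expression in \<open>pos\<close> is affine in t; this t
        gives it the value -1.\<close>
      then show False using pos[of "- (B x x + 1) / (2 * B x y)"] True by (simp add: field_simps)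
    qed
    then show ?thesis using True by simp
  next
    case False
    then have "B y y > 0" using B_nonneg[OF assms(2)] by simp
    then show ?thesis using pos[of "- B x y / B y y"]
      by (simp add: field_simps power2_eq_square)
  qed
qed

lemma null_left: "\<lbrakk>x \<in> V; y \<in> V; B x x = 0\<rbrakk> \<Longrightarrow> B x y = 0"
  using Cauchy_Schwarz[of x y] by simp

text \<open>Parallelogram law without the square of the difference. It serves as the triangle
  inequality, so that all later estimates can stay with squared norms.\<close>

lemma square_add_le: 
  assumes "x \<in> V" "y \<in> V" shows "B (x + y) (x + y) \<le> 2 * B x x + 2 * B y y"
  using B_nonneg[of "x - y"] assms B_commute[of x y] by (simp add: B_linear)

lemma square_diff_le: 
  assumes "x \<in> V" "y \<in> V" "z \<in> V"
  shows "B (x - z) (x - z) \<le> 2 * B (x - y) (x - y) + 2 * B (y - z) (y - z)"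
  using square_add_le[of "x - y" "y - z"] assms by simp

lemma square_diff_commute: "\<lbrakk>x \<in> V; y \<in> V\<rbrakk> \<Longrightarrow> B (x - y) (x - y) = B (y - x) (y - x)"
  by (simp add: B_linear)

lemma tendsto_B_left:
  assumes "\<And>n. s n \<in> V" "g \<in> V" "y \<in> V" and lim: "(\<lambda>n. B (s n - g) (s n - g)) \<longlonglongrightarrow> 0"
  shows "(\<lambda>n. B (s n) y) \<longlonglongrightarrow> B g y"
proof -
  have "(\<lambda>n. B (s n - g) (s n - g) * B y y) \<longlonglongrightarrow> 0"
    using tendsto_mult_left_zero[OF lim] by simp
  then have "(\<lambda>n. (B (s n - g) y)\<^sup>2) \<longlonglongrightarrow> 0"
    by (rule tendsto_sandwich[of "\<lambda>_. 0", rotated 3])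
       (use assms in \<open>auto intro!: always_eventually Cauchy_Schwarz\<close>)
  then have "(\<lambda>n. B (s n - g) y) \<longlonglongrightarrow> 0"
    using tendsto_real_sqrt[of "\<lambda>n. (B (s n - g) y)\<^sup>2" 0] by (simp add: tendsto_rabs_zero_iff)
  then have "(\<lambda>n. B (s n - g) y + B g y) \<longlonglongrightarrow> 0 + B g y"
    by (intro tendsto_intros)
  then show ?thesis using assms by (simp add: B_linear)
qed

lemma tendsto_square:
  assumes "\<And>n. s n \<in> V" "g \<in> V" and lim: "(\<lambda>n. B (s n - g) (s n - g)) \<longlonglongrightarrow> 0"
  shows "(\<lambda>n. B (s n) (s n)) \<longlonglongrightarrow> B g g"
proof -
  have "(\<lambda>n. B (s n - g) (s n - g) + 2 * B (s n) g - B g g) \<longlonglongrightarrow> 0 + 2 * B g g - B g g"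
    by (intro tendsto_intros lim tendsto_B_left assms)
  moreover have "B (s n - g) (s n - g) + 2 * B (s n) g - B g g = B (s n) (s n)" for n
    using assms B_commute[of g "s n"] by (simp add: B_linear)
  ultimately show ?thesis by simp
qed

definition orthonormal :: "(nat \<Rightarrow> 'a) \<Rightarrow> bool" where
  "orthonormal \<phi> \<longleftrightarrow> (\<forall>n. \<phi> n \<in> V) \<and> (\<forall>m n. B (\<phi> m) (\<phi> n) = (if m = n then 1 else 0))"

lemma orthonormal_sum_inner:
  assumes "orthonormal \<phi>" "finite I"
  shows "B (\<Sum>n\<in>I. c n *\<^sub>R \<phi> n) (\<phi> m) = (if m \<in> I then c m else 0)"
proof -
  have V: "\<phi> n \<in> V" for n using assms by (auto simp: orthonormal_def)
  have "B (\<Sum>n\<in>I. c n *\<^sub>R \<phi> n) (\<phi> m) = (\<Sum>n\<in>I. c n * B (\<phi> n) (\<phi> m))"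
    using V by (subst B_sum) (auto simp: B_scale)
  also have "\<dots> = (\<Sum>n\<in>I. if n = m then c n else 0)"
    using assms by (intro sum.cong) (auto simp: orthonormal_def)
  finally have "B (\<Sum>n\<in>I. c n *\<^sub>R \<phi> n) (\<phi> m) = (\<Sum>n\<in>I. if n = m then c n else 0)" .
  then show ?thesis using assms by simp
qed

lemma orthonormal_sum_square:
  assumes "orthonormal \<phi>" "finite I"
  shows "B (\<Sum>n\<in>I. c n *\<^sub>R \<phi> n) (\<Sum>n\<in>I. c n *\<^sub>R \<phi> n) = (\<Sum>n\<in>I. (c n)\<^sup>2)"
proof -
  have V: "\<phi> n \<in> V" for n using assms by (auto simp: orthonormal_def)
  let ?s = "\<Sum>n\<in>I. c n *\<^sub>R \<phi> n"
  have [simp]: "?s \<in> V" using V by simp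
  have "B ?s ?s = (\<Sum>n\<in>I. B (c n *\<^sub>R \<phi> n) ?s)"
    using V by (subst B_sum) auto
  also have "\<dots> = (\<Sum>n\<in>I. (c n)\<^sup>2)"
  proof (rule sum.cong[OF refl])
    fix n assume "n \<in> I"
    then show "B (c n *\<^sub>R \<phi> n) ?s = (c n)\<^sup>2"
      using V orthonormal_sum_inner[OF assms, of c n] B_commute[of "\<phi> n" ?s]
      by (simp add: B_scale power2_eq_square)
  qed
  finally show ?thesis .
qed

lemma Bessel:
  assumes "orthonormal \<phi>" "f \<in> V"
  shows "(\<Sum>n<N. (B f (\<phi> n))\<^sup>2) \<le> B f f"
proof -
  have V: "\<phi> n \<in> V" for n using assms by (auto simp: orthonormal_def)
  let ?s = "\<Sum>n<N. B f (\<phi> n) *\<^sub>R \<phi> n"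
  have [simp]: "?s \<in> V" using V by simp
  have "B ?s f = (\<Sum>n<N. (B f (\<phi> n))\<^sup>2)"
    using V assms by (subst B_sum) (auto simp: B_scale B_scale_right power2_eq_square B_commute[of "\<phi> _" f])
  moreover have "B ?s ?s = (\<Sum>n<N. (B f (\<phi> n))\<^sup>2)"
    using orthonormal_sum_square[OF assms(1)] by simp
  moreover have "0 \<le> B (f - ?s) (f - ?s)" using assms by (intro B_nonneg) simp
  ultimately show ?thesis using assms B_commute[of f ?s] by (simp add: B_linear)
qed

lemma Parseval:
  assumes "orthonormal \<phi>" "f \<in> V" "g \<in> V"
    and "(\<lambda>N. B (f - (\<Sum>n<N. B f (\<phi> n) *\<^sub>R \<phi> n)) (f - (\<Sum>n<N. B f (\<phi> n) *\<^sub>R \<phi> n))) \<longlonglongrightarrow> 0"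
  shows "(\<lambda>n. B f (\<phi> n) * B g (\<phi> n)) sums B f g"
proof -
  have V: "\<phi> n \<in> V" for n using assms by (auto simp: orthonormal_def)
  let ?s = "\<lambda>N. \<Sum>n<N. B f (\<phi> n) *\<^sub>R \<phi> n"
  have [simp]: "?s N \<in> V" for N using V by simp
  have "(\<lambda>N. B (?s N - f) (?s N - f)) \<longlonglongrightarrow> 0"
    using assms by (simp add: square_diff_commute)
  then have "(\<lambda>N. B (?s N) g) \<longlonglongrightarrow> B f g"
    using assms by (intro tendsto_B_left) auto
  moreover have "B (?s N) g = (\<Sum>n<N. B f (\<phi> n) * B g (\<phi> n))" for N
    using V assms by (subst B_sum) (auto simp: B_scale B_commute[of g])
  ultimately show ?thesis by (simp add: sums_def)
qed

end

section \<open>Completeness and the Riesz-Fischer theorem\<close>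

locale complete_semi_inner_space = semi_inner_space +
  assumes complete_V: "\<lbrakk>\<And>n. s n \<in> V; \<And>e. 0 < e \<Longrightarrow> \<exists>M. \<forall>m\<ge>M. \<forall>n\<ge>M. B (s m - s n) (s m - s n) < e\<rbrakk>
    \<Longrightarrow> \<exists>g\<in>V. (\<lambda>n. B (s n - g) (s n - g)) \<longlonglongrightarrow> 0"
begin

lemma Riesz_Fischer:
  assumes orth: "orthonormal \<phi>" and summ: "summable (\<lambda>n. (c n)\<^sup>2)"
  obtains g where "g \<in> V" "(\<lambda>N. B (g - (\<Sum>n<N. c n *\<^sub>R \<phi> n)) (g - (\<Sum>n<N. c n *\<^sub>R \<phi> n))) \<longlonglongrightarrow> 0"
    "\<And>n. B g (\<phi> n) = c n"
proof -
  have V: "\<phi> n \<in> V" for n using assms by (auto simp: orthonormal_def)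
  let ?s = "\<lambda>N. \<Sum>n<N. c n *\<^sub>R \<phi> n"
  have [simp]: "?s N \<in> V" for N using V by simp
  have diff: "B (?s m - ?s n) (?s m - ?s n) = (\<Sum>k=m..<n. (c k)\<^sup>2)" if "m \<le> n" for m n
  proof -
    have "?s n - ?s m = (\<Sum>k=m..<n. c k *\<^sub>R \<phi> k)"
      using that by (metis atLeast0LessThan sum_diff_nat_ivl zero_le)
    then show ?thesis using orthonormal_sum_square[OF orth] by (simp add: square_diff_commute[of "?s m"])
  qed
  have "\<exists>g\<in>V. (\<lambda>n. B (?s n - g) (?s n - g)) \<longlonglongrightarrow> 0"
  proof (rule complete_V)
    fix e :: real assume "0 < e"
    then obtain M where M: "\<And>m n. M \<le> m \<Longrightarrow> norm (\<Sum>k=m..<n. (c k)\<^sup>2) < e"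
      using summ unfolding summable_Cauchy by blast
    have "B (?s m - ?s n) (?s m - ?s n) < e" if "M \<le> m" "M \<le> n" for m n
    proof (cases "m \<le> n")
      case True then show ?thesis using diff M[OF that(1), of n] by simp
    next
      case False 
      then have "B (?s m - ?s n) (?s m - ?s n) = (\<Sum>k=n..<m. (c k)\<^sup>2)"
        using diff[of n m] by (simp add: square_diff_commute[of "?s m"])
      then show ?thesis using M[OF that(2), of m] by simp
    qed
    then show "\<exists>M. \<forall>m\<ge>M. \<forall>n\<ge>M. B (?s m - ?s n) (?s m - ?s n) < e" by blast
  qed simp
  then obtain g where g: "g \<in> V" "(\<lambda>n. B (?s n - g) (?s n - g)) \<longlonglongrightarrow> 0" by blast
  show ?thesis
  proof
    show "(\<lambda>N. B (g - ?s N) (g - ?s N)) \<longlonglongrightarrow> 0" using g by (simp add: square_diff_commute[of g])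
    fix m
    have "(\<lambda>N. B (?s N) (\<phi> m)) \<longlonglongrightarrow> B g (\<phi> m)" using g V by (intro tendsto_B_left) auto
    moreover have "\<forall>\<^sub>F N in sequentially. B (?s N) (\<phi> m) = c m"
      using eventually_gt_at_top[of m] by eventually_elim (simp add: orthonormal_sum_inner[OF orth])
    then have "(\<lambda>N. B (?s N) (\<phi> m)) \<longlonglongrightarrow> c m"
      by (rule tendsto_eventually)
    ultimately show "B g (\<phi> m) = c m" by (rule LIMSEQ_unique)
  qed fact
qed

end

text \<open>\<open>K\<close> is required to be symmetric but not literally linear, because the Green
  operator is obtained by choice and is linear only up to null vectors.
  \<open>infinite_dimensional\<close> keeps the construction of eigenvectors from stopping, so that
  they form a sequence.\<close>

locale compact_positive_operator = complete_semi_inner_space +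
  fixes K :: "'a \<Rightarrow> 'a"
  assumes K_closed [simp]: "x \<in> V \<Longrightarrow> K x \<in> V"
    and K_sym: "\<lbrakk>x \<in> V; y \<in> V\<rbrakk> \<Longrightarrow> B (K x) y = B x (K y)"
    and K_pos: "x \<in> V \<Longrightarrow> 0 \<le> B x (K x)"
    and K_inj: "\<lbrakk>x \<in> V; B (K x) (K x) = 0\<rbrakk> \<Longrightarrow> B x x = 0"
    and K_bounded: "\<exists>C. \<forall>x\<in>V. B (K x) (K x) \<le> C * B x x"
    and K_compact: "\<lbrakk>\<And>n. f n \<in> V; \<And>n. B (f n) (f n) \<le> 1\<rbrakk> \<Longrightarrow>
      \<exists>r g. strict_mono (r :: nat \<Rightarrow> nat) \<and> g \<in> V \<and> (\<lambda>n. B (K (f (r n)) - g) (K (f (r n)) - g)) \<longlonglongrightarrow> 0"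
    and infinite_dimensional: "\<lbrakk>finite S; S \<subseteq> V\<rbrakk> \<Longrightarrow> \<exists>x\<in>V. B x x \<noteq> 0 \<and> (\<forall>s\<in>S. B x s = 0)"
begin

text \<open>Symmetry moves \<open>K\<close> to the other argument, where linearity of
  \<open>B\<close> applies. Tested against vectors of \<open>V\<close>, \<open>K\<close> thus
  behaves linearly.\<close>

lemma K_scale: "\<lbrakk>x \<in> V; z \<in> V\<rbrakk> \<Longrightarrow> B (K (c *\<^sub>R x)) z = c * B (K x) z"
  by (simp add: K_sym B_linear)

lemma K_diff: "\<lbrakk>x \<in> V; y \<in> V; z \<in> V\<rbrakk> \<Longrightarrow> B (K (x - y)) z = B (K x) z - B (K y) z"
  by (simp add: K_sym B_linear)

text \<open>The point is the Cauchy-Schwarz inequality for this second form.\<close>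

sublocale Q: semi_inner_space V "\<lambda>x y. B (K x) y"
proof
  fix x y assume "x \<in> V" "y \<in> V"
  then show "B (K x) y = B (K y) x" using B_commute[of "K y" x] K_sym[of x y] by simp
qed (use K_pos subspace_V in \<open>auto simp: K_sym B_linear\<close>)

lemma K_diff_square:
  assumes "x \<in> V" "y \<in> V" shows "B (K x - K y) (K x - K y) = B (K (x - y)) (K (x - y))"
proof -
  have *: "B (K x - K y) z = B (K (x - y)) z" if "z \<in> V" for z
    using assms that by (simp add: K_diff B_diff)
  then have "B (K x - K y) (K x - K y) = B (K (x - y)) (K x - K y)" using assms by simp
  also have "\<dots> = B (K x - K y) (K (x - y))" using assms by (simp add: B_commute)
  also have "\<dots> = B (K (x - y)) (K (x - y))" using assms * by simp
  finally show ?thesis .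
qed

definition eigenvector :: "real \<Rightarrow> 'a \<Rightarrow> bool" where
  "eigenvector k x \<longleftrightarrow> x \<in> V \<and> B (K x - k *\<^sub>R x) (K x - k *\<^sub>R x) = 0"

lemma eigenvector_inner:
  assumes "eigenvector k x" "y \<in> V" shows "B (K x) y = k * B x y"
  using assms null_left[of "K x - k *\<^sub>R x" y] by (auto simp: eigenvector_def B_linear)

text \<open>Cauchy-Schwarz for \<open>Q\<close> at \<open>x\<close> and \<open>K x\<close> gives |K
  x|^4 \<le> <K x, x> <K (K x), K x>. The hypothesis bounds the last factor by k |K x|^2, and |K
  x|^2 cancels.\<close>

lemma square_K_le:
  assumes "x \<in> V" and "B (K (K x)) (K x) \<le> k * B (K x) (K x)" "0 \<le> k"
  shows "B (K x) (K x) \<le> k * B (K x) x"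
proof (cases "B (K x) (K x) = 0")
  case True then show ?thesis using assms Q.B_nonneg[of x] by simp
next
  case False
  then have pos: "B (K x) (K x) > 0" using B_nonneg[of "K x"] assms by simp
  have "(B (K x) (K x))\<^sup>2 \<le> B (K x) x * B (K (K x)) (K x)"
    using Q.Cauchy_Schwarz[of x "K x"] assms by simp
  also have "\<dots> \<le> B (K x) x * (k * B (K x) (K x))"
    using assms Q.B_nonneg[of x] by (intro mult_left_mono) auto
  finally show ?thesis using pos by (simp add: power2_eq_square mult.assoc[symmetric]) (simp add: mult_ac)
qed

text \<open>If the form vanishes at \<open>x\<close>, Cauchy-Schwarz for \<open>Q\<close> makes
  \<open>K x\<close> null, and injectivity makes \<open>x\<close> null.\<close>

lemma quadratic_pos:
  assumes "x \<in> V" "B x x \<noteq> 0" shows "0 < B (K x) x"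
proof (rule ccontr)
  assume "\<not> ?thesis"
  then have "B (K x) x = 0" using Q.B_nonneg[OF assms(1)] by simp
  then have "B (K x) (K x) = 0" using Q.null_left[of x "K x"] assms by simp
  then show False using K_inj assms by simp
qed

text \<open>The Rayleigh quotient of \<open>K\<close> is maximised over the vectors orthogonal to
  \<open>S\<close>. A maximising sequence almost satisfies the eigenvalue equation, and compactness
  of \<open>K\<close> makes a subsequence converge because the supremum is positive.\<close>

lemma maximal_eigenvector:
  assumes S: "finite S" "\<And>s. s \<in> S \<Longrightarrow> \<exists>k. eigenvector k s"
  shows "\<exists>\<phi> \<kappa>. eigenvector \<kappa> \<phi> \<and> B \<phi> \<phi> = 1 \<and> 0 < \<kappa> \<and> (\<forall>s\<in>S. B \<phi> s = 0) \<and>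
    (\<forall>x\<in>V. (\<forall>s\<in>S. B x s = 0) \<longrightarrow> B (K x) x \<le> \<kappa> * B x x)"
proof -
  have SV: "S \<subseteq> V" using S by (auto simp: eigenvector_def)
  define W where "W = {x\<in>V. \<forall>s\<in>S. B x s = 0}"
  have WI: "x \<in> W" if "x \<in> V" "\<And>s. s \<in> S \<Longrightarrow> B x s = 0" for x using that by (simp add: W_def)
  have WD: "B x s = 0" if "x \<in> W" "s \<in> S" for x s using that by (simp add: W_def)
  have WV [simp]: "x \<in> V" if "x \<in> W" for x using that by (simp add: W_def)
  \<comment> \<open>As \<open>S\<close> consists of eigenvectors, its orthogonal complement is
    invariant under \<open>K\<close>.\<close>
  have KW: "K x \<in> W" if x: "x \<in> W" for x
  proof -
    have "B (K x) s = 0" if s: "s \<in> S" for s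
    proof -
      obtain k where "eigenvector k s" using S s by blast
      then have "B (K s) x = k * B s x" using x by (intro eigenvector_inner) auto
      moreover have "B s x = 0" using x s SV B_commute[of s x] WD[of x s] by auto
      ultimately show ?thesis using x s SV Q.B_commute[of x s] by auto
    qed
    then show ?thesis using x by (auto intro: WI)
  qed
  obtain C where C: "\<And>x. x \<in> V \<Longrightarrow> B (K x) (K x) \<le> C * B x x" using K_bounded by blast
  define A where "A = (\<lambda>x. B (K x) x) ` {x\<in>W. B x x \<le> 1}"
  have bdd: "bdd_above A"
  proof -
    have "B (K x) x \<le> 1 + \<bar>C\<bar>" if x: "x \<in> W" "B x x \<le> 1" for x
    proof -
      have "(B (K x) x)\<^sup>2 \<le> B (K x) (K x) * B x x" using x by (intro Cauchy_Schwarz) auto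
      also have "\<dots> \<le> (C * B x x) * B x x" using x C B_nonneg by (intro mult_right_mono) auto
      also have "\<dots> \<le> \<bar>C\<bar> * 1" unfolding mult.assoc
        using x B_nonneg[of x] mult_le_one[of "B x x" "B x x"]
        by (intro mult_mono) auto
      finally have "(B (K x) x)\<^sup>2 \<le> \<bar>C\<bar>" by simp
      also have "\<dots> \<le> (1 + \<bar>C\<bar>)\<^sup>2" by (simp add: power2_eq_square algebra_simps)
      finally show ?thesis by (rule power2_le_imp_le) simp
    qed
    then show ?thesis by (auto simp: A_def intro!: bdd_aboveI)
  qed
  define \<kappa> where "\<kappa> = Sup A"
  have le: "B (K x) x \<le> \<kappa> * B x x" if x: "x \<in> W" for x
  proof (cases "B x x = 0")
    case True then show ?thesis using null_left[of x "K x"] x by (simp add: B_commute)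
  next
    case False
    then have pos: "B x x > 0" using B_nonneg[of x] x by simp
    define y where "y = (1 / sqrt (B x x)) *\<^sub>R x"
    have y: "y \<in> W" "B y y \<le> 1" using x pos SV WD[of x] by (auto simp: y_def B_linear subset_iff intro!: WI)
    have "B (K y) y = B (K x) x / B x x" using x pos by (simp add: y_def K_scale B_linear)
    moreover have "B (K y) y \<le> \<kappa>" unfolding \<kappa>_def
      by (rule cSup_upper[OF _ bdd]) (use y in \<open>auto simp: A_def\<close>)
    ultimately have "B (K x) x / B x x \<le> \<kappa>" by simp
    then show ?thesis using pos by (simp only: divide_le_eq if_True)
  qed
  obtain x0 where x0: "x0 \<in> W" "B x0 x0 \<noteq> 0" using infinite_dimensional[OF S(1) SV] WI by blast
  have kpos: "\<kappa> > 0"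
  proof -
    have "0 < \<kappa> * B x0 x0" using quadratic_pos[of x0] le[of x0] x0 by simp
    then show ?thesis using B_nonneg[of x0] x0 by (auto simp: zero_less_mult_iff)
  qed
  have "\<exists>x. x \<in> W \<and> B x x \<le> 1 \<and> \<kappa> - inverse (real (Suc n)) < B (K x) x" for n
  proof -
    have "0 \<in> W" using SV by (auto intro!: WI)
    then have "A \<noteq> {}" using x0 by (auto simp: A_def intro!: exI[of _ 0])
    moreover have "\<kappa> - inverse (real (Suc n)) < Sup A" by (simp add: \<kappa>_def)
    ultimately show ?thesis using less_cSup_iff[OF _ bdd, of "\<kappa> - inverse (real (Suc n))"]
      by (auto simp: A_def)
  qed
  then obtain f where f: "\<And>n. f n \<in> W" "\<And>n. B (f n) (f n) \<le> 1"
     "\<And>n. \<kappa> - inverse (real (Suc n)) < B (K (f n)) (f n)" by metis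
  obtain r g where r: "strict_mono r" "g \<in> V" and 
    lim: "(\<lambda>n. B (K (f (r n)) - g) (K (f (r n)) - g)) \<longlonglongrightarrow> 0"
    using K_compact[of f] f by auto
  define x where "x = f \<circ> r"
  have x: "x n \<in> W" "B (x n) (x n) \<le> 1" "\<kappa> - inverse (real (Suc n)) < B (K (x n)) (x n)" for n
  proof -
    \<comment> \<open>Passing to the subsequence keeps the error bound, since n \<le> r n.\<close>
    have "inverse (real (Suc (r n))) \<le> inverse (real (Suc n))"
      using seq_suble[OF r(1), of n] by (simp add: le_imp_inverse_le)
    then show "\<kappa> - inverse (real (Suc n)) < B (K (x n)) (x n)"
      using f(3)[of "r n"] unfolding x_def comp_def by linarith
  qed (use f in \<open>auto simp: x_def\<close>)
  have xV [simp]: "x n \<in> V" for n using x(1) by simp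
  have lim: "(\<lambda>n. B (K (x n) - g) (K (x n) - g)) \<longlonglongrightarrow> 0" using lim by (simp add: x_def)
  have inv0: "(\<lambda>n. inverse (real (Suc n))) \<longlonglongrightarrow> 0" by (rule LIMSEQ_inverse_real_of_nat)
  \<comment> \<open>With q = <K x, x>, the expanded square is at most \<kappa>^2 - 2 \<kappa> q +
    \<kappa> q = \<kappa> (\<kappa> - q), by |x|^2 \<le> 1 and \<open>square_K_le\<close>; along the
    maximising sequence this tends to 0.\<close>
  have eig0: "(\<lambda>n. B (\<kappa> *\<^sub>R x n - K (x n)) (\<kappa> *\<^sub>R x n - K (x n))) \<longlonglongrightarrow> 0"
  proof (rule tendsto_sandwich[of "\<lambda>_. 0"])
    have "B (\<kappa> *\<^sub>R x n - K (x n)) (\<kappa> *\<^sub>R x n - K (x n)) \<le> \<kappa> * inverse (real (Suc n))" for n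
    proof -
      have "B (K (x n)) (K (x n)) \<le> \<kappa> * B (K (x n)) (x n)"
        using KW[OF x(1)] kpos by (intro square_K_le le) auto
      moreover have "\<kappa> * (\<kappa> * B (x n) (x n)) \<le> \<kappa> * (\<kappa> * 1)" using x(2)[of n] kpos by (intro mult_left_mono) auto
      moreover have "\<kappa> * (\<kappa> - B (K (x n)) (x n)) \<le> \<kappa> * inverse (real (Suc n))"
        using x(3)[of n] kpos by (intro mult_left_mono) auto
      moreover have "B (\<kappa> *\<^sub>R x n - K (x n)) (\<kappa> *\<^sub>R x n - K (x n))
         = \<kappa> * (\<kappa> * B (x n) (x n)) - 2 * (\<kappa> * B (K (x n)) (x n)) + B (K (x n)) (K (x n))"
        by (simp add: B_linear B_commute[of "x n" "K (x n)"] algebra_simps)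
      ultimately show ?thesis by (simp add: algebra_simps)
    qed
    then show "\<forall>\<^sub>F n in sequentially. B (\<kappa> *\<^sub>R x n - K (x n)) (\<kappa> *\<^sub>R x n - K (x n)) \<le> \<kappa> * inverse (real (Suc n))"
      by simp
    show "(\<lambda>n. \<kappa> * inverse (real (Suc n))) \<longlonglongrightarrow> 0" using tendsto_mult_right_zero[OF inv0] by simp
  qed (auto intro!: always_eventually B_nonneg)
  \<comment> \<open>Both \<kappa> x_n - K x_n and K x_n - g tend to 0, so x_n tends to g divided by
    \<kappa>.\<close>
  define \<phi> where "\<phi> = (1 / \<kappa>) *\<^sub>R g"
  have \<phi>V [simp]: "\<phi> \<in> V" using r by (simp add: \<phi>_def)
  have g: "g = \<kappa> *\<^sub>R \<phi>" using kpos by (simp add: \<phi>_def)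
  have limx: "(\<lambda>n. B (x n - \<phi>) (x n - \<phi>)) \<longlonglongrightarrow> 0"
  proof (rule tendsto_sandwich[of "\<lambda>_. 0"])
    let ?b = "\<lambda>n. (2 * B (\<kappa> *\<^sub>R x n - K (x n)) (\<kappa> *\<^sub>R x n - K (x n)) + 2 * B (K (x n) - g) (K (x n) - g)) / \<kappa>\<^sup>2"
    have "B (x n - \<phi>) (x n - \<phi>) \<le> ?b n" for n
    proof -
      have "\<kappa>\<^sup>2 * B (x n - \<phi>) (x n - \<phi>) = B (\<kappa> *\<^sub>R x n - g) (\<kappa> *\<^sub>R x n - g)"
        by (simp add: g B_linear power2_eq_square algebra_simps)
      then show ?thesis using square_diff_le[of "\<kappa> *\<^sub>R x n" "K (x n)" g] kpos r by (simp add: field_simps)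
    qed
    then show "\<forall>\<^sub>F n in sequentially. B (x n - \<phi>) (x n - \<phi>) \<le> ?b n" by simp
    have "?b \<longlonglongrightarrow> (2 * 0 + 2 * 0) / \<kappa>\<^sup>2" using kpos by (intro tendsto_intros eig0 lim) auto
    then show "?b \<longlonglongrightarrow> 0" by simp
  qed (auto intro!: always_eventually B_nonneg)
  \<comment> \<open>The sequence was taken in the unit ball only; <K x, x> \<le> \<kappa> |x|^2
    forces its norms to tend to 1.\<close>
  have "B \<phi> \<phi> = 1"
  proof (rule LIMSEQ_unique[OF tendsto_square[OF xV \<phi>V limx]])
    show "(\<lambda>n. B (x n) (x n)) \<longlonglongrightarrow> 1"
    proof (rule tendsto_sandwich)
      have "1 - inverse (real (Suc n)) / \<kappa> \<le> B (x n) (x n)" for n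
      proof -
        have "\<kappa> - inverse (real (Suc n)) \<le> B (x n) (x n) * \<kappa>"
          using x(3)[of n] le[OF x(1), of n] by (simp only: mult.commute[of \<kappa>])
        then have "(\<kappa> - inverse (real (Suc n))) / \<kappa> \<le> B (x n) (x n)"
          using kpos by (simp only: pos_divide_le_eq)
        then show ?thesis using kpos by (simp add: diff_divide_distrib)
      qed
      then show "\<forall>\<^sub>F n in sequentially. 1 - inverse (real (Suc n)) / \<kappa> \<le> B (x n) (x n)" by simp
      have "(\<lambda>n. 1 - inverse (real (Suc n)) / \<kappa>) \<longlonglongrightarrow> 1 - 0 / \<kappa>"
        using kpos by (intro tendsto_intros inv0) auto
      then show "(\<lambda>n. 1 - inverse (real (Suc n)) / \<kappa>) \<longlonglongrightarrow> 1" by simp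
    qed (use x in auto)
  qed
  moreover have "B \<phi> s = 0" if "s \<in> S" for s
  proof -
    have "B (x n) s = 0" for n using x(1)[of n] that by (rule WD)
    moreover have "(\<lambda>n. B (x n) s) \<longlonglongrightarrow> B \<phi> s" using that SV limx by (intro tendsto_B_left) auto
    ultimately show ?thesis by (simp add: LIMSEQ_const_iff)
  qed
  moreover have "eigenvector \<kappa> \<phi>"
  proof -
    have bound: "B (K \<phi> - g) (K \<phi> - g) \<le> 2 * (C * B (x n - \<phi>) (x n - \<phi>)) + 2 * B (K (x n) - g) (K (x n) - g)" for n
    proof -
      have "B (K \<phi> - K (x n)) (K \<phi> - K (x n)) \<le> C * B (x n - \<phi>) (x n - \<phi>)"
        using C[of "\<phi> - x n"] by (simp add: K_diff_square square_diff_commute[of \<phi>])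
      then show ?thesis using square_diff_le[of "K \<phi>" "K (x n)" g] r by simp
    qed
    have "(\<lambda>n. 2 * (C * B (x n - \<phi>) (x n - \<phi>)) + 2 * B (K (x n) - g) (K (x n) - g)) \<longlonglongrightarrow> 2 * (C * 0) + 2 * 0"
      by (intro tendsto_intros limx lim)
    then have "B (K \<phi> - g) (K \<phi> - g) \<le> 0"
      using bound by (intro LIMSEQ_le_const) auto
    then show ?thesis using B_nonneg[of "K \<phi> - g"] r by (simp add: eigenvector_def g)
  qed
  ultimately show ?thesis using kpos le WI by blast
qed

text \<open>Each new eigenvector maximises the Rayleigh quotient on the complement of the earlier
  ones. The expansion converges because a vector orthogonal to all of them has its form bounded by
  every \<kappa>_n |x|^2; as \<kappa>_n tends to 0, the form vanishes there and the vector is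
  null.\<close>

theorem spectral_theorem:
  obtains \<kappa> \<phi> where "orthonormal \<phi>" "\<And>n. eigenvector (\<kappa> n) (\<phi> n)" "\<And>n. 0 < \<kappa> n" "decseq \<kappa>" "\<kappa> \<longlonglongrightarrow> 0"
    "\<And>f. f \<in> V \<Longrightarrow> (\<lambda>N. B (f - (\<Sum>n<N. B f (\<phi> n) *\<^sub>R \<phi> n)) (f - (\<Sum>n<N. B f (\<phi> n) *\<^sub>R \<phi> n))) \<longlonglongrightarrow> 0"
proof -
  define good where "good S p \<longleftrightarrow> eigenvector (snd p) (fst p) \<and> B (fst p) (fst p) = 1 \<and> 0 < snd p \<and> 
    (\<forall>s\<in>S. B (fst p) s = 0) \<and> (\<forall>x\<in>V. (\<forall>s\<in>S. B x s = 0) \<longrightarrow> B (K x) x \<le> snd p * B x x)" for S and p :: "'a \<times> real"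
  define pick where "pick S = (SOME p. good S p)" for S
  have pick: "good S (pick S)" if fin: "finite S" and ev: "\<And>s. s \<in> S \<Longrightarrow> \<exists>k. eigenvector k s" for S
    unfolding pick_def
  proof (rule someI_ex)
    obtain \<phi> \<kappa> where *: "eigenvector \<kappa> \<phi> \<and> B \<phi> \<phi> = 1 \<and> 0 < \<kappa> \<and> (\<forall>s\<in>S. B \<phi> s = 0) \<and>
      (\<forall>x\<in>V. (\<forall>s\<in>S. B x s = 0) \<longrightarrow> B (K x) x \<le> \<kappa> * B x x)"
      using maximal_eigenvector[OF fin ev] by blast
    then have "good S (\<phi>, \<kappa>)" by (simp add: good_def)
    then show "\<exists>p. good S p" ..
  qed
  define S where "S = rec_nat {} (\<lambda>_ S. insert (fst (pick S)) S)"
  define \<phi> where "\<phi> n = fst (pick (S n))" for n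
  define \<kappa> where "\<kappa> n = snd (pick (S n))" for n
  have S0: "S 0 = {}" and SSuc: "S (Suc n) = insert (\<phi> n) (S n)" for n by (simp_all add: S_def \<phi>_def)
  have S_eq: "S n = \<phi> ` {..<n}" for n by (induction n) (auto simp: S0 SSuc lessThan_Suc)
  have inv: "finite (S n) \<and> (\<forall>s\<in>S n. \<exists>k. eigenvector k s)" for n
  proof (induction n)
    case (Suc n)
    then have "good (S n) (pick (S n))" by (intro pick) auto
    then show ?case using Suc by (auto simp: SSuc \<phi>_def good_def)
  qed (simp add: S0)
  have good: "good (S n) (\<phi> n, \<kappa> n)" for n using pick[of "S n"] inv[of n] by (simp add: \<phi>_def \<kappa>_def)
  have eig: "eigenvector (\<kappa> n) (\<phi> n)" "0 < \<kappa> n" for n using good[of n] by (auto simp: good_def)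
  have V [simp]: "\<phi> n \<in> V" for n using eig by (simp add: eigenvector_def)
  have perp: "B (\<phi> n) (\<phi> m) = 0" if "m < n" for m n using good[of n] that by (auto simp: good_def S_eq)
  have orth: "orthonormal \<phi>"
    unfolding orthonormal_def
  proof (intro conjI allI)
    fix m n show "B (\<phi> m) (\<phi> n) = (if m = n then 1 else 0)"
    proof (cases m n rule: linorder_cases)
      case less then show ?thesis using perp[of m n] B_commute[of "\<phi> m" "\<phi> n"] by simp
    next
      case equal then show ?thesis using good[of n] by (simp add: good_def)
    next
      case greater then show ?thesis using perp[of n m] by simp
    qed
  qed simp
  have bound: "B (K x) x \<le> \<kappa> n * B x x" if "x \<in> V" "\<And>m. m < n \<Longrightarrow> B x (\<phi> m) = 0" for x n
    using good[of n] that by (auto simp: good_def S_eq)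
  \<comment> \<open>\<open>\<phi> (Suc n)\<close> is orthogonal to the first n vectors too, so it
    competes in the maximum behind \<open>\<kappa> n\<close>.\<close>
  have dec: "decseq \<kappa>"
  proof (rule decseq_SucI)
    fix n
    have "B (K (\<phi> (Suc n))) (\<phi> (Suc n)) \<le> \<kappa> n * B (\<phi> (Suc n)) (\<phi> (Suc n))"
      by (rule bound) (auto simp: perp)
    then show "\<kappa> (Suc n) \<le> \<kappa> n" using eigenvector_inner[OF eig(1)] orth by (simp add: orthonormal_def)
  qed
  \<comment> \<open>If the limit L were positive, the images under \<open>K\<close> of distinct
    eigenvectors would have squared distance at least 2 L^2. A convergent subsequence brings two of
    them within L^2 / 2 of its limit, and the doubling in \<open>square_diff_le\<close> still leaves
    less than 2 L^2.\<close>
  have lim: "\<kappa> \<longlonglongrightarrow> 0"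
  proof (rule ccontr)
    assume no: "\<not> ?thesis"
    obtain L where L: "\<kappa> \<longlonglongrightarrow> L" "\<And>n. L \<le> \<kappa> n"
      using decseq_convergent[OF dec, of 0] eig(2) by (metis less_imp_le)
    have "L > 0" using no L LIMSEQ_le_const[OF L(1), of 0] eig(2) by (metis less_eq_real_def)
    obtain r g where r: "strict_mono (r::nat\<Rightarrow>nat)" "g \<in> V" and 
      g: "(\<lambda>n. B (K (\<phi> (r n)) - g) (K (\<phi> (r n)) - g)) \<longlonglongrightarrow> 0"
      using K_compact[of \<phi>] orth by (auto simp: orthonormal_def)
    have "\<forall>\<^sub>F n in sequentially. B (K (\<phi> (r n)) - g) (K (\<phi> (r n)) - g) < L\<^sup>2 / 2"
      using g \<open>L > 0\<close> by (intro order_tendstoD(2)[OF g]) auto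
    then obtain n where n: "\<And>m. m \<ge> n \<Longrightarrow> B (K (\<phi> (r m)) - g) (K (\<phi> (r m)) - g) < L\<^sup>2 / 2"
      by (auto simp: eventually_sequentially)
    have "r n < r (Suc n)" using r by (simp add: strict_mono_def)
    let ?a = "\<phi> (r n)" and ?b = "\<phi> (r (Suc n))"
    have "B (K ?a - K ?b) (K ?a - K ?b) = (\<kappa> (r n))\<^sup>2 + (\<kappa> (r (Suc n)))\<^sup>2"
      using orth \<open>r n < r (Suc n)\<close>
      by (simp add: B_diff B_diff_right eigenvector_inner[OF eig(1)] B_commute[of "\<phi> _" "K _"] orthonormal_def power2_eq_square)
    moreover have L2: "L\<^sup>2 \<le> (\<kappa> k)\<^sup>2" for k using L(2) \<open>L > 0\<close> by (intro power_mono) auto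
    ultimately have "L\<^sup>2 + L\<^sup>2 \<le> B (K ?a - K ?b) (K ?a - K ?b)"
      using add_mono[OF L2[of "r n"] L2[of "r (Suc n)"]] by simp
    also have "\<dots> \<le> 2 * B (K ?a - g) (K ?a - g) + 2 * B (g - K ?b) (g - K ?b)"
      using r by (intro square_diff_le) auto
    also have "\<dots> < L\<^sup>2 + L\<^sup>2"
      using n[of n] n[of "Suc n"] r by (simp add: square_diff_commute[of g])
    finally show False by simp
  qed
  show ?thesis
  proof (rule that[OF orth eig dec lim])
    fix f assume f: "f \<in> V"
    have summ: "summable (\<lambda>n. (B f (\<phi> n))\<^sup>2)"
      by (rule summableI_nonneg_bounded[where x = "B f f"]) (use Bessel[OF orth f] in simp_all)
    obtain g where g: "g \<in> V"
      "(\<lambda>N. B (g - (\<Sum>n<N. B f (\<phi> n) *\<^sub>R \<phi> n)) (g - (\<Sum>n<N. B f (\<phi> n) *\<^sub>R \<phi> n))) \<longlonglongrightarrow> 0"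
      "\<And>n. B g (\<phi> n) = B f (\<phi> n)" by (rule Riesz_Fischer[OF orth summ]) blast
    let ?s = "\<lambda>N. \<Sum>n<N. B f (\<phi> n) *\<^sub>R \<phi> n"
    have h: "f - g \<in> V" using f g by simp
    have "B (K (f - g)) (f - g) \<le> \<kappa> n * B (f - g) (f - g)" for n
      using f g by (intro bound) (auto simp: B_diff)
    moreover have "(\<lambda>n. \<kappa> n * B (f - g) (f - g)) \<longlonglongrightarrow> 0" using tendsto_mult_left_zero[OF lim] by simp
    ultimately have "B (K (f - g)) (f - g) \<le> 0" by (intro LIMSEQ_le_const) auto
    then have null: "B (f - g) (f - g) = 0" using quadratic_pos[OF h] by force
    have "B (f - ?s N) (f - ?s N) = B (g - ?s N) (g - ?s N)" for N
    proof -
      have s: "g - ?s N \<in> V" using g by simp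
      have "f - ?s N = (f - g) + (g - ?s N)" by simp
      then have "B (f - ?s N) (f - ?s N) = B ((f - g) + (g - ?s N)) ((f - g) + (g - ?s N))" by simp
      also have "\<dots> = B (g - ?s N) (g - ?s N)"
        unfolding B_add[OF h s V_closed(2)[OF h s]] B_add_right[OF h s h] B_add_right[OF h s s]
        using null null_left[OF h s null] B_commute[OF h s] by simp
      finally show ?thesis .
    qed
    then show "(\<lambda>N. B (f - ?s N) (f - ?s N)) \<longlonglongrightarrow> 0" using g(2) by simp
  qed
qed

end

section \<open>Square integrable functions\<close>

text \<open>Applied twice, this instance turns the families of functions indexed by edges into a
  real vector space with pointwise operations.\<close>

instantiation "fun" :: (type, real_vector) real_vector
begin

definition scaleR_fun :: "real \<Rightarrow> ('a \<Rightarrow> 'b) \<Rightarrow> 'a \<Rightarrow> 'b" where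
  "scaleR_fun c f = (\<lambda>x. c *\<^sub>R f x)"

instance
  by standard (simp_all add: scaleR_fun_def fun_eq_iff scaleR_add_right scaleR_add_left)

end

lemma scaleR_fun_apply [simp]: "(c *\<^sub>R f) x = c *\<^sub>R f x"
  by (simp add: scaleR_fun_def)

lemma sum_fun_apply: "sum f I x = (\<Sum>i\<in>I. f i x)"
  by (induction I rule: infinite_finite_induct) auto

definition L2_space :: "'a measure \<Rightarrow> ('a \<Rightarrow> real) set" where
  "L2_space M = {f. f \<in> borel_measurable M \<and> integrable M (\<lambda>x. (f x)\<^sup>2)}"

lemma L2_spaceD:
  assumes "f \<in> L2_space M"
  shows "f \<in> borel_measurable M" "integrable M (\<lambda>x. (f x)\<^sup>2)"
  using assms by (auto simp: L2_space_def)

lemma L2_integrable_mult: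
  assumes "f \<in> L2_space M" "g \<in> L2_space M"
  shows "integrable M (\<lambda>x. f x * g x)"
proof (rule Bochner_Integration.integrable_bound)
  show "integrable M (\<lambda>x. (f x)\<^sup>2 + (g x)\<^sup>2)" using assms by (auto dest: L2_spaceD)
  show "(\<lambda>x. f x * g x) \<in> borel_measurable M" using assms[THEN L2_spaceD(1)] by measurable
  show "AE x in M. norm (f x * g x) \<le> norm ((f x)\<^sup>2 + (g x)\<^sup>2)"
  proof (rule AE_I2)
    fix x
    have "2 * (\<bar>f x\<bar> * \<bar>g x\<bar>) \<le> (f x)\<^sup>2 + (g x)\<^sup>2"
      using sum_squares_bound[of "\<bar>f x\<bar>" "\<bar>g x\<bar>"] by (simp add: mult.assoc)
    moreover have "0 \<le> \<bar>f x\<bar> * \<bar>g x\<bar>" by simp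
    ultimately have "\<bar>f x * g x\<bar> \<le> (f x)\<^sup>2 + (g x)\<^sup>2"
      unfolding abs_mult by linarith
    then show "norm (f x * g x) \<le> norm ((f x)\<^sup>2 + (g x)\<^sup>2)" by simp
  qed
qed

lemma L2_add:
  assumes "f \<in> L2_space M" "g \<in> L2_space M" shows "(\<lambda>x. f x + g x) \<in> L2_space M"
proof -
  have [measurable]: "f \<in> borel_measurable M" "g \<in> borel_measurable M" using assms by (auto dest: L2_spaceD)
  have "integrable M (\<lambda>x. (f x)\<^sup>2 + (g x)\<^sup>2 + 2 * (f x * g x))"
    using assms by (intro Bochner_Integration.integrable_add integrable_mult_right L2_integrable_mult L2_spaceD)
  then show ?thesis by (simp add: L2_space_def power2_sum mult.assoc)
qed

lemma L2_scale: "f \<in> L2_space M \<Longrightarrow> (\<lambda>x. c * f x) \<in> L2_space M"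
  by (auto simp: L2_space_def power_mult_distrib)

lemma L2_diff: "f \<in> L2_space M \<Longrightarrow> g \<in> L2_space M \<Longrightarrow> (\<lambda>x. f x - g x) \<in> L2_space M"
  using L2_add[of f M "\<lambda>x. -1 * g x"] L2_scale[of g M "-1"] by simp

lemma (in finite_measure) L2_const [simp]: "(\<lambda>x. c) \<in> L2_space M"
  by (simp add: L2_space_def)

lemma (in finite_measure) L2_integrable:
  assumes "f \<in> L2_space M" shows "integrable M f"
  using L2_integrable_mult[OF assms L2_const[of 1]] by simp

text \<open>A subsequence with summable steps converges almost everywhere; Fatou's lemma bounds the distance to its limit.\<close>

lemma (in finite_measure) L2_complete:
  assumes s: "\<And>n. s n \<in> L2_space M"
    and Cauchy: "\<And>e. 0 < e \<Longrightarrow> \<exists>N. \<forall>m\<ge>N. \<forall>n\<ge>N. (\<integral>x. (s m x - s n x)\<^sup>2 \<partial>M) < e"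
  obtains g where "g \<in> L2_space M" "(\<lambda>n. \<integral>x. (s n x - g x)\<^sup>2 \<partial>M) \<longlonglongrightarrow> 0"
proof -
  have [measurable]: "s n \<in> borel_measurable M" for n using s by (auto dest: L2_spaceD)
  have int: "integrable M (\<lambda>x. (s m x - s n x)\<^sup>2)" for m n
    using L2_diff[OF s s] by (rule L2_spaceD)
  \<comment> \<open>The rate (1/4)^k leaves room for the factor 2^k that the passage from squares to
    absolute values costs in \<open>d1\<close>.\<close>
  have "\<forall>k. \<exists>N. \<forall>m\<ge>N. \<forall>n\<ge>N. (\<integral>x. (s m x - s n x)\<^sup>2 \<partial>M) < (1/4)^k"
    by (intro allI Cauchy) simp
  then obtain N where N: "\<And>k m n. m \<ge> N k \<Longrightarrow> n \<ge> N k \<Longrightarrow> (\<integral>x. (s m x - s n x)\<^sup>2 \<partial>M) < (1/4)^k"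
    by metis
  \<comment> \<open>The sum makes \<open>r\<close> monotone and at least \<open>N k\<close>; the
    added k makes it tend to infinity.\<close>
  define r where "r k = (\<Sum>j\<le>k. N j) + k" for k
  have rN: "N k \<le> r k" for k unfolding r_def by (simp add: atMost_Suc trans_le_add1 member_le_sum)
  have r_mono: "r k \<le> r (Suc k)" for k by (simp add: r_def)
  have r_ge: "k \<le> r k" for k by (simp add: r_def)
  define d where "d k x = s (r (Suc k)) x - s (r k) x" for k x
  have [measurable]: "d k \<in> borel_measurable M" for k unfolding d_def by measurable
  have d2: "(\<integral>x. (d k x)\<^sup>2 \<partial>M) < (1/4)^k" for k
    unfolding d_def using rN[of k] r_mono[of k] by (intro N) auto
  have intd2: "integrable M (\<lambda>x. (d k x)\<^sup>2)" for k unfolding d_def by (rule int)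
  have d1: "\<bar>d k x\<bar> \<le> 2^k * (d k x)\<^sup>2 + (1/2)^k" for k x
  proof -
    have "2 * (2^k * \<bar>d k x\<bar>) * 1 \<le> (2^k * \<bar>d k x\<bar>)\<^sup>2 + 1\<^sup>2"
      using sum_squares_bound[of "2^k * \<bar>d k x\<bar>" 1] by simp
    then have "2^k * \<bar>d k x\<bar> \<le> (2^k * \<bar>d k x\<bar>)\<^sup>2 + 1" by (smt (verit) zero_le_mult_iff abs_ge_zero zero_le_power one_power2)
    then have "2^k * \<bar>d k x\<bar> \<le> 2^k * (2^k * (d k x)\<^sup>2 + (1/2)^k)"
      by (simp add: power_mult_distrib power2_eq_square algebra_simps power_one_over)
    then show ?thesis by simp
  qed
  have intd1: "integrable M (\<lambda>x. \<bar>d k x\<bar>)" for k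
  proof (rule Bochner_Integration.integrable_bound)
    show "integrable M (\<lambda>x. 2^k * (d k x)\<^sup>2 + (1/2)^k)" using intd2[of k] by simp
    show "AE x in M. norm \<bar>d k x\<bar> \<le> norm (2^k * (d k x)\<^sup>2 + (1/2)^k)"
      using order_trans[OF d1 abs_ge_self] by (intro AE_I2) simp
  qed measurable
  have l1: "(\<integral>x. \<bar>d k x\<bar> \<partial>M) \<le> (1 + measure M (space M)) * (1/2)^k" for k
  proof -
    have "(\<integral>x. \<bar>d k x\<bar> \<partial>M) \<le> (\<integral>x. 2^k * (d k x)\<^sup>2 + (1/2)^k \<partial>M)"
      using intd1 intd2 d1 by (intro integral_mono) auto
    also have "\<dots> = 2^k * (\<integral>x. (d k x)\<^sup>2 \<partial>M) + (1/2)^k * measure M (space M)"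
      using intd2 by (subst Bochner_Integration.integral_add) auto
    also have "\<dots> \<le> 2^k * (1/4)^k + (1/2)^k * measure M (space M)"
      using less_imp_le[OF d2[of k]] by (intro add_right_mono mult_left_mono) auto
    also have "(2::real)^k * (1/4)^k = (1/2)^k" by (simp flip: power_mult_distrib)
    finally show ?thesis by (simp add: algebra_simps)
  qed
  have "(\<integral>\<^sup>+x. (\<Sum>k. ennreal \<bar>d k x\<bar>) \<partial>M) = (\<Sum>k. \<integral>\<^sup>+x. ennreal \<bar>d k x\<bar> \<partial>M)"
    by (rule nn_integral_suminf) measurable
  also have "\<dots> = (\<Sum>k. ennreal (\<integral>x. \<bar>d k x\<bar> \<partial>M))"
    using intd1 by (simp add: nn_integral_eq_integral)
  also have "\<dots> \<le> (\<Sum>k. ennreal ((1 + measure M (space M)) * (1/2)^k))"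
    using l1 by (intro suminf_le ennreal_leI) auto
  also have "\<dots> = ennreal (\<Sum>k. (1 + measure M (space M)) * (1/2)^k)"
    by (rule suminf_ennreal2) (auto intro!: summable_mult)
  also have "\<dots> < \<infinity>" by simp
  finally have "AE x in M. (\<Sum>k. ennreal \<bar>d k x\<bar>) \<noteq> \<infinity>"
    by (intro nn_integral_PInf_AE) auto
  then have conv: "AE x in M. (\<lambda>k. s (r k) x) \<longlonglongrightarrow> lim (\<lambda>k. s (r k) x)"
  proof eventually_elim
    case (elim x)
    then have "summable (\<lambda>k. \<bar>d k x\<bar>)" by (intro summable_suminf_not_top) auto
    then have "summable (\<lambda>k. d k x)" by (rule summable_rabs_cancel)
    then have "(\<lambda>n. \<Sum>k<n. d k x) \<longlonglongrightarrow> (\<Sum>k. d k x)" by (rule summable_LIMSEQ)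
    moreover have "(\<Sum>k<n. d k x) = s (r n) x - s (r 0) x" for n
      unfolding d_def by (induction n) auto
    ultimately have "(\<lambda>n. s (r n) x - s (r 0) x + s (r 0) x) \<longlonglongrightarrow> (\<Sum>k. d k x) + s (r 0) x"
      by (intro tendsto_intros) simp
    then have "convergent (\<lambda>n. s (r n) x)" by (auto simp: convergent_def)
    then show ?case by (simp add: convergent_LIMSEQ_iff)
  qed
  \<comment> \<open>Where the subsequence diverges, \<open>lim\<close> is an unspecified value; by
    \<open>conv\<close> this happens only on a null set.\<close>
  define g where "g x = lim (\<lambda>k. s (r k) x)" for x
  have [measurable]: "g \<in> borel_measurable M" unfolding g_def by measurable
  have key: "(\<integral>\<^sup>+x. ennreal ((s n x - g x)\<^sup>2) \<partial>M) \<le> ennreal e"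
    if n: "n \<ge> M0" and M0: "\<forall>m\<ge>M0. \<forall>n\<ge>M0. (\<integral>x. (s m x - s n x)\<^sup>2 \<partial>M) < e" for e n M0
  proof -
    have "(\<integral>\<^sup>+x. ennreal ((s n x - g x)\<^sup>2) \<partial>M) = (\<integral>\<^sup>+x. liminf (\<lambda>k. ennreal ((s n x - s (r k) x)\<^sup>2)) \<partial>M)"
      using conv
    proof (intro nn_integral_cong_AE, eventually_elim)
      case (elim x)
      then have "(\<lambda>k. ennreal ((s n x - s (r k) x)\<^sup>2)) \<longlonglongrightarrow> ennreal ((s n x - g x)\<^sup>2)"
        unfolding g_def by (intro tendsto_ennrealI tendsto_intros)
      then show ?case by (rule lim_imp_Liminf[OF trivial_limit_sequentially, symmetric])
    qed
    also have "\<dots> \<le> liminf (\<lambda>k. \<integral>\<^sup>+x. ennreal ((s n x - s (r k) x)\<^sup>2) \<partial>M)"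
      by (rule nn_integral_liminf) measurable
    also have "\<dots> = liminf (\<lambda>k. ennreal (\<integral>x. (s n x - s (r k) x)\<^sup>2 \<partial>M))"
      using int by (simp add: nn_integral_eq_integral)
    also have "\<dots> \<le> liminf (\<lambda>k. ennreal e)"
    proof (rule Liminf_mono)
      show "\<forall>\<^sub>F k in sequentially. ennreal (\<integral>x. (s n x - s (r k) x)\<^sup>2 \<partial>M) \<le> ennreal e"
        using eventually_ge_at_top[of M0]
      proof eventually_elim
        case (elim k)
        then have "r k \<ge> M0" using r_ge[of k] by simp
        then show ?case using M0 n by (intro ennreal_leI less_imp_le) auto
      qed
    qed
    finally show ?thesis by (simp add: Liminf_const)
  qed
  have L2d: "(\<lambda>x. s n x - g x) \<in> L2_space M" if "n \<ge> M0"
    "\<forall>m\<ge>M0. \<forall>n\<ge>M0. (\<integral>x. (s m x - s n x)\<^sup>2 \<partial>M) < e" for n e M0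
  proof -
    have "(\<integral>\<^sup>+x. ennreal (norm ((s n x - g x)\<^sup>2)) \<partial>M) < \<infinity>"
      using key[OF that] by (simp add: le_less_trans)
    then show ?thesis by (auto simp: L2_space_def integrable_iff_bounded)
  qed
  obtain M1 where M1: "\<forall>m\<ge>M1. \<forall>n\<ge>M1. (\<integral>x. (s m x - s n x)\<^sup>2 \<partial>M) < 1" using Cauchy[of 1] by auto
  have gL2: "g \<in> L2_space M" using L2_diff[OF s[of M1] L2d[OF order_refl M1]] by simp
  show ?thesis
  proof (rule that[OF gL2])
    show "(\<lambda>n. \<integral>x. (s n x - g x)\<^sup>2 \<partial>M) \<longlonglongrightarrow> 0"
    proof (rule LIMSEQ_I)
      fix e :: real assume "0 < e"
      then obtain M0 where M0: "\<forall>m\<ge>M0. \<forall>n\<ge>M0. (\<integral>x. (s m x - s n x)\<^sup>2 \<partial>M) < e / 2"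
        using Cauchy[of "e/2"] by auto
      have "norm ((\<integral>x. (s n x - g x)\<^sup>2 \<partial>M) - 0) < e" if n: "n \<ge> M0" for n
      proof -
        have "ennreal (\<integral>x. (s n x - g x)\<^sup>2 \<partial>M) \<le> ennreal (e / 2)"
          using key[OF n M0] L2_spaceD(2)[OF L2_diff[OF s gL2]] by (simp add: nn_integral_eq_integral)
        then have "(\<integral>x. (s n x - g x)\<^sup>2 \<partial>M) \<le> e / 2" using \<open>0 < e\<close> by (simp add: ennreal_le_iff)
        then show ?thesis using \<open>0 < e\<close> by simp
      qed
      then show "\<exists>no. \<forall>n\<ge>no. norm ((\<integral>x. (s n x - g x)\<^sup>2 \<partial>M) - 0) < e" by blast
    qed
  qed
qed

lemma L2_family_complete_semi_inner_space:
  fixes M :: "'e \<Rightarrow> 'x measure"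
  assumes "finite A" and M: "\<And>e. e \<in> A \<Longrightarrow> finite_measure (M e)"
  shows "complete_semi_inner_space {f. \<forall>e\<in>A. f e \<in> L2_space (M e)} (\<lambda>f g. \<Sum>e\<in>A. \<integral>x. f e x * g e x \<partial>M e)"
    (is "complete_semi_inner_space ?V ?B")
proof
  show "subspace ?V"
    by (auto simp: subspace_def plus_fun_def zero_fun_def scaleR_fun_def L2_add L2_scale finite_measure.L2_const[OF M])
  show "?B (x + y) z = ?B x z + ?B y z" if "x \<in> ?V" "y \<in> ?V" "z \<in> ?V" for x y z
  proof -
    have "(\<integral>t. (x + y) e t * z e t \<partial>M e) = (\<integral>t. x e t * z e t \<partial>M e) + (\<integral>t. y e t * z e t \<partial>M e)" if "e \<in> A" for e
      using that \<open>x \<in> ?V\<close> \<open>y \<in> ?V\<close> \<open>z \<in> ?V\<close>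
      by (auto simp: distrib_right intro!: Bochner_Integration.integral_add L2_integrable_mult)
    then show ?thesis by (simp add: sum.distrib)
  qed
  show "?B (c *\<^sub>R x) z = c * ?B x z" for c x z
    by (simp add: sum_distrib_left mult.assoc)
  show "?B x y = ?B y x" for x y by (simp add: mult.commute)
  show "0 \<le> ?B x x" for x by (intro sum_nonneg integral_nonneg) simp
  fix s :: "nat \<Rightarrow> 'e \<Rightarrow> 'x \<Rightarrow> real"
  assume s: "\<And>n. s n \<in> ?V" and Cauchy: "\<And>e. 0 < e \<Longrightarrow> \<exists>N. \<forall>m\<ge>N. \<forall>n\<ge>N. ?B (s m - s n) (s m - s n) < e"
  have "\<exists>g. g \<in> L2_space (M a) \<and> (\<lambda>n. \<integral>x. (s n a x - g x)\<^sup>2 \<partial>M a) \<longlonglongrightarrow> 0" if a: "a \<in> A" for a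
  proof -
    interpret finite_measure "M a" using M a by simp
    have "\<exists>N. \<forall>m\<ge>N. \<forall>n\<ge>N. (\<integral>x. (s m a x - s n a x)\<^sup>2 \<partial>M a) < e" if "0 < e" for e
    proof -
      obtain N where N: "\<And>m n. m\<ge>N \<Longrightarrow> n\<ge>N \<Longrightarrow> ?B (s m - s n) (s m - s n) < e" using Cauchy[OF \<open>0 < e\<close>] by blast
      have "(\<integral>x. (s m a x - s n a x)\<^sup>2 \<partial>M a) \<le> ?B (s m - s n) (s m - s n)" for m n
        using member_le_sum[OF a, of "\<lambda>b. \<integral>x. (s m - s n) b x * (s m - s n) b x \<partial>M b"] \<open>finite A\<close>
        by (simp add: power2_eq_square)
      then show ?thesis using N by (meson le_less_trans)
    qed
    moreover have "s n a \<in> L2_space (M a)" for n using s a by simp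
    ultimately obtain g where "g \<in> L2_space (M a)" "(\<lambda>n. \<integral>x. (s n a x - g x)\<^sup>2 \<partial>M a) \<longlonglongrightarrow> 0"
      using L2_complete[of "\<lambda>n. s n a"] by blast
    then show ?thesis by blast
  qed
  then have "\<exists>g. \<forall>a\<in>A. g a \<in> L2_space (M a) \<and> (\<lambda>n. \<integral>x. (s n a x - g a x)\<^sup>2 \<partial>M a) \<longlonglongrightarrow> 0"
    by (intro bchoice ballI)
  then obtain g where g: "\<And>a. a \<in> A \<Longrightarrow> g a \<in> L2_space (M a)"
    "\<And>a. a \<in> A \<Longrightarrow> (\<lambda>n. \<integral>x. (s n a x - g a x)\<^sup>2 \<partial>M a) \<longlonglongrightarrow> 0" by blast
  have "(\<lambda>n. ?B (s n - g) (s n - g)) \<longlonglongrightarrow> (\<Sum>a\<in>A. 0)"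
    using g(2) by (intro tendsto_sum) (simp add: power2_eq_square)
  then show "\<exists>g\<in>?V. (\<lambda>n. ?B (s n - g) (s n - g)) \<longlonglongrightarrow> 0" using g(1) by auto
qed

section \<open>Integration by parts on an interval\<close>

lemma L2_interval_eq: "L2_interval l = L2_space (lebesgue_on {0..l})"
  by (simp add: L2_interval_def L2_space_def)

lemma finite_measure_lebesgue_on_interval: "finite_measure (lebesgue_on {a..b::real})"
  by (rule finite_measure_lebesgue_on) simp

lemma L2_interval_integrable: "h \<in> L2_interval l \<Longrightarrow> integrable (lebesgue_on {0..l}) h"
  using finite_measure.L2_integrable[OF finite_measure_lebesgue_on_interval] by (simp add: L2_interval_eq)

lemma continuous_on_imp_L2_interval:
  assumes "continuous_on {0..l} f" shows "f \<in> L2_interval l"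
  using assms by (auto simp: L2_interval_def intro!: continuous_imp_measurable_on_sets_lebesgue
      continuous_imp_integrable_real continuous_intros)

text \<open>Indefinite integrals from 0 get evaluated at 0, where the simplifier turns
  \<open>{0..0}\<close> into \<open>{0}\<close>.\<close>

lemma lebesgue_on_singleton_integral [simp]: "(\<integral>t. f t \<partial>lebesgue_on {a::real}) = (0::real)"
  by (rule integral_eq_zero_null_sets) simp

lemma interval_FTC:
  assumes "x \<le> y" and u: "\<And>t. t \<in> {x..y} \<Longrightarrow> (u has_real_derivative u' t) (at t within {x..y})"
    and u': "continuous_on {x..y} u'"
  shows "(\<integral>t. u' t \<partial>lebesgue_on {x..y}) = u y - u x"
proof -
  have "(u' has_integral (u y - u x)) {x..y}"
    using assms by (intro fundamental_theorem_of_calculus) (auto simp: has_real_derivative_iff_has_vector_derivative)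
  then show ?thesis
    using lebesgue_integral_eq_integral[OF continuous_imp_integrable_real[OF u']] by (simp add: integral_unique)
qed

lemma indefinite_integral_has_derivative:
  assumes g: "continuous_on {0..l} g" and "x \<in> {0..l}"
  shows "((\<lambda>x. \<integral>t. g t \<partial>lebesgue_on {0..x}) has_real_derivative g x) (at x within {0..l})"
proof -
  have D: "((\<lambda>x. integral {0..x} g) has_real_derivative g x) (at x within {0..l})"
    using assms by (rule integral_has_real_derivative)
  have E: "(\<integral>t. g t \<partial>lebesgue_on {0..y}) = integral {0..y} g" if "y \<in> {0..l}" for y
    using that continuous_on_subset[OF g, of "{0..y}"]
    by (intro lebesgue_integral_eq_integral continuous_imp_integrable_real) auto
  show ?thesis
    unfolding has_field_derivative_def
    by (rule has_derivative_transform[OF assms(2) E D[unfolded has_field_derivative_def]])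
qed

text \<open>
  Both sides agree since their difference, as a function of the right end point, has derivative
  zero: its increment over \<open>{x..y}\<close> is at most \<open>2 C (y - x)\<close> times the integral of \<open>\<bar>h\<bar>\<close> over \<open>{x..y}\<close>.
\<close>

lemma integration_by_parts_indefinite:
  fixes u u' h H :: "real \<Rightarrow> real"
  assumes l: "0 \<le> l" and h: "integrable (lebesgue_on {0..l}) h"
    and u: "\<And>x. x \<in> {0..l} \<Longrightarrow> (u has_real_derivative u' x) (at x within {0..l})"
    and u': "continuous_on {0..l} u'"
    and H: "\<And>x. x \<in> {0..l} \<Longrightarrow> H x = H 0 + (\<integral>t. h t \<partial>lebesgue_on {0..x})"
  shows "(\<integral>t. u t * h t \<partial>lebesgue_on {0..l}) = u l * H l - u 0 * H 0 - (\<integral>t. u' t * H t \<partial>lebesgue_on {0..l})"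
proof -
  have cont_u: "continuous_on {0..l} u" using u by (rule DERIV_continuous_on)
  have "continuous_on {0..l} (\<lambda>x. H 0 + (\<integral>t. h t \<partial>lebesgue_on {0..x}))"
    by (intro continuous_intros indefinite_integral_continuous_real h)
  then have cont_H: "continuous_on {0..l} H" by (rule continuous_on_eq) (rule H[symmetric])
  have habs: "integrable (lebesgue_on {0..l}) (\<lambda>t. \<bar>h t\<bar>)" using h by simp
  obtain C where C: "\<And>x. x \<in> {0..l} \<Longrightarrow> \<bar>u' x\<bar> \<le> C" "0 \<le> C"
  proof -
    have "bounded (u' ` {0..l})" by (intro compact_imp_bounded compact_continuous_image u') simp
    then obtain C0 where C0: "\<forall>x\<in>{0..l}. \<bar>u' x\<bar> \<le> C0" by (auto simp: bounded_iff)
    show ?thesis by (rule that[of "\<bar>C0\<bar>"]) (use C0 in force)+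
  qed
  have uh: "integrable (lebesgue_on {0..l}) (\<lambda>t. v t * h t)" if v: "continuous_on {0..l} v" for v
  proof (rule absolutely_integrable_imp_integrable[OF absolutely_integrable_bounded_measurable_product_real])
    show "v \<in> borel_measurable (lebesgue_on {0..l})" using v by (intro continuous_imp_measurable_on_sets_lebesgue) auto
    show "bounded (v ` {0..l})" by (intro compact_imp_bounded compact_continuous_image v) simp
    show "h absolutely_integrable_on {0..l}"
      using h by (simp add: absolutely_integrable_on_def set_integrable_def integrable_restrict_space)
  qed auto
  define G where "G x = (\<integral>t. \<bar>h t\<bar> \<partial>lebesgue_on {0..x})" for x
  have cont_G: "continuous_on {0..l} G" unfolding G_def by (rule indefinite_integral_continuous_real[OF habs])
  define \<Phi> where "\<Phi> x = (\<integral>t. u t * h t \<partial>lebesgue_on {0..x}) - u x * H x + (\<integral>t. u' t * H t \<partial>lebesgue_on {0..x})" for x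
  have incr: "\<bar>\<Phi> y - \<Phi> x\<bar> \<le> 2 * C * (y - x) * (G y - G x)" if xy: "0 \<le> x" "x \<le> y" "y \<le> l" for x y
  proof -
    have sub: "{x..y} \<subseteq> {0..l}" using xy by auto
    have split: "(\<integral>t. f t \<partial>lebesgue_on {0..y}) - (\<integral>t. f t \<partial>lebesgue_on {0..x}) = (\<integral>t. f t \<partial>lebesgue_on {x..y})"
      if "integrable (lebesgue_on {0..l}) f" for f :: "real \<Rightarrow> real"
      using integral_combine[of 0 y f x] integrable_subinterval[OF that, of 0 y] xy by simp
    have int_h: "integrable (lebesgue_on {x..y}) h" using h sub by (rule integrable_subinterval)
    have int_habs: "integrable (lebesgue_on {x..y}) (\<lambda>t. \<bar>h t\<bar>)" using habs sub by (rule integrable_subinterval)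
    have int_uh: "integrable (lebesgue_on {x..y}) (\<lambda>t. u t * h t)" using uh[OF cont_u] sub by (rule integrable_subinterval)
    have int_u'H: "integrable (lebesgue_on {x..y}) (\<lambda>t. u' t * H t)"
      by (intro continuous_imp_integrable_real continuous_intros continuous_on_subset[OF _ sub] u' cont_H)
    have int_u': "integrable (lebesgue_on {x..y}) u'"
      by (intro continuous_imp_integrable_real continuous_on_subset[OF u' sub])
    have du: "(\<integral>t. u' t \<partial>lebesgue_on {x..y}) = u y - u x"
      using xy sub by (intro interval_FTC continuous_on_subset[OF u' sub] DERIV_subset[OF u]) auto
    have GG: "G y - G x = (\<integral>t. \<bar>h t\<bar> \<partial>lebesgue_on {x..y})" unfolding G_def by (rule split[OF habs])
    have Gnonneg: "0 \<le> G y - G x" unfolding GG by simp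
    have "H y - H x = (\<integral>t. h t \<partial>lebesgue_on {0..y}) - (\<integral>t. h t \<partial>lebesgue_on {0..x})"
      using H[of y] H[of x] xy by simp
    then have HH: "H y - H x = (\<integral>t. h t \<partial>lebesgue_on {x..y})" using split[OF h] by simp
    \<comment> \<open>The increment of the product u H is exactly u y (H y - H x) + H x (u y - u x),
      with \<open>u\<close> frozen at the right end point and \<open>H\<close> at the left one. Two
      integrals containing a difference remain, each at most C (y - x) (G y - G x).\<close>
    have e1: "(\<integral>t. (u t - u y) * h t \<partial>lebesgue_on {x..y}) = (\<integral>t. u t * h t \<partial>lebesgue_on {x..y}) - u y * (H y - H x)"
      unfolding HH left_diff_distrib using int_uh int_h by (subst Bochner_Integration.integral_diff) auto
    have e2: "(\<integral>t. u' t * (H t - H x) \<partial>lebesgue_on {x..y}) = (\<integral>t. u' t * H t \<partial>lebesgue_on {x..y}) - H x * (u y - u x)"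
      unfolding du[symmetric] right_diff_distrib using int_u'H int_u' by (subst Bochner_Integration.integral_diff) (auto simp: mult.commute)
    have s1: "(\<integral>t. u t * h t \<partial>lebesgue_on {0..y}) - (\<integral>t. u t * h t \<partial>lebesgue_on {0..x}) = (\<integral>t. u t * h t \<partial>lebesgue_on {x..y})"
      by (rule split[OF uh[OF cont_u]])
    have s2: "(\<integral>t. u' t * H t \<partial>lebesgue_on {0..y}) - (\<integral>t. u' t * H t \<partial>lebesgue_on {0..x}) = (\<integral>t. u' t * H t \<partial>lebesgue_on {x..y})"
      by (intro split continuous_imp_integrable_real continuous_intros u' cont_H)
    have eq: "\<Phi> y - \<Phi> x = (\<integral>t. (u t - u y) * h t \<partial>lebesgue_on {x..y}) + (\<integral>t. u' t * (H t - H x) \<partial>lebesgue_on {x..y})"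
      unfolding e1 e2 s1[symmetric] s2[symmetric] by (simp add: \<Phi>_def algebra_simps)
    have Lip: "\<bar>u t - u y\<bar> \<le> C * (y - x)" if t: "t \<in> {x..y}" for t
    proof -
      have "norm (u t - u y) \<le> C * norm (t - y)"
        using t sub C by (intro field_differentiable_bound[of "{x..y}" u u' C] DERIV_subset[OF u]) auto
      also have "\<dots> \<le> C * (y - x)" using t C(2) by (intro mult_left_mono) auto
      finally show ?thesis by simp
    qed
    have Hosc: "\<bar>H t - H x\<bar> \<le> G y - G x" if t: "t \<in> {x..y}" for t
    proof -
      have subt: "{x..t} \<subseteq> {0..l}" "{0..t} \<subseteq> {0..l}" "{t..y} \<subseteq> {x..y}" using t xy by auto
      have "H t - H x = (\<integral>s. h s \<partial>lebesgue_on {x..t})"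
        using H[of t] H[of x] integral_combine[of 0 t h x] integrable_subinterval[OF h subt(2)] xy t by auto
      then have "\<bar>H t - H x\<bar> \<le> (\<integral>s. \<bar>h s\<bar> \<partial>lebesgue_on {x..t})"
        using integral_norm_bound[of "lebesgue_on {x..t}" h] by simp
      also have "\<dots> \<le> (\<integral>s. \<bar>h s\<bar> \<partial>lebesgue_on {x..t}) + (\<integral>s. \<bar>h s\<bar> \<partial>lebesgue_on {t..y})" by simp
      also have "\<dots> = G y - G x" unfolding GG using integral_combine[OF int_habs, of t] t by simp
      finally show ?thesis .
    qed
    have int_ud: "integrable (lebesgue_on {x..y}) (\<lambda>t. (u t - u y) * h t)"
      unfolding left_diff_distrib using int_uh int_h by simp
    have "\<bar>\<integral>t. (u t - u y) * h t \<partial>lebesgue_on {x..y}\<bar> \<le> (\<integral>t. \<bar>(u t - u y) * h t\<bar> \<partial>lebesgue_on {x..y})"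
      using integral_norm_bound[of "lebesgue_on {x..y}" "\<lambda>t. (u t - u y) * h t"] by simp
    also have "\<dots> \<le> (\<integral>t. C * (y - x) * \<bar>h t\<bar> \<partial>lebesgue_on {x..y})"
    proof (rule integral_mono[OF integrable_abs[OF int_ud]])
      show "integrable (lebesgue_on {x..y}) (\<lambda>t. C * (y - x) * \<bar>h t\<bar>)" using int_habs by simp
      fix t assume "t \<in> space (lebesgue_on {x..y})"
      then show "\<bar>(u t - u y) * h t\<bar> \<le> C * (y - x) * \<bar>h t\<bar>"
        using Lip[of t] by (simp add: abs_mult mult_right_mono)
    qed
    also have "\<dots> = C * (y - x) * (G y - G x)" unfolding GG by simp
    finally have b1: "\<bar>\<integral>t. (u t - u y) * h t \<partial>lebesgue_on {x..y}\<bar> \<le> C * (y - x) * (G y - G x)" .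
    have int_uH: "integrable (lebesgue_on {x..y}) (\<lambda>t. u' t * (H t - H x))"
      by (intro continuous_imp_integrable_real continuous_intros continuous_on_subset[OF _ sub] u' cont_H)
    have "\<bar>\<integral>t. u' t * (H t - H x) \<partial>lebesgue_on {x..y}\<bar> \<le> (\<integral>t. \<bar>u' t * (H t - H x)\<bar> \<partial>lebesgue_on {x..y})"
      using integral_norm_bound[of "lebesgue_on {x..y}" "\<lambda>t. u' t * (H t - H x)"] by simp
    also have "\<dots> \<le> (\<integral>t. C * (G y - G x) \<partial>lebesgue_on {x..y})"
    proof (rule integral_mono)
      fix t assume "t \<in> space (lebesgue_on {x..y})"
      then show "\<bar>u' t * (H t - H x)\<bar> \<le> C * (G y - G x)"
        using C(1)[of t] C(2) Hosc[of t] sub by (auto simp: abs_mult intro!: mult_mono)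
    qed (use int_uH continuous_imp_integrable_real in auto)
    also have "\<dots> = C * (y - x) * (G y - G x)"
      using xy by (simp add: measure_restrict_space)
    finally show ?thesis using b1 unfolding eq by linarith
  qed
  have "(\<Phi> has_real_derivative 0) (at x within {0..l})" if x: "x \<in> {0..l}" for x
    unfolding has_field_derivative_iff
  proof (rule Lim_null_comparison)
    show "\<forall>\<^sub>F y in at x within {0..l}. norm ((\<Phi> y - \<Phi> x) / (y - x)) \<le> 2 * C * \<bar>G y - G x\<bar>"
      unfolding eventually_at_filter
    proof (intro always_eventually allI impI)
      fix y assume y: "y \<noteq> x" "y \<in> {0..l}"
      have "\<bar>\<Phi> y - \<Phi> x\<bar> \<le> 2 * C * \<bar>y - x\<bar> * \<bar>G y - G x\<bar>"
      proof (cases "x \<le> y")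
        case True
        have "2 * C * (y - x) * (G y - G x) \<le> 2 * C * (y - x) * \<bar>G y - G x\<bar>"
          using True C(2) by (intro mult_left_mono) auto
        then show ?thesis using incr[of x y] True x y by simp
      next
        case False
        have "2 * C * (x - y) * (G x - G y) \<le> 2 * C * (x - y) * \<bar>G y - G x\<bar>"
          using False C(2) by (intro mult_left_mono) auto
        then show ?thesis using incr[of y x] False x y by (simp add: abs_minus_commute)
      qed
      then show "norm ((\<Phi> y - \<Phi> x) / (y - x)) \<le> 2 * C * \<bar>G y - G x\<bar>"
        using y by (simp add: pos_divide_le_eq mult_ac)
    qed
    have "(G \<longlongrightarrow> G x) (at x within {0..l})" using cont_G x by (simp add: continuous_on_def)
    then have "((\<lambda>y. 2 * C * \<bar>G y - G x\<bar>) \<longlongrightarrow> 2 * C * \<bar>G x - G x\<bar>) (at x within {0..l})" by (intro tendsto_intros)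
    then show "((\<lambda>y. 2 * C * \<bar>G y - G x\<bar>) \<longlongrightarrow> 0) (at x within {0..l})" by simp
  qed
  then obtain c where "\<And>x. x \<in> {0..l} \<Longrightarrow> \<Phi> x = c"
    using has_field_derivative_zero_constant[of "{0..l}" \<Phi>] by auto
  then have "\<Phi> l = \<Phi> 0" using l by simp
  then show ?thesis by (simp add: \<Phi>_def)
qed

text \<open>The integral vanishes over half-lines, and sets with this property are closed under
  complements and countable disjoint unions. Hence it vanishes over all Borel sets, and uniqueness
  of densities applies.\<close>

lemma AE_zero_if_indefinite_integral_zero:
  fixes h :: "real \<Rightarrow> real"
  assumes h: "integrable (lebesgue_on {0..l}) h"
    and zero: "\<And>x. x \<in> {0..l} \<Longrightarrow> (\<integral>t. h t \<partial>lebesgue_on {0..x}) = 0"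
  shows "AE x in lebesgue_on {0..l}. h x = 0"
proof -
  define h0 where "h0 x = (if x \<in> {0..l} then h x else 0)" for x
  have h0: "integrable lebesgue h0"
    unfolding h0_def by (rule Lebesgue_Measure.integrable_restrict_UNIV[THEN iffD2, OF _ h]) simp
  \<comment> \<open>Half-lines generate the Borel sets only, so the extension by zero is replaced by
    a Borel representative.\<close>
  obtain g where g: "g \<in> borel_measurable lborel" "AE x in lborel. h0 x = g x"
    using completion_ex_borel_measurable_real[of h0 lborel] h0 by auto
  have AE_leb: "AE x in lebesgue. h0 x = g x" using g(2) by (rule AE_completion)
  have g_leb: "g \<in> borel_measurable lebesgue" using g(1) by (rule measurable_completion)
  have g_int: "integrable lborel g"
    using h0 integrable_cong_AE[OF borel_measurable_integrable[OF h0] g_leb AE_leb] g(1)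
    by (simp add: integrable_completion)
  have set_int: "(\<integral>x\<in>A. g x \<partial>lborel) = (\<integral>x. indicator A x * h0 x \<partial>lebesgue)" if "A \<in> sets borel" for A
  proof -
    have "(\<integral>x\<in>A. g x \<partial>lborel) = (\<integral>x. indicator A x * g x \<partial>lebesgue)"
      using that g(1) by (simp add: set_lebesgue_integral_def integral_completion)
    also have "\<dots> = (\<integral>x. indicator A x * h0 x \<partial>lebesgue)"
    proof (rule integral_cong_AE)
      have [measurable]: "A \<in> sets lebesgue" using that by simp
      note [measurable] = g_leb borel_measurable_integrable[OF h0]
      show "(\<lambda>x. indicator A x * g x) \<in> borel_measurable lebesgue" by measurable
      show "(\<lambda>x. indicator A x * h0 x) \<in> borel_measurable lebesgue" by measurable
      show "AE x in lebesgue. indicator A x * g x = indicator A x * h0 x" using AE_leb by eventually_elim simp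
    qed
    finally show ?thesis .
  qed
  have atMost: "(\<integral>x\<in>{..a}. g x \<partial>lborel) = 0" for a
  proof -
    have "(\<integral>x\<in>{..a}. g x \<partial>lborel) = (\<integral>x. (if x \<in> {0..min a l} then h x else 0) \<partial>lebesgue)"
      by (subst set_int) (auto simp: h0_def indicator_def intro!: Bochner_Integration.integral_cong)
    also have "\<dots> = (\<integral>x. h x \<partial>lebesgue_on {0..min a l})" by (rule Lebesgue_Measure.integral_restrict_UNIV) simp
    also have "\<dots> = 0" 
    proof (cases "min a l < 0")
      case False then show ?thesis using zero[of "min a l"] by (auto simp: min_less_iff_disj)
    qed simp
    finally show ?thesis .
  qed
  have gsi: "set_integrable lborel A g" if "A \<in> sets borel" for A
    using integrable_mult_indicator[OF _ g_int] that by (simp add: set_integrable_def)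
  \<comment> \<open>The complement case needs the total integral; it is the integral over a
    half-line because \<open>h0\<close> vanishes beyond \<open>l\<close>.\<close>
  have univ: "(\<integral>x\<in>UNIV. g x \<partial>lborel) = 0"
  proof -
    have "(\<integral>x\<in>UNIV. g x \<partial>lborel) = (\<integral>x\<in>{..l}. g x \<partial>lborel)"
      by (subst (1 2) set_int) (auto simp: h0_def indicator_def intro!: Bochner_Integration.integral_cong)
    then show ?thesis using atMost by simp
  qed
  have all: "(\<integral>x\<in>A. g x \<partial>lborel) = 0" if A: "A \<in> sets borel" for A
  proof -
    have "A \<in> sigma_sets UNIV (range (\<lambda>a::real. {..a}))"
      using A by (simp add: borel_eq_atMost)
    then show ?thesis
    proof (induction A rule: sigma_sets_induct_disjoint[rotated 2, consumes 1, case_names basic empty compl union])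
      case (basic A) then show ?case using atMost by auto
    next
      case empty then show ?case by (simp add: set_lebesgue_integral_def)
    next
      case (compl A)
      then have A: "A \<in> sets borel" by (simp add: borel_eq_atMost)
      have "(\<integral>x\<in>A \<union> (UNIV - A). g x \<partial>lborel) = (\<integral>x\<in>A. g x \<partial>lborel) + (\<integral>x\<in>UNIV - A. g x \<partial>lborel)"
        using A by (intro set_integral_Un gsi) auto
      then show ?case using compl univ by simp
    next
      case (union A)
      then have A: "A i \<in> sets borel" for i by (auto simp: borel_eq_atMost)
      have "(\<integral>x\<in>(\<Union>i. A i). g x \<partial>lborel) = (\<Sum>i. (\<integral>x\<in>A i. g x \<partial>lborel))"
        using A union(1) by (intro lebesgue_integral_countable_add gsi) (auto simp: disjoint_family_on_def)
      then show ?case using union by simp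
    next
      show "Int_stable (range (\<lambda>a::real. {..a}))" by (auto simp: Int_stable_def)
    qed simp
  qed
  have "AE x in lborel. g x = 0" using g_int by (rule density_unique_real[OF _ integrable_zero]) (use all in \<open>simp add: set_lebesgue_integral_def\<close>)
  then have "AE x in lebesgue. g x = 0" by (rule AE_completion)
  then have "AE x in lebesgue. h0 x = 0" using AE_leb by eventually_elim simp
  then show ?thesis by (subst AE_restrict_space_iff) (auto simp: h0_def elim!: eventually_mono)
qed

text \<open>Cauchy-Schwarz for the integral of u', obtained by expanding the integral of (L u' -
  D)^2 with L = y - x and D = u y - u x. The resulting Hoelder bound of exponent 1/2 gives both the
  Poincare inequality and the equicontinuity for compactness.\<close>

lemma square_increment_le_energy:
  assumes u: "\<And>x. x \<in> {0..l} \<Longrightarrow> (u has_real_derivative u' x) (at x within {0..l})"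
    and u': "continuous_on {0..l} u'" and x: "x \<in> {0..l}" and y: "y \<in> {0..l}"
  shows "(u y - u x)\<^sup>2 \<le> \<bar>y - x\<bar> * (\<integral>t. (u' t)\<^sup>2 \<partial>lebesgue_on {0..l})"
proof -
  have main: "(u y - u x)\<^sup>2 \<le> (y - x) * (\<integral>t. (u' t)\<^sup>2 \<partial>lebesgue_on {0..l})" if xy: "0 \<le> x" "x < y" "y \<le> l" for x y
  proof -
    have sub: "{x..y} \<subseteq> {0..l}" using xy by auto
    have c: "continuous_on {x..y} u'" using u' sub by (rule continuous_on_subset)
    let ?D = "u y - u x" and ?L = "y - x" and ?A = "\<integral>t. (u' t)\<^sup>2 \<partial>lebesgue_on {x..y}"
    have du: "(\<integral>t. u' t \<partial>lebesgue_on {x..y}) = ?D"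
      using xy sub by (intro interval_FTC c DERIV_subset[OF u]) auto
    have i: "integrable (lebesgue_on {x..y}) u'" "integrable (lebesgue_on {x..y}) (\<lambda>t. (u' t)\<^sup>2)"
      by (intro continuous_imp_integrable_real continuous_intros c)+
    have "0 \<le> (\<integral>t. (?L * u' t - ?D)\<^sup>2 \<partial>lebesgue_on {x..y})" by simp
    also have "\<dots> = (\<integral>t. ?L\<^sup>2 * (u' t)\<^sup>2 - 2 * ?L * ?D * u' t + ?D\<^sup>2 \<partial>lebesgue_on {x..y})"
      by (intro Bochner_Integration.integral_cong refl) (simp add: power2_eq_square algebra_simps)
    also have "\<dots> = ?L\<^sup>2 * ?A - 2 * ?L * ?D * ?D + ?D\<^sup>2 * ?L"
      using i xy by (simp add: du measure_restrict_space finite_measure.integrable_const[OF finite_measure_lebesgue_on_interval])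
    also have "\<dots> = ?L * (?L * ?A - ?D\<^sup>2)" by (simp add: power2_eq_square algebra_simps)
    finally have "?D\<^sup>2 \<le> ?L * ?A" using xy by (simp add: zero_le_mult_iff)
    also have "\<dots> \<le> ?L * (\<integral>t. (u' t)\<^sup>2 \<partial>lebesgue_on {0..l})"
    proof (intro mult_left_mono)
      have i0: "integrable (lebesgue_on {0..l}) (\<lambda>t. (u' t)\<^sup>2)"
        by (intro continuous_imp_integrable_real continuous_intros u')
      have i1: "integrable (lebesgue_on {0..y}) (\<lambda>t. (u' t)\<^sup>2)" using i0 xy by (intro integrable_subinterval[OF i0]) auto
      have "0 \<le> (\<integral>t. (u' t)\<^sup>2 \<partial>lebesgue_on {0..x})" "0 \<le> (\<integral>t. (u' t)\<^sup>2 \<partial>lebesgue_on {y..l})" by simp_all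
      then show "?A \<le> (\<integral>t. (u' t)\<^sup>2 \<partial>lebesgue_on {0..l})"
        using integral_combine[OF i0, of y] integral_combine[OF i1, of x] xy by linarith
    qed (use xy in simp)
    finally show ?thesis .
  qed
  show ?thesis
  proof (cases x y rule: linorder_cases)
    case less then show ?thesis using main[of x y] x y by simp
  next
    case greater then show ?thesis using main[of y x] x y by (simp add: power2_commute)
  qed simp
qed

section \<open>Functions of class H^2 on an interval\<close>

lemma H2_intervalD:
  assumes "H2_interval l f f' f''"
  shows "\<And>x. x \<in> {0..l} \<Longrightarrow> (f has_real_derivative f' x) (at x within {0..l})"
    and "f'' \<in> L2_interval l"
    and "\<And>x. x \<in> {0..l} \<Longrightarrow> f' x = f' 0 + (\<integral>t. f'' t \<partial>lebesgue_on {0..x})"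
  using assms unfolding H2_interval_def by blast+

lemma H2_interval_continuous:
  assumes "H2_interval l f f' f''"
  shows "continuous_on {0..l} f" "continuous_on {0..l} f'"
proof -
  show "continuous_on {0..l} f" using H2_intervalD(1)[OF assms] by (rule DERIV_continuous_on)
  have "continuous_on {0..l} (\<lambda>x. f' 0 + (\<integral>t. f'' t \<partial>lebesgue_on {0..x}))"
    by (intro continuous_intros indefinite_integral_continuous_real L2_interval_integrable H2_intervalD(2)[OF assms])
  then show "continuous_on {0..l} f'"
    by (rule continuous_on_eq) (rule H2_intervalD(3)[OF assms, symmetric])
qed

text \<open>This solves -f'' = h on one edge; the value \<open>a\<close> and the slope
  \<open>c\<close> at 0 are the two constants left to match the vertex values.\<close>

lemma H2_interval_double_integral:
  assumes "h \<in> L2_interval l"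
  shows "H2_interval l (\<lambda>x. a + c * x - (\<integral>t. (\<integral>s. h s \<partial>lebesgue_on {0..t}) \<partial>lebesgue_on {0..x}))
     (\<lambda>x. c - (\<integral>s. h s \<partial>lebesgue_on {0..x})) (\<lambda>x. - h x)"
proof -
  have cont: "continuous_on {0..l} (\<lambda>x. \<integral>s. h s \<partial>lebesgue_on {0..x})"
    using assms by (intro indefinite_integral_continuous_real L2_interval_integrable)
  have "(\<lambda>x. - h x) \<in> L2_interval l" using L2_scale[of h _ "-1"] assms by (simp add: L2_interval_eq)
  then show ?thesis
    unfolding H2_interval_def
    by (auto intro!: derivative_eq_intros indefinite_integral_has_derivative[OF cont])
qed

lemma H2_interval_by_parts:
  assumes "H2_interval l f f' f''" "0 \<le> l"
    and "\<And>x. x \<in> {0..l} \<Longrightarrow> (u has_real_derivative u' x) (at x within {0..l})" "continuous_on {0..l} u'"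
  shows "(\<integral>t. u t * f'' t \<partial>lebesgue_on {0..l}) = u l * f' l - u 0 * f' 0 - (\<integral>t. u' t * f' t \<partial>lebesgue_on {0..l})"
  using assms(2) L2_interval_integrable[OF H2_intervalD(2)[OF assms(1)]] assms(3,4) H2_intervalD(3)[OF assms(1)]
  by (rule integration_by_parts_indefinite)

section \<open>The energy form of a metric graph\<close>

text \<open>Gaussian elimination: an equation with a nonzero coefficient is solved for one unknown
  and substituted into the others.\<close>

lemma homogeneous_system_nontrivial:
  fixes a :: "'i \<Rightarrow> 'j \<Rightarrow> real"
  assumes "finite I" "finite J" "card I < card J"
  shows "\<exists>x. (\<exists>j\<in>J. x j \<noteq> 0) \<and> (\<forall>i\<in>I. (\<Sum>j\<in>J. a i j * x j) = 0)"
  using assms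
proof (induction I arbitrary: J a rule: finite_induct)
  case empty
  then obtain j where "j \<in> J" by fastforce
  then show ?case by (intro exI[of _ "\<lambda>_. 1"]) auto
next
  case (insert i0 I)
  show ?case
  proof (cases "\<forall>j\<in>J. a i0 j = 0")
    case True
    have "card I < card J" using insert.hyps insert.prems by simp
    then obtain x where x: "\<exists>j\<in>J. x j \<noteq> 0" "\<forall>i\<in>I. (\<Sum>j\<in>J. a i j * x j) = 0"
      using insert.IH[OF insert.prems(1), of a] by blast
    then show ?thesis using True by (intro exI[of _ x]) auto
  next
    case False
    then obtain j0 where j0: "j0 \<in> J" "a i0 j0 \<noteq> 0" by auto
    define J' where "J' = J - {j0}"
    have fin: "finite J'" using insert.prems by (simp add: J'_def)
    have card: "card I < card J'" using insert j0 by (simp add: J'_def)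
    obtain x where x: "\<exists>j\<in>J'. x j \<noteq> 0" "\<And>i. i \<in> I \<Longrightarrow> (\<Sum>j\<in>J'. (a i j - a i j0 * a i0 j / a i0 j0) * x j) = 0"
      using insert.IH[OF fin card, of "\<lambda>i j. a i j - a i j0 * a i0 j / a i0 j0"] by auto
    define s where "s = (\<Sum>j\<in>J'. a i0 j * x j)"
    \<comment> \<open>The eliminated unknown gets the value that equation \<open>i0\<close>
      dictates.\<close>
    define y where "y = x(j0 := - s / a i0 j0)"
    have sum_J: "(\<Sum>j\<in>J. a i j * y j) = - a i j0 * s / a i0 j0 + (\<Sum>j\<in>J'. a i j * x j)" for i
    proof -
      have "(\<Sum>j\<in>J. a i j * y j) = a i j0 * y j0 + (\<Sum>j\<in>J'. a i j * y j)"
        unfolding J'_def using j0 insert.prems by (simp add: sum.remove)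
      also have "(\<Sum>j\<in>J'. a i j * y j) = (\<Sum>j\<in>J'. a i j * x j)"
        by (rule sum.cong) (auto simp: y_def J'_def)
      finally show ?thesis by (simp add: y_def)
    qed
    have "(\<Sum>j\<in>J. a i j * y j) = 0" if "i \<in> insert i0 I" for i
    proof (cases "i = i0")
      case True then show ?thesis using j0 unfolding sum_J by (simp add: s_def)
    next
      case False
      then have "0 = (\<Sum>j\<in>J'. (a i j - a i j0 * a i0 j / a i0 j0) * x j)" using that x(2) by simp
      also have "\<dots> = (\<Sum>j\<in>J'. a i j * x j) - (\<Sum>j\<in>J'. (a i j0 / a i0 j0) * (a i0 j * x j))"
        by (simp add: left_diff_distrib sum_subtractf mult.assoc)
      also have "(\<Sum>j\<in>J'. (a i j0 / a i0 j0) * (a i0 j * x j)) = (a i j0 / a i0 j0) * s"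
        unfolding s_def by (rule sum_distrib_left[symmetric])
      finally show ?thesis unfolding sum_J by simp
    qed
    moreover have "\<exists>j\<in>J. y j \<noteq> 0" using x(1) by (auto simp: y_def J'_def)
    ultimately show ?thesis by (intro exI[of _ y]) blast
  qed
qed

text \<open>The right-hand side becomes a column for an extra unknown \<open>None\<close>. The
  enlarged homogeneous system has a nontrivial solution; by injectivity its \<open>None\<close>
  component is nonzero, and dividing by it solves the original system.\<close>

lemma linear_system_solvable:
  fixes a :: "'i \<Rightarrow> 'i \<Rightarrow> real"
  assumes fin: "finite I" and inj: "\<And>x. (\<And>i. i \<in> I \<Longrightarrow> (\<Sum>j\<in>I. a i j * x j) = 0) \<Longrightarrow> \<forall>j\<in>I. x j = 0"
  shows "\<exists>x. \<forall>i\<in>I. (\<Sum>j\<in>I. a i j * x j) = b i"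
proof -
  define a' where "a' i j = (case j of None \<Rightarrow> - b i | Some j \<Rightarrow> a i j)" for i j
  have split: "(\<Sum>j\<in>insert None (Some ` I). a' i j * y j) = - b i * y None + (\<Sum>j\<in>I. a i j * y (Some j))" for i y
    using fin by (subst sum.insert) (auto simp: a'_def sum.reindex)
  have "card I < card (insert None (Some ` I))" using fin by (simp add: card_image)
  then obtain y where y: "\<exists>j\<in>insert None (Some ` I). y j \<noteq> 0"
    "\<And>i. i \<in> I \<Longrightarrow> - b i * y None + (\<Sum>j\<in>I. a i j * y (Some j)) = 0"
    using homogeneous_system_nontrivial[of I "insert None (Some ` I)" a'] fin unfolding split by auto
  have nz: "y None \<noteq> 0"
  proof
    assume z: "y None = 0"
    have "\<forall>j\<in>I. y (Some j) = 0" using y(2) z by (intro inj) simp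
    then show False using y(1) z by auto
  qed
  show ?thesis
  proof (intro exI ballI)
    fix i assume "i \<in> I"
    have "(\<Sum>j\<in>I. a i j * (y (Some j) / y None)) = (\<Sum>j\<in>I. a i j * y (Some j)) / y None"
      by (simp add: sum_divide_distrib)
    then show "(\<Sum>j\<in>I. a i j * (y (Some j) / y None)) = b i" using y(2)[OF \<open>i \<in> I\<close>] nz by (simp add: field_simps)
  qed
qed

text \<open>Together with \<open>vertex_continuous\<close> this replaces the form domain H^1 with
  Dirichlet conditions. The derivative is a separate argument so that the energy can be written as
  an \<open>L2_inner\<close>.\<close>

definition edgewise_C1 :: "('v, 'e) metric_graph \<Rightarrow> ('e \<Rightarrow> real \<Rightarrow> real) \<Rightarrow> ('e \<Rightarrow> real \<Rightarrow> real) \<Rightarrow> bool" where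
  "edgewise_C1 G f f' \<longleftrightarrow> (\<forall>e\<in>arcs (skeleton G).
     (\<forall>x\<in>{0..len G e}. (f e has_real_derivative f' e x) (at x within {0..len G e})) \<and> continuous_on {0..len G e} (f' e))"

text \<open>Without an edge, L^2 would be trivial and contain no orthonormal sequence.\<close>

locale dirichlet_graph =
  fixes G :: "('v, 'e) metric_graph"
  assumes compact: "compact_metric_graph G" and connected: "connected_metric_graph G"
    and dirichlet_nonempty: "dirichlet G \<noteq> {}" and arcs_nonempty: "arcs (skeleton G) \<noteq> {}"
begin

abbreviation "E \<equiv> arcs (skeleton G)"
abbreviation "src \<equiv> tail (skeleton G)"
abbreviation "dst \<equiv> head (skeleton G)"
abbreviation "l \<equiv> len G"

sublocale skel: fin_digraph "skeleton G"
  using compact by (simp add: compact_metric_graph_def)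

lemma len_pos: "e \<in> E \<Longrightarrow> 0 < l e"
  using compact by (simp add: compact_metric_graph_def)

lemma dirichlet_verts: "dirichlet G \<subseteq> verts (skeleton G)"
  using compact by (simp add: compact_metric_graph_def)

sublocale complete_semi_inner_space "L2_graph G" "L2_inner G"
proof -
  have "L2_graph G = {f. \<forall>e\<in>E. f e \<in> L2_space (lebesgue_on {0..l e})}"
    by (simp add: L2_graph_def L2_interval_eq)
  moreover have "L2_inner G = (\<lambda>f g. \<Sum>e\<in>E. \<integral>x. f e x * g e x \<partial>lebesgue_on {0..l e})"
    by (simp add: L2_inner_def graph_integral_def fun_eq_iff)
  ultimately show "complete_semi_inner_space (L2_graph G) (L2_inner G)"
    using L2_family_complete_semi_inner_space[of E "\<lambda>e. lebesgue_on {0..l e}"] finite_measure_lebesgue_on_interval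
    by simp
qed

lemma L2_inner_eq: "L2_inner G f g = (\<Sum>e\<in>E. \<integral>x. f e x * g e x \<partial>lebesgue_on {0..l e})"
  by (simp add: L2_inner_def graph_integral_def)

lemma edgewise_C1D:
  assumes "edgewise_C1 G f f'" "e \<in> E"
  shows "\<And>x. x \<in> {0..l e} \<Longrightarrow> (f e has_real_derivative f' e x) (at x within {0..l e})"
    and "continuous_on {0..l e} (f' e)" and "continuous_on {0..l e} (f e)"
proof -
  show *: "\<And>x. x \<in> {0..l e} \<Longrightarrow> (f e has_real_derivative f' e x) (at x within {0..l e})"
    using assms unfolding edgewise_C1_def by blast
  show "continuous_on {0..l e} (f' e)" using assms unfolding edgewise_C1_def by blast
  show "continuous_on {0..l e} (f e)" using * by (rule DERIV_continuous_on)
qed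

lemma edgewise_C1_L2:
  assumes "edgewise_C1 G f f'" shows "f \<in> L2_graph G" "f' \<in> L2_graph G"
  using edgewise_C1D[OF assms] by (auto simp: L2_graph_def intro!: continuous_on_imp_L2_interval)

lemma L2_inner_self_edge_le:
  assumes "e \<in> E" shows "(\<integral>x. (f e x)\<^sup>2 \<partial>lebesgue_on {0..l e}) \<le> L2_inner G f f"
  using member_le_sum[OF assms, of "\<lambda>e. \<integral>x. f e x * f e x \<partial>lebesgue_on {0..l e}"]
  by (simp add: L2_inner_eq power2_eq_square)

lemma edge_increment_le:
  assumes "edgewise_C1 G u u'" "e \<in> E" "x \<in> {0..l e}" "y \<in> {0..l e}"
  shows "(u e y - u e x)\<^sup>2 \<le> \<bar>y - x\<bar> * L2_inner G u' u'"
proof -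
  have "(u e y - u e x)\<^sup>2 \<le> \<bar>y - x\<bar> * (\<integral>t. (u' e t)\<^sup>2 \<partial>lebesgue_on {0..l e})"
    using edgewise_C1D[OF assms(1,2)] assms(3,4) by (intro square_increment_le_energy) auto
  also have "\<dots> \<le> \<bar>y - x\<bar> * L2_inner G u' u'"
    using L2_inner_self_edge_le[OF assms(2)] by (intro mult_left_mono) auto
  finally show ?thesis .
qed

lemma square_le_twice_increment: "(a::real)\<^sup>2 \<le> 2 * b\<^sup>2 + 2 * (a - b)\<^sup>2"
  using sum_squares_bound[of b "a - b"] by (simp add: power2_eq_square algebra_simps)

text \<open>Induction along a path from a Dirichlet vertex to \<open>v\<close>: each edge changes
  the value by an amount that the energy controls. The vertex values \<open>val\<close> are explicit
  so that the bound also applies to the unknowns of the vertex system behind the Dirichlet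
  problem.\<close>

lemma vertex_value_bound:
  assumes "v \<in> verts (skeleton G)"
  shows "\<exists>C\<ge>0. \<forall>u u' val. edgewise_C1 G u u' \<longrightarrow>
     (\<forall>e\<in>E. u e 0 = val (src e) \<and> u e (l e) = val (dst e)) \<longrightarrow> (\<forall>v\<in>dirichlet G. val v = 0) \<longrightarrow>
     (val v)\<^sup>2 \<le> C * L2_inner G u' u'"
proof -
  obtain d where d: "d \<in> dirichlet G" using dirichlet_nonempty by auto
  have "(d, v) \<in> rtrancl_on (verts (skeleton G)) ((arcs_ends (skeleton G))\<^sup>s)"
    using connected d dirichlet_verts assms
    by (auto simp: connected_metric_graph_def connected_conv)
  then show ?thesis
  proof (induction rule: rtrancl_on_induct)
    case base
    show ?case using d by (intro exI[of _ 0]) auto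
  next
    case (step y z)
    then obtain C where C: "C \<ge> 0" "\<And>u u' val. edgewise_C1 G u u' \<Longrightarrow>
     (\<forall>e\<in>E. u e 0 = val (src e) \<and> u e (l e) = val (dst e)) \<Longrightarrow> (\<forall>v\<in>dirichlet G. val v = 0) \<Longrightarrow>
     (val y)\<^sup>2 \<le> C * L2_inner G u' u'" by blast
    obtain e where e: "e \<in> E" and ends: "(y = src e \<and> z = dst e) \<or> (y = dst e \<and> z = src e)"
      using step by (auto simp: symcl_def arcs_ends_conv)
    show ?case
    \<comment> \<open>From (val z)^2 \<le> 2 (val y)^2 + 2 (val z - val y)^2, where the increment
      along \<open>e\<close> is bounded with constant \<open>l e\<close> in either
      direction.\<close>
    proof (intro exI[of _ "2 * C + 2 * l e"] conjI allI impI)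
      show "0 \<le> 2 * C + 2 * l e" using C len_pos[OF e] by simp
      fix u u' and val :: "'v \<Rightarrow> real"
      assume u: "edgewise_C1 G u u'" and val: "\<forall>e\<in>E. u e 0 = val (src e) \<and> u e (l e) = val (dst e)"
        and D: "\<forall>v\<in>dirichlet G. val v = 0"
      have "(u e (l e) - u e 0)\<^sup>2 \<le> l e * L2_inner G u' u'"
        using edge_increment_le[OF u e, of 0 "l e"] len_pos[OF e] by simp
      then have "(val z - val y)\<^sup>2 \<le> l e * L2_inner G u' u'"
        using val e ends by (auto simp: power2_commute)
      then show "(val z)\<^sup>2 \<le> (2 * C + 2 * l e) * L2_inner G u' u'"
        using square_le_twice_increment[of "val z" "val y"] C(2)[OF u val D]
        by (simp add: algebra_simps)
    qed
  qed
qed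

lemma Poincare:
  obtains C where "C \<ge> 0" "\<And>u u' e x. edgewise_C1 G u u' \<Longrightarrow> vertex_continuous G u \<Longrightarrow> e \<in> E \<Longrightarrow> x \<in> {0..l e} \<Longrightarrow>
     (u e x)\<^sup>2 \<le> C * L2_inner G u' u'"
proof -
  have "\<forall>v\<in>verts (skeleton G). \<exists>C. C \<ge> 0 \<and> (\<forall>u u' val. edgewise_C1 G u u' \<longrightarrow>
     (\<forall>e\<in>E. u e 0 = val (src e) \<and> u e (l e) = val (dst e)) \<longrightarrow> (\<forall>v\<in>dirichlet G. val v = 0) \<longrightarrow>
     (val v)\<^sup>2 \<le> C * L2_inner G u' u')"
    using vertex_value_bound by blast
  from bchoice[OF this] obtain C where C: "\<And>v. v \<in> verts (skeleton G) \<Longrightarrow> C v \<ge> 0"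
    "\<And>v u u' val. v \<in> verts (skeleton G) \<Longrightarrow> edgewise_C1 G u u' \<Longrightarrow>
     (\<forall>e\<in>E. u e 0 = val (src e) \<and> u e (l e) = val (dst e)) \<Longrightarrow> (\<forall>v\<in>dirichlet G. val v = 0) \<Longrightarrow>
     (val v)\<^sup>2 \<le> C v * L2_inner G u' u'" by blast
  \<comment> \<open>Each summand bounds its own edge, starting from the value at the tail; all are
    nonnegative, so the sum serves every edge.\<close>
  define M where "M = (\<Sum>e\<in>E. 2 * C (src e) + 2 * l e)"
  have nn: "0 \<le> 2 * C (src e) + 2 * l e" if "e \<in> E" for e using C(1)[of "src e"] len_pos[OF that] that by simp
  show ?thesis
  proof
    show "M \<ge> 0" unfolding M_def using nn by (rule sum_nonneg)
    fix u u' e x assume u: "edgewise_C1 G u u'" and vc: "vertex_continuous G u" and e: "e \<in> E" and x: "x \<in> {0..l e}"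
    obtain val where val: "\<forall>e\<in>E. u e 0 = val (src e) \<and> u e (l e) = val (dst e)" "\<forall>v\<in>dirichlet G. val v = 0"
      using vc by (auto simp: vertex_continuous_def)
    have D: "0 \<le> L2_inner G u' u'" using edgewise_C1_L2(2)[OF u] by (rule B_nonneg)
    have "(u e x - u e 0)\<^sup>2 \<le> \<bar>x - 0\<bar> * L2_inner G u' u'"
      using x len_pos[OF e] by (intro edge_increment_le u e) auto
    also have "\<dots> \<le> l e * L2_inner G u' u'" using x D by (intro mult_right_mono) auto
    finally have "(u e x - u e 0)\<^sup>2 \<le> l e * L2_inner G u' u'" .
    moreover have "(u e 0)\<^sup>2 \<le> C (src e) * L2_inner G u' u'"
      using C(2)[OF _ u val, of "src e"] val(1) e by simp
    ultimately have "(u e x)\<^sup>2 \<le> (2 * C (src e) + 2 * l e) * L2_inner G u' u'"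
      using square_le_twice_increment[of "u e x" "u e 0"] by (simp add: algebra_simps)
    also have "\<dots> \<le> M * L2_inner G u' u'"
      using D nn e by (intro mult_right_mono) (auto simp: M_def intro!: member_le_sum)
    finally show "(u e x)\<^sup>2 \<le> M * L2_inner G u' u'" .
  qed
qed

text \<open>Grouped by vertices instead of edges, the boundary terms at \<open>v\<close> are
  \<open>val v\<close> times the Kirchhoff sum. The first factor vanishes at Dirichlet vertices, the
  second at all others.\<close>

lemma kirchhoff_boundary_sum:
  assumes k: "kirchhoff G f'" and u: "vertex_continuous G u"
  shows "(\<Sum>e\<in>E. u e (l e) * f' e (l e) - u e 0 * f' e 0) = 0"
proof -
  obtain val where val: "\<And>e. e \<in> E \<Longrightarrow> u e 0 = val (src e) \<and> u e (l e) = val (dst e)" "\<forall>v\<in>dirichlet G. val v = 0"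
    using u by (auto simp: vertex_continuous_def)
  have "(\<Sum>e\<in>E. u e (l e) * f' e (l e) - u e 0 * f' e 0)
     = (\<Sum>e\<in>E. val (dst e) * f' e (l e)) + (\<Sum>e\<in>E. val (src e) * (- f' e 0))"
    unfolding sum.distrib[symmetric] using val(1) by (intro sum.cong) auto
  also have "(\<Sum>e\<in>E. val (dst e) * f' e (l e)) = (\<Sum>v\<in>verts (skeleton G). \<Sum>e\<in>{e\<in>E. dst e = v}. val (dst e) * f' e (l e))"
    by (rule sum.group[symmetric]) auto
  also have "(\<Sum>e\<in>E. val (src e) * (- f' e 0)) = (\<Sum>v\<in>verts (skeleton G). \<Sum>e\<in>{e\<in>E. src e = v}. val (src e) * (- f' e 0))"
    by (rule sum.group[symmetric]) auto
  also have "(\<Sum>v\<in>verts (skeleton G). \<Sum>e\<in>{e\<in>E. dst e = v}. val (dst e) * f' e (l e)) +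
      (\<Sum>v\<in>verts (skeleton G). \<Sum>e\<in>{e\<in>E. src e = v}. val (src e) * (- f' e 0))
     = (\<Sum>v\<in>verts (skeleton G). val v * ((\<Sum>e\<in>{e\<in>E. dst e = v}. f' e (l e)) + (\<Sum>e\<in>{e\<in>E. src e = v}. - f' e 0)))"
    unfolding sum.distrib[symmetric] distrib_left sum_distrib_left
    by (intro sum.cong arg_cong2[of _ _ _ _ "(+)"]) auto
  also have "\<dots> = 0"
  proof (intro sum.neutral ballI)
    fix v assume "v \<in> verts (skeleton G)"
    then show "val v * ((\<Sum>e\<in>{e\<in>E. dst e = v}. f' e (l e)) + (\<Sum>e\<in>{e\<in>E. src e = v}. - f' e 0)) = 0"
      using val(2) k unfolding kirchhoff_def by (cases "v \<in> dirichlet G") auto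
  qed
  finally show ?thesis .
qed

text \<open>Weak form of the equation -\<Delta> f = h: integration by parts on each edge, after
  which the Kirchhoff and continuity conditions cancel all boundary terms.\<close>

lemma Green_formula:
  assumes H2: "\<And>e. e \<in> E \<Longrightarrow> H2_interval (l e) (f e) (f' e) (f'' e)" and k: "kirchhoff G f'"
    and h: "\<And>e. e \<in> E \<Longrightarrow> AE x in lebesgue_on {0..l e}. h e x = - f'' e x" and hL2: "h \<in> L2_graph G"
    and u: "edgewise_C1 G u u'" "vertex_continuous G u"
  shows "L2_inner G u h = L2_inner G u' f'"
proof -
  have "(\<integral>x. u e x * h e x \<partial>lebesgue_on {0..l e}) =
     (\<integral>x. u' e x * f' e x \<partial>lebesgue_on {0..l e}) - (u e (l e) * f' e (l e) - u e 0 * f' e 0)" if e: "e \<in> E" for e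
  proof -
    have meas: "u e \<in> borel_measurable (lebesgue_on {0..l e})" "h e \<in> borel_measurable (lebesgue_on {0..l e})"
        "f'' e \<in> borel_measurable (lebesgue_on {0..l e})"
      using edgewise_C1_L2(1)[OF u(1)] hL2 H2_intervalD(2)[OF H2[OF e]] e by (auto simp: L2_graph_def L2_interval_def)
    note [measurable] = meas
    have "(\<integral>x. u e x * h e x \<partial>lebesgue_on {0..l e}) = (\<integral>x. - (u e x * f'' e x) \<partial>lebesgue_on {0..l e})"
    proof (rule integral_cong_AE)
      show "AE x in lebesgue_on {0..l e}. u e x * h e x = - (u e x * f'' e x)"
        using h[OF e] by eventually_elim simp
    qed measurable
    also have "\<dots> = - (\<integral>x. u e x * f'' e x \<partial>lebesgue_on {0..l e})" by simp
    also have "(\<integral>x. u e x * f'' e x \<partial>lebesgue_on {0..l e}) =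
       u e (l e) * f' e (l e) - u e 0 * f' e 0 - (\<integral>x. u' e x * f' e x \<partial>lebesgue_on {0..l e})"
      using len_pos[OF e] edgewise_C1D[OF u(1) e] by (intro H2_interval_by_parts[OF H2[OF e]]) auto
    finally show ?thesis by simp
  qed
  then have "L2_inner G u h = L2_inner G u' f' - (\<Sum>e\<in>E. u e (l e) * f' e (l e) - u e 0 * f' e 0)"
    unfolding L2_inner_eq by (simp only: sum_subtractf[symmetric] cong: sum.cong)
  then show ?thesis using kirchhoff_boundary_sum[OF k u(2)] by simp
qed

lemma H2_edgewise_C1:
  assumes "\<And>e. e \<in> E \<Longrightarrow> H2_interval (l e) (f e) (f' e) (f'' e)" shows "edgewise_C1 G f f'"
  unfolding edgewise_C1_def using H2_intervalD(1)[OF assms] H2_interval_continuous(2)[OF assms] by blast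

end

section \<open>The Green operator\<close>

context dirichlet_graph
begin

lemma Dirichlet_problem_solvable:
  assumes h: "h \<in> L2_graph G"
  shows "\<exists>f f'. (\<forall>e\<in>E. H2_interval (l e) (f e) (f' e) (\<lambda>x. - h e x)) \<and> vertex_continuous G f \<and> kirchhoff G f'"
proof -
  txt \<open>
    For the solution with prescribed vertex values, the Kirchhoff conditions are a linear system with
    matrix \<open>a\<close>, the weighted Laplacian of the skeleton. Vertex values in its kernel are constant along
    each edge, so they are those of a function without energy, hence zero.
  \<close>
  define W where "W = verts (skeleton G) - dirichlet G"
  have finW: "finite W" by (simp add: W_def)
  \<comment> \<open>Signed incidence of vertex and edge; it is 0 for a loop, whose two ends
    cancel.\<close>
  define \<sigma> where "\<sigma> v e = (if dst e = v then 1 else 0) - (if src e = v then 1 else (0::real))" for v e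
  define a where "a v w = (\<Sum>e\<in>E. \<sigma> v e * \<sigma> w e / l e)" for v w
  define ext where "ext x v = (if v \<in> W then x v else (0::real))" for x v
  have ext_diff: "(\<Sum>w\<in>W. \<sigma> w e * x w) = ext x (dst e) - ext x (src e)" for x e
    using finW by (simp add: \<sigma>_def left_diff_distrib sum_subtractf ext_def if_distrib[of "\<lambda>c. c * _"] cong: if_cong)
  have a_sum: "(\<Sum>w\<in>W. a v w * x w) = (\<Sum>e\<in>E. \<sigma> v e * ((ext x (dst e) - ext x (src e)) / l e))" for v x
  proof -
    have "(\<Sum>w\<in>W. a v w * x w) = (\<Sum>w\<in>W. \<Sum>e\<in>E. (\<sigma> v e / l e) * (\<sigma> w e * x w))"
      by (simp add: a_def sum_distrib_right sum_distrib_left mult_ac)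
    also have "\<dots> = (\<Sum>e\<in>E. \<Sum>w\<in>W. (\<sigma> v e / l e) * (\<sigma> w e * x w))" by (rule sum.swap)
    also have "\<dots> = (\<Sum>e\<in>E. (\<sigma> v e / l e) * (ext x (dst e) - ext x (src e)))"
      unfolding sum_distrib_left[symmetric] ext_diff ..
    finally show ?thesis by simp
  qed
  have inj: "\<forall>w\<in>W. x w = 0" if ker: "\<And>v. v \<in> W \<Longrightarrow> (\<Sum>w\<in>W. a v w * x w) = 0" for x
  proof -
    let ?d = "\<lambda>e. ext x (dst e) - ext x (src e)"
    \<comment> \<open>Pairing the kernel equations with \<open>x\<close> produces the energy of the
      edgewise affine interpolation of the vertex values.\<close>
    have "0 = (\<Sum>v\<in>W. x v * (\<Sum>w\<in>W. a v w * x w))" using ker by simp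
    also have "\<dots> = (\<Sum>v\<in>W. \<Sum>e\<in>E. (\<sigma> v e * x v) * (?d e / l e))"
      unfolding a_sum by (simp add: sum_distrib_left mult_ac)
    also have "\<dots> = (\<Sum>e\<in>E. \<Sum>v\<in>W. (\<sigma> v e * x v) * (?d e / l e))" by (rule sum.swap)
    also have "\<dots> = (\<Sum>e\<in>E. (?d e)\<^sup>2 / l e)"
      unfolding sum_distrib_right[symmetric] ext_diff by (simp add: power2_eq_square)
    finally have "(\<Sum>e\<in>E. (?d e)\<^sup>2 / l e) = 0" ..
    then have "\<forall>e\<in>E. (?d e)\<^sup>2 / l e = 0"
      using len_pos by (subst (asm) sum_nonneg_eq_0_iff) (auto intro!: divide_nonneg_pos)
    then have d0: "ext x (dst e) = ext x (src e)" if "e \<in> E" for e using len_pos[OF that] that by fastforce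
    define u where "u = (\<lambda>e (t::real). ext x (src e))"
    have u: "edgewise_C1 G u (\<lambda>e t. 0)" by (auto simp: edgewise_C1_def u_def)
    have z: "L2_inner G (\<lambda>e t. 0) (\<lambda>e t. 0) = 0" by (simp add: L2_inner_eq)
    show ?thesis
    proof
      fix w assume w: "w \<in> W"
      then obtain C where "\<forall>u u' val. edgewise_C1 G u u' \<longrightarrow>
         (\<forall>e\<in>E. u e 0 = val (src e) \<and> u e (l e) = val (dst e)) \<longrightarrow> (\<forall>v\<in>dirichlet G. val v = 0) \<longrightarrow>
         (val w)\<^sup>2 \<le> C * L2_inner G u' u'"
        using vertex_value_bound[of w] by (auto simp: W_def)
      then have "(ext x w)\<^sup>2 \<le> C * L2_inner G (\<lambda>e t. 0) (\<lambda>e t. 0)"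
        using u d0 by (elim allE[of _ u] allE[of _ "\<lambda>e t. 0"] allE[of _ "ext x"]) (auto simp: u_def ext_def W_def)
      then show "x w = 0" using w unfolding z by (simp add: ext_def)
    qed
  qed
  define I where "I e x = (\<integral>s. h e s \<partial>lebesgue_on {0..x})" for e x
  define F where "F e x = (\<integral>t. I e t \<partial>lebesgue_on {0..x})" for e x
  \<comment> \<open>The right-hand side collects what the source \<open>h\<close> contributes to the
    Kirchhoff sum at \<open>v\<close>: \<open>F\<close> enters through the slopes \<open>c e\<close>
    below, and \<open>I\<close> through the derivative at heads only, since it vanishes at
    tails.\<close>
  obtain x where x: "\<And>v. v \<in> W \<Longrightarrow> (\<Sum>w\<in>W. a v w * x w)
     = - (\<Sum>e\<in>E. \<sigma> v e * (F e (l e) / l e)) + (\<Sum>e\<in>E. if dst e = v then I e (l e) else 0)"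
    using linear_system_solvable[OF finW inj, where b = "\<lambda>v. - (\<Sum>e\<in>E. \<sigma> v e * (F e (l e) / l e)) + (\<Sum>e\<in>E. if dst e = v then I e (l e) else 0)"]
    by blast
  \<comment> \<open>This initial slope makes the value at the head equal to
    \<open>ext x (dst e)\<close>.\<close>
  define c where "c e = (ext x (dst e) - ext x (src e) + F e (l e)) / l e" for e
  define f where "f e t = ext x (src e) + c e * t - F e t" for e t
  define f' where "f' e t = c e - I e t" for e t
  have "H2_interval (l e) (f e) (f' e) (\<lambda>x. - h e x)" if "e \<in> E" for e
    using H2_interval_double_integral[of "h e" "l e" "ext x (src e)" "c e"] h that
    by (simp add: f_def [abs_def] f'_def [abs_def] F_def I_def L2_graph_def)
  moreover have "vertex_continuous G f"
    unfolding vertex_continuous_def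
  proof (intro exI[of _ "ext x"] conjI ballI)
    fix e assume "e \<in> E"
    then show "f e 0 = ext x (src e)" "f e (l e) = ext x (dst e)"
      using len_pos[of e] by (simp_all add: f_def F_def c_def)
  qed (auto simp: ext_def W_def)
  moreover have "kirchhoff G f'"
    unfolding kirchhoff_def
  proof
    fix v assume v: "v \<in> verts (skeleton G) - dirichlet G"
    have "(\<Sum>e\<in>{e\<in>E. dst e = v}. f' e (l e)) + (\<Sum>e\<in>{e\<in>E. src e = v}. - f' e 0)
      = (\<Sum>e\<in>E. if dst e = v then f' e (l e) else 0) + (\<Sum>e\<in>E. if src e = v then - f' e 0 else 0)"
      by (simp add: sum.inter_filter)
    also have "\<dots> = (\<Sum>e\<in>E. \<sigma> v e * c e) - (\<Sum>e\<in>E. if dst e = v then I e (l e) else 0)"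
      unfolding sum.distrib[symmetric] sum_subtractf[symmetric]
      by (intro sum.cong) (auto simp: \<sigma>_def f'_def I_def)
    also have "(\<Sum>e\<in>E. \<sigma> v e * c e) = (\<Sum>w\<in>W. a v w * x w) + (\<Sum>e\<in>E. \<sigma> v e * (F e (l e) / l e))"
      unfolding a_sum sum.distrib[symmetric] by (intro sum.cong) (auto simp: c_def add_divide_distrib distrib_left)
    finally show "(\<Sum>e\<in>{e\<in>E. dst e = v}. f' e (l e)) + (\<Sum>e\<in>{e\<in>E. src e = v}. - f' e 0) = 0"
      using x[of v] v by (simp add: W_def)
  qed
  ultimately show ?thesis by blast
qed

text \<open>Function and derivative are chosen as one pair, so that \<open>K'\<close> is the
  derivative of \<open>K\<close> and satisfies the Kirchhoff condition.\<close>

definition solution :: "('e \<Rightarrow> real \<Rightarrow> real) \<Rightarrow> ('e \<Rightarrow> real \<Rightarrow> real) \<times> ('e \<Rightarrow> real \<Rightarrow> real)" where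
  "solution h = (SOME p. (\<forall>e\<in>E. H2_interval (l e) (fst p e) (snd p e) (\<lambda>x. - h e x)) \<and>
     vertex_continuous G (fst p) \<and> kirchhoff G (snd p))"

definition K :: "('e \<Rightarrow> real \<Rightarrow> real) \<Rightarrow> 'e \<Rightarrow> real \<Rightarrow> real" where "K h = fst (solution h)"

definition K' :: "('e \<Rightarrow> real \<Rightarrow> real) \<Rightarrow> 'e \<Rightarrow> real \<Rightarrow> real" where "K' h = snd (solution h)"

lemma K_solution:
  assumes "h \<in> L2_graph G"
  shows "\<And>e. e \<in> E \<Longrightarrow> H2_interval (l e) (K h e) (K' h e) (\<lambda>x. - h e x)"
    and "vertex_continuous G (K h)" and "kirchhoff G (K' h)" and "edgewise_C1 G (K h) (K' h)"
proof -
  have "\<exists>p. (\<forall>e\<in>E. H2_interval (l e) (fst p e) (snd p e) (\<lambda>x. - h e x)) \<and>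
     vertex_continuous G (fst p) \<and> kirchhoff G (snd p)"
    using Dirichlet_problem_solvable[OF assms] by simp
  from someI_ex[OF this] show *: "\<And>e. e \<in> E \<Longrightarrow> H2_interval (l e) (K h e) (K' h e) (\<lambda>x. - h e x)"
    and "vertex_continuous G (K h)" "kirchhoff G (K' h)"
    by (simp_all add: K_def K'_def solution_def)
  show "edgewise_C1 G (K h) (K' h)" using * by (rule H2_edgewise_C1)
qed

lemma K_Green:
  assumes "h \<in> L2_graph G" "edgewise_C1 G u u'" "vertex_continuous G u"
  shows "L2_inner G u h = L2_inner G u' (K' h)"
  by (rule Green_formula[OF K_solution(1)[OF assms(1)] K_solution(3)[OF assms(1)] _ assms]) auto

lemma K_L2: "h \<in> L2_graph G \<Longrightarrow> K h \<in> L2_graph G" "h \<in> L2_graph G \<Longrightarrow> K' h \<in> L2_graph G"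
  using edgewise_C1_L2[OF K_solution(4)] by auto

text \<open>By Green's formula both sides equal the energy pairing of \<open>K' x\<close> and
  \<open>K' y\<close>.\<close>

lemma K_symmetric:
  assumes "x \<in> L2_graph G" "y \<in> L2_graph G" shows "L2_inner G (K x) y = L2_inner G x (K y)"
  using K_Green[OF assms(2) K_solution(4,2)[OF assms(1)]] K_Green[OF assms(1) K_solution(4,2)[OF assms(2)]]
    B_commute[OF assms(1) K_L2(1)[OF assms(2)]] B_commute[OF K_L2(2)[OF assms(1)] K_L2(2)[OF assms(2)]] by simp

lemma K_energy:
  assumes "h \<in> L2_graph G" shows "L2_inner G (K h) h = L2_inner G (K' h) (K' h)"
  using K_Green[OF assms K_solution(4,2)[OF assms]] .

lemma L2_null_iff:
  assumes "f \<in> L2_graph G"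
  shows "L2_inner G f f = 0 \<longleftrightarrow> (\<forall>e\<in>E. AE x in lebesgue_on {0..l e}. f e x = 0)"
proof -
  have "L2_inner G f f = 0 \<longleftrightarrow> (\<forall>e\<in>E. (\<integral>x. f e x * f e x \<partial>lebesgue_on {0..l e}) = 0)"
    unfolding L2_inner_eq by (rule sum_nonneg_eq_0_iff) auto
  also have "\<dots> \<longleftrightarrow> (\<forall>e\<in>E. AE x in lebesgue_on {0..l e}. f e x = 0)"
  proof (rule ball_cong[OF refl])
    fix e assume "e \<in> E"
    then have "integrable (lebesgue_on {0..l e}) (\<lambda>x. f e x * f e x)"
      using assms by (auto simp: L2_graph_def L2_interval_def power2_eq_square)
    then show "((\<integral>x. f e x * f e x \<partial>lebesgue_on {0..l e}) = 0) = (AE x in lebesgue_on {0..l e}. f e x = 0)"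
      by (subst integral_nonneg_eq_0_iff_AE) auto
  qed
  finally show ?thesis .
qed

text \<open>\<open>K h\<close> is continuous on each edge, so if null it is zero everywhere there.
  Then its derivative is zero, hence so are the indefinite integrals of \<open>h\<close>.\<close>

lemma K_injective:
  assumes h: "h \<in> L2_graph G" and null: "L2_inner G (K h) (K h) = 0"
  shows "L2_inner G h h = 0"
  unfolding L2_null_iff[OF h]
proof
  fix e assume e: "e \<in> E"
  have H2: "H2_interval (l e) (K h e) (K' h e) (\<lambda>x. - h e x)" by (rule K_solution(1)[OF h e])
  have "(\<integral>x. (K h e x)\<^sup>2 \<partial>lebesgue_on {0..l e}) \<le> 0"
    using L2_inner_self_edge_le[OF e, of "K h"] null by simp
  moreover have "0 \<le> (\<integral>x. (K h e x)\<^sup>2 \<partial>lebesgue_on {0..l e})" by simp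
  ultimately have "\<forall>x\<in>{0..l e}. (K h e x)\<^sup>2 = 0"
    using integralL_eq_0_iff[of 0 "l e" "\<lambda>x. (K h e x)\<^sup>2"] H2_interval_continuous(1)[OF H2] len_pos[OF e]
    by (auto intro!: continuous_intros)
  then have K0: "\<And>x. x \<in> {0..l e} \<Longrightarrow> K h e x = 0" by simp
  have K'0: "K' h e x = 0" if x: "x \<in> {0..l e}" for x
  proof -
    have "((\<lambda>x. 0) has_real_derivative K' h e x) (at x within {0..l e})"
      using has_derivative_transform[OF x K0[symmetric] H2_intervalD(1)[OF H2 x, unfolded has_field_derivative_def]]
      by (simp add: has_field_derivative_def)
    moreover have "((\<lambda>x. 0) has_real_derivative 0) (at x within {0..l e})" by simp
    ultimately show ?thesis
      using has_field_derivative_unique[of "\<lambda>x. 0" "K' h e x" x "{0..l e}" 0] x len_pos[OF e]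
      by (metis (no_types, lifting) at_within_cbox_finite box_real(2) has_real_derivative_iff_has_vector_derivative vector_derivative_unique_within trivial_limit_within islimpt_Icc)
  qed
  have "h e \<in> L2_interval (l e)" using h e by (simp add: L2_graph_def)
  then show "AE x in lebesgue_on {0..l e}. h e x = 0"
  proof (intro AE_zero_if_indefinite_integral_zero L2_interval_integrable)
    fix x assume x: "x \<in> {0..l e}"
    then show "(\<integral>t. h e t \<partial>lebesgue_on {0..x}) = 0"
      using H2_intervalD(3)[OF H2 x] K'0[OF x] K'0[of 0] len_pos[OF e] by simp
  qed
qed

lemma L2_inner_le_if_bounded:
  assumes "\<And>e x. e \<in> E \<Longrightarrow> x \<in> {0..l e} \<Longrightarrow> (f e x)\<^sup>2 \<le> c" "f \<in> L2_graph G"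
  shows "L2_inner G f f \<le> sum l E * c"
proof -
  have "(\<integral>x. f e x * f e x \<partial>lebesgue_on {0..l e}) \<le> l e * c" if e: "e \<in> E" for e
  proof -
    have "(\<integral>x. f e x * f e x \<partial>lebesgue_on {0..l e}) \<le> (\<integral>x. c \<partial>lebesgue_on {0..l e})"
      using assms e finite_measure.integrable_const[OF finite_measure_lebesgue_on_interval]
      by (intro integral_mono) (auto simp: power2_eq_square L2_graph_def L2_interval_def)
    also have "\<dots> = l e * c" using len_pos[OF e] by (simp add: measure_restrict_space)
    finally show ?thesis .
  qed
  then show ?thesis unfolding L2_inner_eq sum_distrib_right by (rule sum_mono)
qed

lemma K_bounds:
  obtains C where "C \<ge> 0" "\<And>h. h \<in> L2_graph G \<Longrightarrow> L2_inner G (K' h) (K' h) \<le> C * L2_inner G h h"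
    "\<And>h e x. h \<in> L2_graph G \<Longrightarrow> e \<in> E \<Longrightarrow> x \<in> {0..l e} \<Longrightarrow> (K h e x)\<^sup>2 \<le> C * L2_inner G h h"
    "\<And>h. h \<in> L2_graph G \<Longrightarrow> L2_inner G (K h) (K h) \<le> C * L2_inner G h h"
proof -
  obtain P where P: "P \<ge> 0" "\<And>u u' e x. edgewise_C1 G u u' \<Longrightarrow> vertex_continuous G u \<Longrightarrow> e \<in> E \<Longrightarrow> x \<in> {0..l e} \<Longrightarrow>
     (u e x)\<^sup>2 \<le> P * L2_inner G u' u'" by (rule Poincare) blast
  define L where "L = sum l E"
  have L: "L \<ge> 0" unfolding L_def using len_pos by (intro sum_nonneg) (auto intro: less_imp_le)
  define Q where "Q = L * P"
  have Q: "Q \<ge> 0" using L P by (simp add: Q_def)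
  have pt: "(K h e x)\<^sup>2 \<le> P * L2_inner G (K' h) (K' h)" if "h \<in> L2_graph G" "e \<in> E" "x \<in> {0..l e}" for h e x
    using P(2)[OF K_solution(4,2)[OF that(1)] that(2,3)] .
  have KK: "L2_inner G (K h) (K h) \<le> Q * L2_inner G (K' h) (K' h)" if h: "h \<in> L2_graph G" for h
    using L2_inner_le_if_bounded[OF pt[OF h] K_L2(1)[OF h]] by (simp add: Q_def L_def mult.assoc)
  \<comment> \<open>With energy D = <K h, h>, Cauchy-Schwarz and \<open>KK\<close> give D^2 \<le> Q
    D |h|^2, and D cancels.\<close>
  have D: "L2_inner G (K' h) (K' h) \<le> Q * L2_inner G h h" if h: "h \<in> L2_graph G" for h
  proof (cases "L2_inner G (K' h) (K' h) = 0")
    case True then show ?thesis using Q B_nonneg[OF h] by simp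
  next
    case False
    then have pos: "0 < L2_inner G (K' h) (K' h)" using B_nonneg[OF K_L2(2)[OF h]] by simp
    have "(L2_inner G (K' h) (K' h))\<^sup>2 \<le> L2_inner G (K h) (K h) * L2_inner G h h"
      unfolding K_energy[OF h, symmetric] by (rule Cauchy_Schwarz[OF K_L2(1)[OF h] h])
    also have "\<dots> \<le> (Q * L2_inner G (K' h) (K' h)) * L2_inner G h h"
      using KK[OF h] B_nonneg[OF h] by (rule mult_right_mono)
    finally have "L2_inner G (K' h) (K' h) * L2_inner G (K' h) (K' h) \<le> L2_inner G (K' h) (K' h) * (Q * L2_inner G h h)"
      by (simp only: power2_eq_square mult_ac)
    then show ?thesis using pos by (simp only: mult_le_cancel_left_pos)
  qed
  \<comment> \<open>One constant for all three bounds: Q for the energy, P Q for point values, Q Q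
    for the norm.\<close>
  define C where "C = Q + P * Q + Q * Q"
  have le: "Q \<le> C" "P * Q \<le> C" "Q * Q \<le> C" using P(1) Q by (simp_all add: C_def)
  show ?thesis
  proof
    show "C \<ge> 0" using le Q by simp
    fix h assume h: "h \<in> L2_graph G"
    note nn = B_nonneg[OF h]
    show "L2_inner G (K' h) (K' h) \<le> C * L2_inner G h h"
      using D[OF h] mult_right_mono[OF le(1) nn] by simp
    show "L2_inner G (K h) (K h) \<le> C * L2_inner G h h"
      using KK[OF h] mult_left_mono[OF D[OF h] Q] mult_right_mono[OF le(3) nn] by (simp add: mult.assoc)
    fix e x assume "e \<in> E" "x \<in> {0..l e}"
    then show "(K h e x)\<^sup>2 \<le> C * L2_inner G h h"
      using pt[OF h, of e x] mult_left_mono[OF D[OF h] P(1)] mult_right_mono[OF le(2) nn] by (simp add: mult.assoc)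
  qed
qed

end

section \<open>Existence of eigensystems\<close>

text \<open>Induction over the edges, refining the subsequence once for each edge; the refinement
  keeps the convergence already achieved.\<close>

lemma Arzela_Ascoli_finite_family:
  fixes F :: "nat \<Rightarrow> 'e \<Rightarrow> real \<Rightarrow> real"
  assumes "finite A"
    and bound: "\<And>n e x. e \<in> A \<Longrightarrow> x \<in> {0..l e} \<Longrightarrow> \<bar>F n e x\<bar> \<le> M"
    and equi: "\<And>n e x y. e \<in> A \<Longrightarrow> x \<in> {0..l e} \<Longrightarrow> y \<in> {0..l e} \<Longrightarrow> (F n e x - F n e y)\<^sup>2 \<le> C * \<bar>x - y\<bar>"
  shows "\<exists>(r :: nat \<Rightarrow> nat) g. strict_mono r \<and> (\<forall>e\<in>A. continuous_on {0..l e} (g e) \<and>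
    (\<forall>\<epsilon>>0. \<exists>N. \<forall>n\<ge>N. \<forall>x\<in>{0..l e}. \<bar>F (r n) e x - g e x\<bar> < \<epsilon>))"
  using assms
proof (induction A rule: finite_induct)
  case empty
  show ?case by (intro exI[of _ id]) (auto simp: strict_mono_def)
next
  case (insert a A)
  obtain r g where r: "strict_mono (r :: nat \<Rightarrow> nat)" and
    g: "\<And>e. e \<in> A \<Longrightarrow> continuous_on {0..l e} (g e)"
       "\<And>e \<epsilon>. e \<in> A \<Longrightarrow> \<epsilon> > 0 \<Longrightarrow> \<exists>N. \<forall>n\<ge>N. \<forall>x\<in>{0..l e}. \<bar>F (r n) e x - g e x\<bar> < \<epsilon>"
    using insert.IH[OF insert.prems] by blast
  have equi_a: "(F n a x - F n a y)\<^sup>2 \<le> C * \<bar>x - y\<bar>" if "x \<in> {0..l a}" "y \<in> {0..l a}" for n x y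
    using insert.prems(2) that by blast
  obtain g0 k where g0: "continuous_on {0..l a} g0" and k: "strict_mono (k :: nat \<Rightarrow> nat)" and
    lim: "\<And>\<epsilon>. 0 < \<epsilon> \<Longrightarrow> \<exists>N. \<forall>n x. n \<ge> N \<and> x \<in> {0..l a} \<longrightarrow> norm (F (r (k n)) a x - g0 x) < \<epsilon>"
  proof (rule Arzela_Ascoli[of "{0..l a}" "\<lambda>n. F (r n) a" M])
    show "norm (F (r n) a x) \<le> M" if "x \<in> {0..l a}" for n x using insert.prems(1) that by simp
    fix x \<epsilon> :: real assume x: "x \<in> {0..l a}" and \<epsilon>: "0 < \<epsilon>"
    \<comment> \<open>Chosen so that (|C| + 1) d = \<epsilon>^2; the added 1 keeps the divisor
      positive.\<close>
    define d where "d = \<epsilon>\<^sup>2 / (\<bar>C\<bar> + 1)"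
    show "\<exists>d. 0 < d \<and> (\<forall>n y. y \<in> {0..l a} \<and> norm (x - y) < d \<longrightarrow> norm (F (r n) a x - F (r n) a y) < \<epsilon>)"
    proof (intro exI[of _ d] conjI allI impI)
      show "0 < d" using \<epsilon> by (simp add: d_def)
      fix n y assume y: "y \<in> {0..l a} \<and> norm (x - y) < d"
      have "(F (r n) a x - F (r n) a y)\<^sup>2 \<le> C * \<bar>x - y\<bar>" using equi_a x y by blast
      also have "\<dots> \<le> (\<bar>C\<bar> + 1) * \<bar>x - y\<bar>" by (intro mult_right_mono) auto
      also have "\<dots> < (\<bar>C\<bar> + 1) * d" using y by (intro mult_strict_left_mono) auto
      also have "\<dots> = \<epsilon>\<^sup>2" by (simp add: d_def)
      finally have "\<bar>F (r n) a x - F (r n) a y\<bar>\<^sup>2 < \<epsilon>\<^sup>2" by simp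
      then show "norm (F (r n) a x - F (r n) a y) < \<epsilon>"
        using \<epsilon> power_less_imp_less_base[of _ 2 \<epsilon>] by simp
    qed
  qed auto
  define g' where "g' = g(a := g0)"
  show ?case
  proof (intro exI[of _ "r \<circ> k"] exI[of _ g'] conjI ballI allI impI)
    show "strict_mono (r \<circ> k)" using r k by (rule strict_mono_o)
    fix e assume e: "e \<in> insert a A"
    show "continuous_on {0..l e} (g' e)" using e g(1) g0 by (auto simp: g'_def)
    fix \<epsilon> :: real assume \<epsilon>: "\<epsilon> > 0"
    show "\<exists>N. \<forall>n\<ge>N. \<forall>x\<in>{0..l e}. \<bar>F ((r \<circ> k) n) e x - g' e x\<bar> < \<epsilon>"
    proof (cases "e = a")
      case True
      then show ?thesis using lim[OF \<epsilon>] by (fastforce simp: g'_def)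
    next
      case False
      then have eA: "e \<in> A" using e by simp
      obtain N where N: "\<forall>n\<ge>N. \<forall>x\<in>{0..l e}. \<bar>F (r n) e x - g e x\<bar> < \<epsilon>" using g(2)[OF eA \<epsilon>] by blast
      have "k n \<ge> N" if "n \<ge> N" for n using seq_suble[OF k, of n] that by simp
      then show ?thesis using N False by (intro exI[of _ N]) (auto simp: g'_def)
    qed
  qed
qed

context dirichlet_graph
begin

text \<open>On the unit ball, \<open>K_bounds\<close> gives uniformly bounded point values and
  energies, hence equicontinuity. A uniformly convergent subsequence also converges in L^2 because
  the total length is finite.\<close>

lemma K_compact_sequence:
  assumes h: "\<And>n. h n \<in> L2_graph G" "\<And>n. L2_inner G (h n) (h n) \<le> 1"
  shows "\<exists>r g. strict_mono (r :: nat \<Rightarrow> nat) \<and> g \<in> L2_graph G \<and>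
    (\<lambda>n. L2_inner G (K (h (r n)) - g) (K (h (r n)) - g)) \<longlonglongrightarrow> 0"
proof -
  obtain C where C: "C \<ge> 0" "\<And>h. h \<in> L2_graph G \<Longrightarrow> L2_inner G (K' h) (K' h) \<le> C * L2_inner G h h"
    "\<And>h e x. h \<in> L2_graph G \<Longrightarrow> e \<in> E \<Longrightarrow> x \<in> {0..l e} \<Longrightarrow> (K h e x)\<^sup>2 \<le> C * L2_inner G h h"
    by (rule K_bounds) blast
  have C1: "C * L2_inner G (h n) (h n) \<le> C" for n using mult_left_mono[OF h(2) C(1), of n] by simp
  have "\<exists>(r :: nat \<Rightarrow> nat) g. strict_mono r \<and> (\<forall>e\<in>E. continuous_on {0..l e} (g e) \<and>
    (\<forall>\<epsilon>>0. \<exists>N. \<forall>n\<ge>N. \<forall>x\<in>{0..l e}. \<bar>K (h (r n)) e x - g e x\<bar> < \<epsilon>))"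
  proof (rule Arzela_Ascoli_finite_family[where F = "\<lambda>n. K (h n)" and M = "sqrt C" and C = C])
    fix n e x assume ex: "e \<in> E" "x \<in> {0..l e}"
    have "(K (h n) e x)\<^sup>2 \<le> C" using C(3)[OF h(1)[of n] ex] C1[of n] by simp
    then show "\<bar>K (h n) e x\<bar> \<le> sqrt C" by (rule real_le_rsqrt[of "\<bar>_\<bar>", simplified])
    fix y assume y: "y \<in> {0..l e}"
    have "(K (h n) e x - K (h n) e y)\<^sup>2 \<le> \<bar>x - y\<bar> * L2_inner G (K' (h n)) (K' (h n))"
      using edge_increment_le[OF K_solution(4)[OF h(1)] ex(1) y ex(2)] .
    also have "\<dots> \<le> \<bar>x - y\<bar> * C" using C(2)[OF h(1)[of n]] C1[of n] by (intro mult_left_mono) auto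
    finally show "(K (h n) e x - K (h n) e y)\<^sup>2 \<le> C * \<bar>x - y\<bar>" by (simp add: mult.commute)
  qed simp
  then obtain r g where r: "strict_mono (r :: nat \<Rightarrow> nat)" and g: "\<And>e. e \<in> E \<Longrightarrow> continuous_on {0..l e} (g e)"
    and lim: "\<And>e \<epsilon>. e \<in> E \<Longrightarrow> \<epsilon> > 0 \<Longrightarrow> \<exists>N. \<forall>n\<ge>N. \<forall>x\<in>{0..l e}. \<bar>K (h (r n)) e x - g e x\<bar> < \<epsilon>" by blast
  have gL2: "g \<in> L2_graph G" using g by (auto simp: L2_graph_def intro: continuous_on_imp_L2_interval)
  have "(\<lambda>n. L2_inner G (K (h (r n)) - g) (K (h (r n)) - g)) \<longlonglongrightarrow> 0"
  proof (rule LIMSEQ_I)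
    fix \<epsilon> :: real assume \<epsilon>: "0 < \<epsilon>"
    define L where "L = sum l E"
    have L: "L \<ge> 0" unfolding L_def using len_pos by (intro sum_nonneg) (auto intro: less_imp_le)
    \<comment> \<open>A pointwise error \<delta> costs at most L \<delta>^2 = \<epsilon> L / (L + 1)
      < \<epsilon> in the squared norm.\<close>
    define \<delta> where "\<delta> = sqrt (\<epsilon> / (L + 1))"
    have \<delta>: "\<delta> > 0" "\<delta>\<^sup>2 = \<epsilon> / (L + 1)" using \<epsilon> L by (simp_all add: \<delta>_def)
    have "\<forall>e\<in>E. \<exists>N. \<forall>n\<ge>N. \<forall>x\<in>{0..l e}. \<bar>K (h (r n)) e x - g e x\<bar> < \<delta>" using lim \<delta> by blast
    then obtain N where N: "\<And>e n x. e \<in> E \<Longrightarrow> n \<ge> N e \<Longrightarrow> x \<in> {0..l e} \<Longrightarrow> \<bar>K (h (r n)) e x - g e x\<bar> < \<delta>"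
      using bchoice[of E "\<lambda>e N. \<forall>n\<ge>N. \<forall>x\<in>{0..l e}. \<bar>K (h (r n)) e x - g e x\<bar> < \<delta>"] by blast
    have "norm (L2_inner G (K (h (r n)) - g) (K (h (r n)) - g) - 0) < \<epsilon>" if n: "n \<ge> (\<Sum>e\<in>E. N e)" for n
    proof -
      have V: "K (h (r n)) - g \<in> L2_graph G" using K_L2(1)[OF h(1)] gL2 by simp
      have "L2_inner G (K (h (r n)) - g) (K (h (r n)) - g) \<le> sum l E * (\<epsilon> / (L + 1))"
      proof (rule L2_inner_le_if_bounded[OF _ V])
        fix e x assume ex: "e \<in> E" "x \<in> {0..l e}"
        have "N e \<le> n" using member_le_sum[OF ex(1), of N] n by simp
        then have "\<bar>K (h (r n)) e x - g e x\<bar>\<^sup>2 \<le> \<delta>\<^sup>2"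
          using N[OF ex(1) _ ex(2), of n] by (intro power_mono) auto
        then show "((K (h (r n)) - g) e x)\<^sup>2 \<le> \<epsilon> / (L + 1)" using \<delta> by simp
      qed
      also have "\<dots> < \<epsilon>" using \<epsilon> L by (simp add: L_def[symmetric] pos_divide_less_eq)
      finally show ?thesis using B_nonneg[OF V] by simp
    qed
    then show "\<exists>no. \<forall>n\<ge>no. norm (L2_inner G (K (h (r n)) - g) (K (h (r n)) - g) - 0) < \<epsilon>" by blast
  qed
  then show ?thesis using r gL2 by blast
qed

text \<open>On a single edge there are card S + 1 monomials against card S orthogonality conditions,
  so some nontrivial combination is orthogonal to \<open>S\<close>. It is not null, since a nonzero
  polynomial has finitely many roots.\<close>

lemma L2_graph_infinite_dimensional:
  assumes S: "finite S" "S \<subseteq> L2_graph G"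
  shows "\<exists>x\<in>L2_graph G. L2_inner G x x \<noteq> 0 \<and> (\<forall>s\<in>S. L2_inner G x s = 0)"
proof -
  obtain e0 where e0: "e0 \<in> E" using arcs_nonempty by blast
  define p where "p j = (\<lambda>e x. if e = e0 then x ^ j else (0::real))" for j :: nat
  have pV: "p j \<in> L2_graph G" for j
  proof -
    have "continuous_on {0..l e} (p j e)" for e
      by (cases "e = e0") (auto simp: p_def intro!: continuous_intros)
    then show ?thesis by (simp add: L2_graph_def continuous_on_imp_L2_interval)
  qed
  obtain c where c: "\<exists>j\<in>{..card S}. c j \<noteq> 0" "\<And>s. s \<in> S \<Longrightarrow> (\<Sum>j\<in>{..card S}. L2_inner G (p j) s * c j) = 0"
    using homogeneous_system_nontrivial[of S "{..card S}" "\<lambda>s j. L2_inner G (p j) s"] S by auto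
  define x where "x = (\<Sum>j\<in>{..card S}. c j *\<^sub>R p j)"
  have xV: "x \<in> L2_graph G" unfolding x_def using pV by simp
  have "L2_inner G x s = 0" if "s \<in> S" for s
    unfolding x_def using c(2)[OF that] pV S that by (subst B_sum) (auto simp: B_scale mult.commute subset_iff)
  moreover have "L2_inner G x x \<noteq> 0"
  proof
    assume z: "L2_inner G x x = 0"
    define q where "q t = (\<Sum>j\<le>card S. c j * t ^ j)" for t
    have xq: "x e0 t = q t" for t by (simp add: x_def q_def sum_fun_apply p_def)
    have "(\<integral>t. (q t)\<^sup>2 \<partial>lebesgue_on {0..l e0}) \<le> 0"
      using L2_inner_self_edge_le[OF e0, of x] z by (simp add: xq)
    moreover have "0 \<le> (\<integral>t. (q t)\<^sup>2 \<partial>lebesgue_on {0..l e0})" by simp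
    ultimately have "(\<integral>t. (q t)\<^sup>2 \<partial>lebesgue_on {0..l e0}) = 0" by simp
    moreover have "continuous_on {0..l e0} (\<lambda>t. (q t)\<^sup>2)" unfolding q_def by (intro continuous_intros)
    ultimately have "\<forall>t\<in>{0..l e0}. (q t)\<^sup>2 = 0"
      using integralL_eq_0_iff[of 0 "l e0" "\<lambda>t. (q t)\<^sup>2"] len_pos[OF e0] by simp
    then have "{0..l e0} \<subseteq> {t. (\<Sum>j\<le>card S. c j * t ^ j) = 0}" by (auto simp: q_def)
    moreover have "finite {t. (\<Sum>j\<le>card S. c j * t ^ j) = 0}" using c(1) unfolding polyfun_finite_roots by auto
    ultimately have "finite {0..l e0}" by (rule finite_subset)
    then show False using len_pos[OF e0] infinite_Icc by blast
  qed
  ultimately show ?thesis using xV by blast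
qed

sublocale compact_positive_operator "L2_graph G" "L2_inner G" K
proof
  show "x \<in> L2_graph G \<Longrightarrow> K x \<in> L2_graph G" for x by (rule K_L2)
  show "x \<in> L2_graph G \<Longrightarrow> y \<in> L2_graph G \<Longrightarrow> L2_inner G (K x) y = L2_inner G x (K y)" for x y
    by (rule K_symmetric)
  show "0 \<le> L2_inner G x (K x)" if x: "x \<in> L2_graph G" for x
    using B_commute[OF x K_L2(1)[OF x]] K_energy[OF x] B_nonneg[OF K_L2(2)[OF x]] by simp
  show "x \<in> L2_graph G \<Longrightarrow> L2_inner G (K x) (K x) = 0 \<Longrightarrow> L2_inner G x x = 0" for x
    by (rule K_injective)
  show "\<exists>C. \<forall>x\<in>L2_graph G. L2_inner G (K x) (K x) \<le> C * L2_inner G x x"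
    using K_bounds by metis
qed (fact K_compact_sequence L2_graph_infinite_dimensional)+

lemma null_sum:
  assumes "finite I" "\<And>i. i \<in> I \<Longrightarrow> d i \<in> L2_graph G \<and> L2_inner G (d i) (d i) = 0"
  shows "L2_inner G (\<Sum>i\<in>I. c i *\<^sub>R d i) (\<Sum>i\<in>I. c i *\<^sub>R d i) = 0"
proof -
  let ?s = "\<Sum>i\<in>I. c i *\<^sub>R d i"
  have s: "?s \<in> L2_graph G" using assms by simp
  have "L2_inner G ?s ?s = (\<Sum>i\<in>I. L2_inner G (c i *\<^sub>R d i) ?s)" using assms s by (intro B_sum) auto
  also have "\<dots> = 0" using assms s null_left[OF _ s] by (intro sum.neutral) (auto simp: B_scale)
  finally show ?thesis .
qed

lemma null_add:
  assumes "x \<in> L2_graph G" "d \<in> L2_graph G" "L2_inner G d d = 0"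
  shows "L2_inner G (x + d) (x + d) = L2_inner G x x"
  using assms null_left[of d x] B_commute[of d x] by (simp add: B_add B_add_right)

text \<open>The abstract eigenvectors are known only up to null functions and need not satisfy
  vertex conditions. Each is replaced by its image under \<open>K\<close> divided by its eigenvalue,
  which equals it almost everywhere and lies in the domain of the Laplacian.\<close>

theorem eigensystem_exists: "\<exists>\<mu> \<phi>. eigensystem G \<mu> \<phi>"
proof -
  obtain \<kappa> \<phi> where orth: "orthonormal \<phi>" and eig: "\<And>n. eigenvector (\<kappa> n) (\<phi> n)" and pos: "\<And>n. 0 < \<kappa> n"
    and dec: "decseq \<kappa>" and lim: "\<kappa> \<longlonglongrightarrow> 0" and
    basis: "\<And>f. f \<in> L2_graph G \<Longrightarrow> (\<lambda>N. L2_inner G (f - (\<Sum>n<N. L2_inner G f (\<phi> n) *\<^sub>R \<phi> n)) (f - (\<Sum>n<N. L2_inner G f (\<phi> n) *\<^sub>R \<phi> n))) \<longlonglongrightarrow> 0"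
    by (rule spectral_theorem) blast
  have \<phi>V: "\<phi> n \<in> L2_graph G" for n using orth by (simp add: orthonormal_def)
  define \<psi> where "\<psi> n = (1 / \<kappa> n) *\<^sub>R K (\<phi> n)" for n
  define d where "d n = \<psi> n - \<phi> n" for n
  have \<psi>V: "\<psi> n \<in> L2_graph G" for n unfolding \<psi>_def by (intro V_closed K_L2 \<phi>V)
  have dV: "d n \<in> L2_graph G" for n unfolding d_def by (intro V_closed \<psi>V \<phi>V)
  have d0: "L2_inner G (d n) (d n) = 0" for n
  proof -
    have d_eq: "d n = (1 / \<kappa> n) *\<^sub>R (K (\<phi> n) - \<kappa> n *\<^sub>R \<phi> n)"
      using pos[of n] by (simp add: d_def \<psi>_def scaleR_diff_right)
    have V: "K (\<phi> n) - \<kappa> n *\<^sub>R \<phi> n \<in> L2_graph G" by (intro V_closed K_L2 \<phi>V)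
    show ?thesis unfolding d_eq using eig[of n] V
      by (simp add: B_scale B_scale_right eigenvector_def)
  qed
  have \<psi>_eq: "\<psi> n = \<phi> n + d n" for n by (simp add: d_def)
  have inner_\<psi>: "L2_inner G f (\<psi> n) = L2_inner G f (\<phi> n)" if f: "f \<in> L2_graph G" for f n
    using null_left[OF dV f d0] B_commute[OF f dV] unfolding \<psi>_eq by (simp add: B_add_right f \<phi>V dV)
  have orth\<psi>: "L2_inner G (\<psi> m) (\<psi> n) = (if m = n then 1 else 0)" for m n
    using inner_\<psi>[OF \<psi>V] inner_\<psi>[OF \<phi>V] B_commute[OF \<psi>V \<phi>V, of m n] orth by (simp add: orthonormal_def)
  have conv: "L2_series_converges G (\<lambda>n e x. L2_inner G f (\<psi> n) * \<psi> n e x) f" if f: "f \<in> L2_graph G" for f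
  proof -
    have "L2_norm G (\<lambda>e x. f e x - (\<Sum>n<N. L2_inner G f (\<psi> n) * \<psi> n e x)) =
       sqrt (L2_inner G (f - (\<Sum>n<N. L2_inner G f (\<phi> n) *\<^sub>R \<phi> n)) (f - (\<Sum>n<N. L2_inner G f (\<phi> n) *\<^sub>R \<phi> n)))" for N
    proof -
      let ?c = "\<lambda>n. L2_inner G f (\<phi> n)"
      let ?y = "f - (\<Sum>n<N. ?c n *\<^sub>R \<phi> n)" and ?s = "\<Sum>n<N. (- ?c n) *\<^sub>R d n"
      have "(\<lambda>e x. f e x - (\<Sum>n<N. L2_inner G f (\<psi> n) * \<psi> n e x)) = ?y + ?s"
        unfolding inner_\<psi>[OF f]
        by (simp add: fun_eq_iff sum_fun_apply \<psi>_eq distrib_left sum.distrib sum_negf)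
      moreover have "L2_inner G (?y + ?s) (?y + ?s) = L2_inner G ?y ?y"
        using null_sum[of "{..<N}" d "\<lambda>n. - ?c n"] dV d0 f \<phi>V by (intro null_add V_closed V_sum) auto
      ultimately show ?thesis by (simp add: L2_norm_def)
    qed
    then show ?thesis unfolding L2_series_converges_def using tendsto_real_sqrt[OF basis[OF f]] by simp
  qed
  \<comment> \<open>The second derivative of \<open>\<psi> n\<close> is expressed by the source
    \<open>\<phi> n\<close>; it matches \<open>\<psi> n\<close> almost everywhere because
    \<open>d n\<close> is null.\<close>
  have lap: "neg_laplacian G (\<psi> n) (\<lambda>e x. 1 / \<kappa> n * \<psi> n e x)" for n
    unfolding neg_laplacian_def
  proof (intro exI conjI ballI)
    note sol = K_solution[OF \<phi>V[of n]]
    fix e assume e: "e \<in> E"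
    show "H2_interval (l e) (\<psi> n e) (\<lambda>x. 1 / \<kappa> n * K' (\<phi> n) e x) (\<lambda>x. 1 / \<kappa> n * - \<phi> n e x)"
      unfolding H2_interval_def
    proof (intro conjI ballI)
      note H = H2_intervalD[OF sol(1)[OF e]]
      show "(\<lambda>x. 1 / \<kappa> n * - \<phi> n e x) \<in> L2_interval (l e)"
        unfolding L2_interval_eq by (rule L2_scale[OF H(2)[unfolded L2_interval_eq]])
      fix x assume x: "x \<in> {0..l e}"
      show "(\<psi> n e has_real_derivative 1 / \<kappa> n * K' (\<phi> n) e x) (at x within {0..l e})"
        using DERIV_cmult[OF H(1)[OF x], of "1 / \<kappa> n"] by (simp add: \<psi>_def scaleR_fun_def)
      show "1 / \<kappa> n * K' (\<phi> n) e x = 1 / \<kappa> n * K' (\<phi> n) e 0 + (\<integral>t. 1 / \<kappa> n * - \<phi> n e t \<partial>lebesgue_on {0..x})"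
        using H(3)[OF x] by (simp only: Bochner_Integration.integral_mult_right_zero distrib_left)
    qed
    have "AE x in lebesgue_on {0..l e}. d n e x = 0"
      using L2_null_iff[OF dV[of n]] d0[of n] e by blast
    then show "AE x in lebesgue_on {0..l e}. 1 / \<kappa> n * \<psi> n e x = - (1 / \<kappa> n * - \<phi> n e x)"
      by eventually_elim (simp add: \<psi>_eq)
  next
    obtain val where "\<forall>e\<in>E. K (\<phi> n) e 0 = val (src e) \<and> K (\<phi> n) e (l e) = val (dst e)" "\<forall>v\<in>dirichlet G. val v = 0"
      using K_solution(2)[OF \<phi>V[of n]] unfolding vertex_continuous_def by blast
    then show "vertex_continuous G (\<psi> n)"
      unfolding vertex_continuous_def by (intro exI[of _ "\<lambda>v. 1 / \<kappa> n * val v"]) (simp add: \<psi>_def)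
    show "kirchhoff G (\<lambda>e x. 1 / \<kappa> n * K' (\<phi> n) e x)"
      unfolding kirchhoff_def
    proof
      fix v assume v: "v \<in> verts (skeleton G) - dirichlet G"
      have "(\<Sum>e\<in>{e\<in>E. dst e = v}. 1 / \<kappa> n * K' (\<phi> n) e (l e)) + (\<Sum>e\<in>{e\<in>E. src e = v}. - (1 / \<kappa> n * K' (\<phi> n) e 0))
        = 1 / \<kappa> n * ((\<Sum>e\<in>{e\<in>E. dst e = v}. K' (\<phi> n) e (l e)) + (\<Sum>e\<in>{e\<in>E. src e = v}. - K' (\<phi> n) e 0))"
        unfolding distrib_left sum_distrib_left by simp
      then show "(\<Sum>e\<in>{e\<in>E. dst e = v}. 1 / \<kappa> n * K' (\<phi> n) e (l e)) + (\<Sum>e\<in>{e\<in>E. src e = v}. - (1 / \<kappa> n * K' (\<phi> n) e 0)) = 0"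
        using K_solution(3)[OF \<phi>V[of n]] v by (simp add: kirchhoff_def)
    qed
  qed
  have "eigensystem G (\<lambda>n. 1 / \<kappa> n) \<psi>"
    unfolding eigensystem_def orthonormal_basis_def
  proof (intro conjI allI ballI)
    show "incseq (\<lambda>n. 1 / \<kappa> n)"
      using dec pos by (auto simp: incseq_def decseq_def intro!: divide_left_mono mult_pos_pos)
    have "filterlim \<kappa> (at_right 0) sequentially"
      using lim pos by (auto simp: filterlim_at less_imp_neq[OF pos, symmetric] intro!: always_eventually)
    then show "filterlim (\<lambda>n. 1 / \<kappa> n) at_top sequentially"
      unfolding divide_inverse mult_1 by (rule filterlim_compose[OF filterlim_inverse_at_top_right])
  qed (use pos \<psi>V orth\<psi> conv lap in auto)
  then show ?thesis by blast
qed

end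

section \<open>The variational principle for the resolvent\<close>

context dirichlet_graph
begin

abbreviation "\<mu>\<^sub>G \<equiv> eigval G"
abbreviation "\<phi>\<^sub>G \<equiv> eigfun G"
abbreviation "c\<^sub>G n \<equiv> L2_inner G (\<lambda>e x. 1) (\<phi>\<^sub>G n)"

lemma eigensystem_chosen: "eigensystem G \<mu>\<^sub>G \<phi>\<^sub>G"
proof -
  have "\<exists>p. eigensystem G (fst p) (snd p)" using eigensystem_exists by simp
  then show ?thesis unfolding eigval_def eigfun_def chosen_eigensystem_def by (rule someI_ex)
qed

lemma eigval_pos: "0 < \<mu>\<^sub>G n"
  using eigensystem_chosen by (simp add: eigensystem_def)

lemma eigval_ge: "\<mu>\<^sub>G 0 \<le> \<mu>\<^sub>G n"
  using eigensystem_chosen by (auto simp: eigensystem_def incseq_def)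

lemma eigfun_orthonormal: "orthonormal \<phi>\<^sub>G"
  using eigensystem_chosen by (simp add: eigensystem_def orthonormal_basis_def orthonormal_def)

lemma eigfun_L2: "\<phi>\<^sub>G n \<in> L2_graph G"
  using eigfun_orthonormal by (simp add: orthonormal_def)

lemma one_L2: "(\<lambda>e x. 1) \<in> L2_graph G"
  by (auto simp: L2_graph_def intro!: continuous_on_imp_L2_interval)

lemma L2_series_converges_iff:
  assumes f: "f \<in> L2_graph G"
  shows "L2_series_converges G (\<lambda>n e x. a n * \<phi>\<^sub>G n e x) f \<longleftrightarrow>
    (\<lambda>N. L2_inner G (f - (\<Sum>n<N. a n *\<^sub>R \<phi>\<^sub>G n)) (f - (\<Sum>n<N. a n *\<^sub>R \<phi>\<^sub>G n))) \<longlonglongrightarrow> 0"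
proof -
  let ?r = "\<lambda>N. f - (\<Sum>n<N. a n *\<^sub>R \<phi>\<^sub>G n)"
  have eq: "(\<lambda>e x. f e x - (\<Sum>n<N. a n * \<phi>\<^sub>G n e x)) = ?r N" for N
    by (simp add: fun_eq_iff sum_fun_apply)
  have nn: "0 \<le> L2_inner G (?r N) (?r N)" for N
    using f eigfun_L2 by (intro B_nonneg V_closed V_sum) auto
  have "((\<lambda>N. sqrt (L2_inner G (?r N) (?r N))) \<longlonglongrightarrow> 0) = ((\<lambda>N. L2_inner G (?r N) (?r N)) \<longlonglongrightarrow> 0)"
  proof
    assume "(\<lambda>N. sqrt (L2_inner G (?r N) (?r N))) \<longlonglongrightarrow> 0"
    then have "(\<lambda>N. (sqrt (L2_inner G (?r N) (?r N)))\<^sup>2) \<longlonglongrightarrow> 0\<^sup>2" by (rule tendsto_power)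
    then show "(\<lambda>N. L2_inner G (?r N) (?r N)) \<longlonglongrightarrow> 0" using nn by simp
  next
    assume "(\<lambda>N. L2_inner G (?r N) (?r N)) \<longlonglongrightarrow> 0"
    from tendsto_real_sqrt[OF this] show "(\<lambda>N. sqrt (L2_inner G (?r N) (?r N))) \<longlonglongrightarrow> 0" by simp
  qed
  then show ?thesis unfolding L2_series_converges_def L2_norm_def eq .
qed

lemma eigfun_basis:
  assumes f: "f \<in> L2_graph G"
  shows "(\<lambda>N. L2_inner G (f - (\<Sum>n<N. L2_inner G f (\<phi>\<^sub>G n) *\<^sub>R \<phi>\<^sub>G n)) (f - (\<Sum>n<N. L2_inner G f (\<phi>\<^sub>G n) *\<^sub>R \<phi>\<^sub>G n))) \<longlonglongrightarrow> 0"
  using eigensystem_chosen f unfolding L2_series_converges_iff[OF f, symmetric]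
  by (simp add: eigensystem_def orthonormal_basis_def)

lemma series_coefficient:
  assumes f: "f \<in> L2_graph G" and "L2_series_converges G (\<lambda>n e x. a n * \<phi>\<^sub>G n e x) f"
  shows "L2_inner G f (\<phi>\<^sub>G m) = a m"
proof -
  let ?s = "\<lambda>N. \<Sum>n<N. a n *\<^sub>R \<phi>\<^sub>G n"
  have s: "?s N \<in> L2_graph G" for N using eigfun_L2 by (intro V_sum V_closed)
  have "(\<lambda>N. L2_inner G (?s N - f) (?s N - f)) \<longlonglongrightarrow> 0"
    using assms(2) unfolding L2_series_converges_iff[OF f] square_diff_commute[OF s f] .
  then have "(\<lambda>N. L2_inner G (?s N) (\<phi>\<^sub>G m)) \<longlonglongrightarrow> L2_inner G f (\<phi>\<^sub>G m)"
    by (intro tendsto_B_left s f eigfun_L2)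
  moreover have "\<forall>\<^sub>F N in sequentially. L2_inner G (?s N) (\<phi>\<^sub>G m) = a m"
    using eventually_gt_at_top[of m] by eventually_elim (simp add: orthonormal_sum_inner[OF eigfun_orthonormal])
  then have "(\<lambda>N. L2_inner G (?s N) (\<phi>\<^sub>G m)) \<longlonglongrightarrow> a m" by (rule tendsto_eventually)
  ultimately show ?thesis by (rule LIMSEQ_unique)
qed

section \<open>The series formula for the fractional torsional rigidity\<close>

lemma summable_one_coefficients: "summable (\<lambda>n. (c\<^sub>G n)\<^sup>2)"
  by (rule summableI_nonneg_bounded[where x = "L2_inner G (\<lambda>e x. 1) (\<lambda>e x. 1)"])
     (use Bessel[OF eigfun_orthonormal one_L2] in simp_all)

text \<open>The function with coefficients \<mu>_n^-\<alpha> c_n exists by Riesz-Fischer, because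
  \<mu>_n \<ge> \<mu>_0 > 0 keeps these coefficients square summable.\<close>

lemma frac_torsion_solution:
  assumes "0 < \<alpha>"
  shows "\<exists>u. frac_laplacian G \<alpha> u (\<lambda>e x. 1)"
proof -
  define b where "b n = \<mu>\<^sub>G n powr (- \<alpha>) * c\<^sub>G n" for n
  have "(b n)\<^sup>2 \<le> (\<mu>\<^sub>G 0 powr (- \<alpha>))\<^sup>2 * (c\<^sub>G n)\<^sup>2" for n
    unfolding b_def power_mult_distrib using eigval_pos[of 0] eigval_ge[of n] assms
    by (intro mult_right_mono power_mono powr_mono2') auto
  then have "summable (\<lambda>n. (b n)\<^sup>2)"
    by (intro summable_comparison_test'[OF summable_mult[OF summable_one_coefficients, of "(\<mu>\<^sub>G 0 powr (- \<alpha>))\<^sup>2"]]) simp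
  then obtain u where u: "u \<in> L2_graph G" "\<And>n. L2_inner G u (\<phi>\<^sub>G n) = b n"
    by (rule Riesz_Fischer[OF eigfun_orthonormal]) blast
  have canc: "\<mu>\<^sub>G n powr \<alpha> * b n = c\<^sub>G n" for n
    using eigval_pos[of n] by (simp add: b_def mult.assoc[symmetric] flip: powr_add)
  have "\<mu>\<^sub>G n powr (2 * \<alpha>) * \<bar>b n\<bar>\<^sup>2 = (c\<^sub>G n)\<^sup>2" for n
  proof -
    have "\<mu>\<^sub>G n powr (2 * \<alpha>) = (\<mu>\<^sub>G n powr \<alpha>)\<^sup>2"
      by (simp add: power2_eq_square flip: powr_add)
    then show ?thesis by (simp add: canc flip: power_mult_distrib)
  qed
  then have "frac_laplacian G \<alpha> u (\<lambda>e x. 1)"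
    unfolding frac_laplacian_def u(2) canc L2_series_converges_iff[OF one_L2]
    using u(1) one_L2 summable_one_coefficients eigfun_basis[OF one_L2] by simp
  then show ?thesis by (rule exI[of _ u])
qed

text \<open>Whichever torsion function is chosen, the defining equation forces its coefficients.
  Parseval against the constant 1 then gives its integral.\<close>

theorem frac_torsional_rigidity_sums:
  assumes "0 < \<alpha>"
  shows "(\<lambda>n. \<mu>\<^sub>G n powr (- \<alpha>) * (c\<^sub>G n)\<^sup>2) sums frac_torsional_rigidity \<alpha> G"
proof -
  define u where "u = frac_torsion_function G \<alpha>"
  have u: "frac_laplacian G \<alpha> u (\<lambda>e x. 1)"
    unfolding u_def frac_torsion_function_def using frac_torsion_solution[OF assms] by (rule someI_ex)
  then have uV: "u \<in> L2_graph G" by (simp add: frac_laplacian_def)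
  have "c\<^sub>G n = \<mu>\<^sub>G n powr \<alpha> * L2_inner G u (\<phi>\<^sub>G n)" for n
    using u by (intro series_coefficient one_L2) (simp add: frac_laplacian_def)
  then have coeff: "L2_inner G u (\<phi>\<^sub>G n) = \<mu>\<^sub>G n powr (- \<alpha>) * c\<^sub>G n" for n
    using eigval_pos[of n] by (simp add: mult.assoc[symmetric] flip: powr_add)
  have "(\<lambda>n. L2_inner G u (\<phi>\<^sub>G n) * c\<^sub>G n) sums L2_inner G u (\<lambda>e x. 1)"
    by (rule Parseval[OF eigfun_orthonormal uV one_L2 eigfun_basis[OF uV]])
  moreover have "L2_inner G u (\<lambda>e x. 1) = frac_torsional_rigidity \<alpha> G"
    by (simp add: L2_inner_def frac_torsional_rigidity_def u_def)
  ultimately show ?thesis by (simp add: coeff power2_eq_square mult.assoc)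
qed

text \<open>\<open>neg_laplacian\<close> provides the derivative only existentially; it is fixed
  here together with the weak eigenvalue equation.\<close>

definition eigfun_deriv :: "nat \<Rightarrow> 'e \<Rightarrow> real \<Rightarrow> real" where
  "eigfun_deriv n = (SOME f'. edgewise_C1 G (\<phi>\<^sub>G n) f' \<and>
     (\<forall>u u'. edgewise_C1 G u u' \<longrightarrow> vertex_continuous G u \<longrightarrow> L2_inner G u' f' = \<mu>\<^sub>G n * L2_inner G u (\<phi>\<^sub>G n)))"

lemma eigfun_deriv:
  shows "edgewise_C1 G (\<phi>\<^sub>G n) (eigfun_deriv n)"
    and "edgewise_C1 G u u' \<Longrightarrow> vertex_continuous G u \<Longrightarrow> L2_inner G u' (eigfun_deriv n) = \<mu>\<^sub>G n * L2_inner G u (\<phi>\<^sub>G n)"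
    and "vertex_continuous G (\<phi>\<^sub>G n)"
proof -
  have "neg_laplacian G (\<phi>\<^sub>G n) (\<lambda>e x. \<mu>\<^sub>G n * \<phi>\<^sub>G n e x)"
    using eigensystem_chosen by (simp add: eigensystem_def)
  then obtain f' f'' where H2: "\<And>e. e \<in> E \<Longrightarrow> H2_interval (l e) (\<phi>\<^sub>G n e) (f' e) (f'' e)"
    and vc: "vertex_continuous G (\<phi>\<^sub>G n)" and k: "kirchhoff G f'"
    and AE: "\<And>e. e \<in> E \<Longrightarrow> AE x in lebesgue_on {0..l e}. \<mu>\<^sub>G n * \<phi>\<^sub>G n e x = - f'' e x"
    unfolding neg_laplacian_def by blast
  show "vertex_continuous G (\<phi>\<^sub>G n)" by fact
  have h_eq: "(\<lambda>e x. \<mu>\<^sub>G n * \<phi>\<^sub>G n e x) = \<mu>\<^sub>G n *\<^sub>R \<phi>\<^sub>G n" by (simp add: fun_eq_iff)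
  have hV: "(\<lambda>e x. \<mu>\<^sub>G n * \<phi>\<^sub>G n e x) \<in> L2_graph G" unfolding h_eq by (intro V_closed eigfun_L2)
  have "L2_inner G u' f' = \<mu>\<^sub>G n * L2_inner G u (\<phi>\<^sub>G n)" if u: "edgewise_C1 G u u'" "vertex_continuous G u" for u u'
    using Green_formula[OF H2 k AE hV u] edgewise_C1_L2(1)[OF u(1)] eigfun_L2[of n]
    unfolding h_eq by (simp add: B_scale_right)
  then have "\<exists>f'. edgewise_C1 G (\<phi>\<^sub>G n) f' \<and>
     (\<forall>u u'. edgewise_C1 G u u' \<longrightarrow> vertex_continuous G u \<longrightarrow> L2_inner G u' f' = \<mu>\<^sub>G n * L2_inner G u (\<phi>\<^sub>G n))"
    using H2_edgewise_C1[OF H2] by blast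
  from someI_ex[OF this] show "edgewise_C1 G (\<phi>\<^sub>G n) (eigfun_deriv n)"
    and "edgewise_C1 G u u' \<Longrightarrow> vertex_continuous G u \<Longrightarrow> L2_inner G u' (eigfun_deriv n) = \<mu>\<^sub>G n * L2_inner G u (\<phi>\<^sub>G n)"
    unfolding eigfun_deriv_def by blast+
qed

text \<open>The weak eigenvalue equation tested with another eigenfunction: orthogonality in L^2
  carries over to the energy.\<close>

lemma eigfun_deriv_inner: "L2_inner G (eigfun_deriv m) (eigfun_deriv n) = (if m = n then \<mu>\<^sub>G n else 0)"
  using eigfun_deriv(2)[OF eigfun_deriv(1,3)] eigfun_orthonormal by (simp add: orthonormal_def)

lemma eigfun_deriv_L2: "eigfun_deriv n \<in> L2_graph G"
  by (rule edgewise_C1_L2(2)[OF eigfun_deriv(1)])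

lemma eigfun_deriv_orthonormal: "orthonormal (\<lambda>n. (1 / sqrt (\<mu>\<^sub>G n)) *\<^sub>R eigfun_deriv n)"
  unfolding orthonormal_def
proof (intro conjI allI)
  show "(1 / sqrt (\<mu>\<^sub>G n)) *\<^sub>R eigfun_deriv n \<in> L2_graph G" for n by (intro V_closed eigfun_deriv_L2)
  show "L2_inner G ((1 / sqrt (\<mu>\<^sub>G m)) *\<^sub>R eigfun_deriv m) ((1 / sqrt (\<mu>\<^sub>G n)) *\<^sub>R eigfun_deriv n) = (if m = n then 1 else 0)" for m n
    using eigfun_deriv_L2 eigval_pos[of n] by (simp add: B_scale B_scale_right eigfun_deriv_inner real_div_sqrt)
qed

text \<open>Bessel's inequality twice: for \<open>u\<close>, and for \<open>u'\<close> with the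
  normalised derivatives, where the coefficients are sqrt \<mu>_n <u, \<phi>_n>.\<close>

lemma energy_Bessel:
  assumes u: "edgewise_C1 G u u'" "vertex_continuous G u" and t: "0 \<le> t"
  shows "(\<Sum>n<M. (\<mu>\<^sub>G n + t) * (L2_inner G u (\<phi>\<^sub>G n))\<^sup>2) \<le> L2_inner G u' u' + t * L2_inner G u u"
proof -
  have "(L2_inner G u' ((1 / sqrt (\<mu>\<^sub>G n)) *\<^sub>R eigfun_deriv n))\<^sup>2 = \<mu>\<^sub>G n * (L2_inner G u (\<phi>\<^sub>G n))\<^sup>2" for n
    using eigfun_deriv(2)[OF u, of n] eigfun_deriv_L2[of n] edgewise_C1_L2(2)[OF u(1)] eigval_pos[of n]
    by (simp add: B_scale_right power_mult_distrib power_divide) (simp add: power2_eq_square)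
  then have "(\<Sum>n<M. \<mu>\<^sub>G n * (L2_inner G u (\<phi>\<^sub>G n))\<^sup>2) \<le> L2_inner G u' u'"
    using Bessel[OF eigfun_deriv_orthonormal edgewise_C1_L2(2)[OF u(1)], of M] by simp
  moreover have "t * (\<Sum>n<M. (L2_inner G u (\<phi>\<^sub>G n))\<^sup>2) \<le> t * L2_inner G u u"
    using Bessel[OF eigfun_orthonormal edgewise_C1_L2(1)[OF u(1)], of M] t by (rule mult_left_mono)
  ultimately show ?thesis by (simp add: distrib_right sum.distrib sum_distrib_left)
qed

section \<open>The resolvent sum as a supremum\<close>

lemma summable_resolvent:
  assumes "0 \<le> t" shows "summable (\<lambda>n. (c\<^sub>G n)\<^sup>2 / (\<mu>\<^sub>G n + t))"
proof (rule summable_comparison_test'[OF summable_mult[OF summable_one_coefficients, of "1 / \<mu>\<^sub>G 0"]])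
  fix n
  have "(c\<^sub>G n)\<^sup>2 / (\<mu>\<^sub>G n + t) \<le> (c\<^sub>G n)\<^sup>2 / \<mu>\<^sub>G 0"
    using eigval_pos[of 0] eigval_ge[of n] assms by (intro divide_left_mono) auto
  then show "norm ((c\<^sub>G n)\<^sup>2 / (\<mu>\<^sub>G n + t)) \<le> 1 / \<mu>\<^sub>G 0 * (c\<^sub>G n)\<^sup>2"
    using eigval_pos[of n] assms by simp
qed

text \<open>Upper half of the variational principle: Cauchy-Schwarz for the Parseval sum of <u, 1>,
  with weights sqrt (\<mu>_n + t) distributed over the two factors.\<close>

lemma one_inner_square_le:
  assumes u: "edgewise_C1 G u u'" "vertex_continuous G u" and t: "0 \<le> t"
  shows "(L2_inner G u (\<lambda>e x. 1))\<^sup>2 \<le> (L2_inner G u' u' + t * L2_inner G u u) * (\<Sum>n. (c\<^sub>G n)\<^sup>2 / (\<mu>\<^sub>G n + t))"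
proof (rule LIMSEQ_le_const2)
  have uV: "u \<in> L2_graph G" by (rule edgewise_C1_L2(1)[OF u(1)])
  have "(\<lambda>n. L2_inner G u (\<phi>\<^sub>G n) * c\<^sub>G n) sums L2_inner G u (\<lambda>e x. 1)"
    by (rule Parseval[OF eigfun_orthonormal uV one_L2 eigfun_basis[OF uV]])
  then show "(\<lambda>M. (\<Sum>n<M. L2_inner G u (\<phi>\<^sub>G n) * c\<^sub>G n)\<^sup>2) \<longlonglongrightarrow> (L2_inner G u (\<lambda>e x. 1))\<^sup>2"
    unfolding sums_def by (intro tendsto_power)
  have pos: "0 < \<mu>\<^sub>G n + t" for n using eigval_pos[of n] t by simp
  have "(\<Sum>n<M. L2_inner G u (\<phi>\<^sub>G n) * c\<^sub>G n)\<^sup>2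
    \<le> (L2_inner G u' u' + t * L2_inner G u u) * (\<Sum>n. (c\<^sub>G n)\<^sup>2 / (\<mu>\<^sub>G n + t))" for M
  proof -
    let ?w = "\<lambda>n. sqrt (\<mu>\<^sub>G n + t)"
    have "(\<Sum>n<M. L2_inner G u (\<phi>\<^sub>G n) * c\<^sub>G n)\<^sup>2 = (\<Sum>n<M. (?w n * L2_inner G u (\<phi>\<^sub>G n)) * (c\<^sub>G n / ?w n))\<^sup>2"
      using pos by (intro arg_cong[where f = "\<lambda>x. x\<^sup>2"] sum.cong refl) (simp add: less_imp_neq[OF pos, symmetric])
    also have "\<dots> \<le> (\<Sum>n<M. (?w n * L2_inner G u (\<phi>\<^sub>G n))\<^sup>2) * (\<Sum>n<M. (c\<^sub>G n / ?w n)\<^sup>2)"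
      by (rule Cauchy_Schwarz_ineq_sum)
    also have "\<dots> = (\<Sum>n<M. (\<mu>\<^sub>G n + t) * (L2_inner G u (\<phi>\<^sub>G n))\<^sup>2) * (\<Sum>n<M. (c\<^sub>G n)\<^sup>2 / (\<mu>\<^sub>G n + t))"
      using less_imp_le[OF pos] by (simp add: power_mult_distrib power_divide)
    also have "\<dots> \<le> (L2_inner G u' u' + t * L2_inner G u u) * (\<Sum>n. (c\<^sub>G n)\<^sup>2 / (\<mu>\<^sub>G n + t))"
    proof (intro mult_mono)
      show "(\<Sum>n<M. (\<mu>\<^sub>G n + t) * (L2_inner G u (\<phi>\<^sub>G n))\<^sup>2) \<le> L2_inner G u' u' + t * L2_inner G u u"
        by (rule energy_Bessel[OF u t])
      show "(\<Sum>n<M. (c\<^sub>G n)\<^sup>2 / (\<mu>\<^sub>G n + t)) \<le> (\<Sum>n. (c\<^sub>G n)\<^sup>2 / (\<mu>\<^sub>G n + t))"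
        using pos by (intro sum_le_suminf summable_resolvent t) (auto intro: divide_nonneg_pos)
      show "0 \<le> L2_inner G u' u' + t * L2_inner G u u"
        using B_nonneg[OF uV] B_nonneg[OF edgewise_C1_L2(2)[OF u(1)]] t by simp
      show "0 \<le> (\<Sum>n<M. (c\<^sub>G n)\<^sup>2 / (\<mu>\<^sub>G n + t))"
        using pos by (intro sum_nonneg) (auto intro: divide_nonneg_pos)
    qed
    finally show ?thesis .
  qed
  then show "\<exists>N. \<forall>M\<ge>N. (\<Sum>n<M. L2_inner G u (\<phi>\<^sub>G n) * c\<^sub>G n)\<^sup>2
    \<le> (L2_inner G u' u' + t * L2_inner G u u) * (\<Sum>n. (c\<^sub>G n)\<^sup>2 / (\<mu>\<^sub>G n + t))" by blast
qed

text \<open>Lower half: for truncated expansions of (-\<Delta> + t)^-1 1, numerator root and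
  denominator of the quotient are the same partial sum S, so the quotient S^2 / S recovers
  S.\<close>

lemma resolvent_test_function:
  assumes t: "0 \<le> t"
  obtains u u' where "edgewise_C1 G u u'" "vertex_continuous G u"
    "L2_inner G u (\<lambda>e x. 1) = (\<Sum>n<N. (c\<^sub>G n)\<^sup>2 / (\<mu>\<^sub>G n + t))"
    "L2_inner G u' u' + t * L2_inner G u u = (\<Sum>n<N. (c\<^sub>G n)\<^sup>2 / (\<mu>\<^sub>G n + t))"
proof -
  have pos: "0 < \<mu>\<^sub>G n + t" for n using eigval_pos[of n] t by simp
  define b where "b n = c\<^sub>G n / (\<mu>\<^sub>G n + t)" for n
  define u where "u = (\<Sum>n<N. b n *\<^sub>R \<phi>\<^sub>G n)"
  define u' where "u' = (\<Sum>n<N. b n *\<^sub>R eigfun_deriv n)"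
  have uV: "u \<in> L2_graph G" unfolding u_def by (intro V_sum V_closed eigfun_L2)
  have C1: "edgewise_C1 G u u'"
    unfolding edgewise_C1_def
  proof (intro ballI conjI)
    fix e assume e: "e \<in> E"
    have ue: "u e = (\<lambda>x. \<Sum>n<N. b n * \<phi>\<^sub>G n e x)" "u' e = (\<lambda>x. \<Sum>n<N. b n * eigfun_deriv n e x)"
      by (simp_all add: u_def u'_def sum_fun_apply fun_eq_iff)
    show "continuous_on {0..l e} (u' e)" unfolding ue
      by (intro continuous_intros edgewise_C1D(2)[OF eigfun_deriv(1) e])
    fix x assume "x \<in> {0..l e}"
    then show "(u e has_real_derivative u' e x) (at x within {0..l e})" unfolding ue
      by (intro DERIV_sum DERIV_cmult edgewise_C1D(1)[OF eigfun_deriv(1) e])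
  qed
  have vc: "vertex_continuous G u"
  proof -
    have "\<forall>n. \<exists>val. (\<forall>e\<in>E. \<phi>\<^sub>G n e 0 = val (src e) \<and> \<phi>\<^sub>G n e (l e) = val (dst e)) \<and> (\<forall>v\<in>dirichlet G. val v = 0)"
      using eigfun_deriv(3) by (simp add: vertex_continuous_def)
    from choice[OF this] obtain val where "\<forall>n. (\<forall>e\<in>E. \<phi>\<^sub>G n e 0 = val n (src e) \<and> \<phi>\<^sub>G n e (l e) = val n (dst e)) \<and> (\<forall>v\<in>dirichlet G. val n v = 0)" ..
    then show ?thesis unfolding vertex_continuous_def
      by (intro exI[of _ "\<lambda>v. \<Sum>n<N. b n * val n v"]) (simp add: u_def sum_fun_apply)
  qed
  have inner_u: "L2_inner G z u = (\<Sum>n<N. b n * L2_inner G z (\<phi>\<^sub>G n))" if z: "z \<in> L2_graph G" for z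
  proof -
    have "L2_inner G u z = (\<Sum>n<N. b n * L2_inner G (\<phi>\<^sub>G n) z)"
      unfolding u_def using z eigfun_L2 by (subst B_sum) (auto simp: B_scale)
    then show ?thesis using B_commute[OF z uV] B_commute[OF z eigfun_L2] by simp
  qed
  have u\<phi>: "L2_inner G u (\<phi>\<^sub>G n) = b n" if "n < N" for n
    using orthonormal_sum_inner[OF eigfun_orthonormal, of "{..<N}" b n] that by (simp add: u_def)
  have "L2_inner G u (\<lambda>e x. 1) = (\<Sum>n<N. (c\<^sub>G n)\<^sup>2 / (\<mu>\<^sub>G n + t))"
    using B_commute[OF uV one_L2] inner_u[OF one_L2] by (simp add: b_def power2_eq_square)
  moreover have "L2_inner G u' u' + t * L2_inner G u u = (\<Sum>n<N. (c\<^sub>G n)\<^sup>2 / (\<mu>\<^sub>G n + t))"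
  proof -
    have u'V: "u' \<in> L2_graph G" by (rule edgewise_C1_L2(2)[OF C1])
    have "L2_inner G u' u' = (\<Sum>n<N. b n * L2_inner G (eigfun_deriv n) u')"
      by (subst (1) u'_def) (use u'V eigfun_deriv_L2 in \<open>simp add: B_sum B_scale\<close>)
    also have "\<dots> = (\<Sum>n<N. b n * (\<mu>\<^sub>G n * b n))"
    proof (rule sum.cong[OF refl])
      fix n assume "n \<in> {..<N}"
      then show "b n * L2_inner G (eigfun_deriv n) u' = b n * (\<mu>\<^sub>G n * b n)"
        using eigfun_deriv(2)[OF C1 vc, of n] u\<phi>[of n] B_commute[OF u'V eigfun_deriv_L2, of n] by simp
    qed
    finally have e1: "L2_inner G u' u' = (\<Sum>n<N. b n * (\<mu>\<^sub>G n * b n))" .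
    have e2: "L2_inner G u u = (\<Sum>n<N. b n * b n)" using inner_u[OF uV] u\<phi> by simp
    have "L2_inner G u' u' + t * L2_inner G u u = (\<Sum>n<N. (\<mu>\<^sub>G n + t) * (b n)\<^sup>2)"
      unfolding e1 e2 sum_distrib_left sum.distrib[symmetric]
      by (intro sum.cong) (auto simp: power2_eq_square algebra_simps)
    also have "\<dots> = (\<Sum>n<N. (c\<^sub>G n)\<^sup>2 / (\<mu>\<^sub>G n + t))"
      using less_imp_neq[OF pos] by (intro sum.cong) (auto simp: b_def power2_eq_square)
    finally show ?thesis .
  qed
  ultimately show ?thesis using that[OF C1 vc] by blast
qed

end

section \<open>Fractional rigidity and gluing\<close>

text \<open>The test function for a partial sum S on \<open>G'\<close> is admissible on
  \<open>G\<close>, where the upper bound reads S^2 \<le> S R with R the full resolvent sum of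
  \<open>G\<close>. For S > 0 this gives S \<le> R.\<close>

lemma resolvent_mono:
  assumes "dirichlet_graph G" "dirichlet_graph G'" and inner: "L2_inner G' = L2_inner G"
    and C1: "\<And>u u'. edgewise_C1 G' u u' \<Longrightarrow> edgewise_C1 G u u'"
    and vc: "\<And>u. vertex_continuous G' u \<Longrightarrow> vertex_continuous G u" and t: "0 \<le> t"
  shows "(\<Sum>n. (L2_inner G' (\<lambda>e x. 1) (eigfun G' n))\<^sup>2 / (eigval G' n + t))
    \<le> (\<Sum>n. (L2_inner G (\<lambda>e x. 1) (eigfun G n))\<^sup>2 / (eigval G n + t))"
proof -
  interpret A: dirichlet_graph G by fact
  interpret A': dirichlet_graph G' by fact
  let ?R = "\<Sum>n. (L2_inner G (\<lambda>e x. 1) (eigfun G n))\<^sup>2 / (eigval G n + t)"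
  have R: "0 \<le> ?R"
    by (intro suminf_nonneg A.summable_resolvent t divide_nonneg_pos add_pos_nonneg A.eigval_pos) simp
  show ?thesis
  proof (rule suminf_le_const[OF A'.summable_resolvent[OF t]])
    fix N
    let ?S = "\<Sum>n<N. (L2_inner G' (\<lambda>e x. 1) (eigfun G' n))\<^sup>2 / (eigval G' n + t)"
    obtain u u' where u: "edgewise_C1 G' u u'" "vertex_continuous G' u"
      "L2_inner G' u (\<lambda>e x. 1) = ?S" "L2_inner G' u' u' + t * L2_inner G' u u = ?S"
      by (rule A'.resolvent_test_function[OF t, of N])
    have "?S\<^sup>2 \<le> ?S * ?R"
      using A.one_inner_square_le[OF C1[OF u(1)] vc[OF u(2)] t] u(3,4) unfolding inner by simp
    then have *: "?S * ?S \<le> ?S * ?R" by (simp add: power2_eq_square)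
    have S: "0 \<le> ?S"
      by (intro sum_nonneg divide_nonneg_pos add_pos_nonneg A'.eigval_pos t) simp
    show "?S \<le> ?R"
    proof (cases "?S = 0")
      case True then show ?thesis using R by simp
    next
      case False
      then have "0 < ?S" using S by simp
      then show ?thesis using * by (simp only: mult_le_cancel_left_pos)
    qed
  qed
qed

text \<open>For 0 < \<alpha> < 1 this is pi / sin (pi \<alpha>). Values in \<open>ennreal\<close>
  let substitution and exchange with sums proceed before finiteness is known.\<close>

definition resolvent_kernel_integral :: "real \<Rightarrow> ennreal" where
  "resolvent_kernel_integral \<alpha> = (\<integral>\<^sup>+t. ennreal (t powr (- \<alpha>) / (1 + t)) * indicator {0<..} t \<partial>lborel)"

text \<open>Substituting \<mu> t for t extracts \<mu>^-\<alpha>: the integrand scales by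
  \<mu>^-\<alpha> / \<mu> and the measure by \<mu>.\<close>

lemma nn_integral_resolvent_kernel:
  assumes "0 < \<mu>"
  shows "(\<integral>\<^sup>+t. ennreal (t powr (- \<alpha>) / (\<mu> + t)) * indicator {0<..} t \<partial>lborel)
    = ennreal (\<mu> powr (- \<alpha>)) * resolvent_kernel_integral \<alpha>"
proof -
  have "(\<integral>\<^sup>+t. ennreal (t powr (- \<alpha>) / (\<mu> + t)) * indicator {0<..} t \<partial>lborel)
    = ennreal \<bar>\<mu>\<bar> * (\<integral>\<^sup>+t. ennreal ((0 + \<mu> * t) powr (- \<alpha>) / (\<mu> + (0 + \<mu> * t))) * indicator {0<..} (0 + \<mu> * t) \<partial>lborel)"
    using assms by (intro nn_integral_real_affine) auto
  also have "(\<integral>\<^sup>+t. ennreal ((0 + \<mu> * t) powr (- \<alpha>) / (\<mu> + (0 + \<mu> * t))) * indicator {0<..} (0 + \<mu> * t) \<partial>lborel)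
    = (\<integral>\<^sup>+t. ennreal (\<mu> powr (- \<alpha>) / \<mu>) * (ennreal (t powr (- \<alpha>) / (1 + t)) * indicator {0<..} t) \<partial>lborel)"
  proof (rule nn_integral_cong)
    fix t
    show "ennreal ((0 + \<mu> * t) powr (- \<alpha>) / (\<mu> + (0 + \<mu> * t))) * indicator {0<..} (0 + \<mu> * t) =
       ennreal (\<mu> powr (- \<alpha>) / \<mu>) * (ennreal (t powr (- \<alpha>) / (1 + t)) * indicator {0<..} t)"
    proof (cases "0 < t")
      case True
      have "(\<mu> * t) powr (- \<alpha>) / (\<mu> + \<mu> * t) = (\<mu> powr (- \<alpha>) / \<mu>) * (t powr (- \<alpha>) / (1 + t))"
        using True assms by (simp add: powr_mult field_simps)
      then show ?thesis using True assms by (simp flip: ennreal_mult)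
    next
      case False then show ?thesis using assms by (simp add: zero_less_mult_iff)
    qed
  qed
  also have "\<dots> = ennreal (\<mu> powr (- \<alpha>) / \<mu>) * resolvent_kernel_integral \<alpha>"
    unfolding resolvent_kernel_integral_def by (rule nn_integral_cmult) measurable
  finally show ?thesis using assms by (simp add: mult.assoc[symmetric] flip: ennreal_mult)
qed

text \<open>The kernel is dominated by t^-\<alpha> up to 1, integrable since \<alpha> < 1, and by
  t^(-\<alpha> - 1) beyond 1, integrable since \<alpha> > 0.\<close>

lemma resolvent_kernel_integral_finite:
  assumes "0 < \<alpha>" "\<alpha> < 1" shows "resolvent_kernel_integral \<alpha> < \<infinity>"
proof -
  have i1: "((\<lambda>t. t powr (- \<alpha>)) has_integral (1 powr (- \<alpha> + 1) / (- \<alpha> + 1))) {0..1}"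
    using assms by (intro has_integral_powr_from_0) auto
  have i2: "((\<lambda>t. t powr (- \<alpha> - 1)) has_integral - (1 powr (- \<alpha> - 1 + 1)) / (- \<alpha> - 1 + 1)) {1..}"
    using assms by (intro has_integral_powr_to_inf) auto
  have n1: "(\<integral>\<^sup>+t. ennreal (indicat_real {0..1} t * t powr (- \<alpha>)) \<partial>lborel) < \<infinity>"
    using nn_integral_has_integral_lebesgue[OF _ i1] by simp
  have n2: "(\<integral>\<^sup>+t. ennreal (indicat_real {1..} t * t powr (- \<alpha> - 1)) \<partial>lborel) < \<infinity>"
    using nn_integral_has_integral_lebesgue[OF _ i2] by simp
  have "resolvent_kernel_integral \<alpha>
    \<le> (\<integral>\<^sup>+t. ennreal (indicat_real {0..1} t * t powr (- \<alpha>)) + ennreal (indicat_real {1..} t * t powr (- \<alpha> - 1)) \<partial>lborel)"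
    unfolding resolvent_kernel_integral_def
  proof (rule nn_integral_mono)
    fix t :: real
    consider "t \<le> 0" | "0 < t" "t \<le> 1" | "1 < t" by linarith
    then show "ennreal (t powr (- \<alpha>) / (1 + t)) * indicator {0<..} t
      \<le> ennreal (indicat_real {0..1} t * t powr (- \<alpha>)) + ennreal (indicat_real {1..} t * t powr (- \<alpha> - 1))"
    proof cases
      case 1 then show ?thesis by simp
    next
      case 2
      have "t powr (- \<alpha>) / (1 + t) \<le> t powr (- \<alpha>) / 1" using 2 by (intro divide_left_mono) auto
      then show ?thesis using 2 by (simp add: add_increasing2 ennreal_leI)
    next
      case 3
      have "t powr (- \<alpha>) / (1 + t) \<le> t powr (- \<alpha>) / t" using 3 by (intro divide_left_mono) auto
      also have "\<dots> = t powr (- \<alpha> - 1)" using 3 by (simp add: powr_diff)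
      finally show ?thesis using 3 by (simp add: ennreal_leI)
    qed
  qed
  also have "\<dots> = (\<integral>\<^sup>+t. ennreal (indicat_real {0..1} t * t powr (- \<alpha>)) \<partial>lborel) + (\<integral>\<^sup>+t. ennreal (indicat_real {1..} t * t powr (- \<alpha> - 1)) \<partial>lborel)"
    by (rule nn_integral_add) measurable
  also have "\<dots> < \<infinity>" using n1 n2 by simp
  finally show ?thesis .
qed

lemma resolvent_kernel_integral_pos:
  assumes "0 < \<alpha>" shows "0 < resolvent_kernel_integral \<alpha>"
proof -
  \<comment> \<open>The kernel decreases, so on \<open>{1..2}\<close> it is at least its value at
    2.\<close>
  have "0 < ennreal (2 powr (- \<alpha>) / 3)" by simp
  also have "\<dots> = (\<integral>\<^sup>+t. ennreal (2 powr (- \<alpha>) / 3) * indicator {1..2} t \<partial>(lborel :: real measure))"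
    by (subst nn_integral_cmult_indicator) auto
  also have "\<dots> \<le> resolvent_kernel_integral \<alpha>"
    unfolding resolvent_kernel_integral_def
  proof (rule nn_integral_mono)
    fix t :: real
    show "ennreal (2 powr (- \<alpha>) / 3) * indicator {1..2} t \<le> ennreal (t powr (- \<alpha>) / (1 + t)) * indicator {0<..} t"
    proof (cases "t \<in> {1..2}")
      case True
      have "2 powr (- \<alpha>) / 3 \<le> t powr (- \<alpha>) / (1 + t)"
        using True assms by (intro frac_le powr_mono2') auto
      then show ?thesis using True by (simp add: ennreal_leI)
    qed simp
  qed
  finally show ?thesis .
qed

text \<open>Each power in the series is replaced by its kernel integral; nonnegativity of all terms
  justifies exchanging sum and integral.\<close>

lemma (in dirichlet_graph) frac_torsional_rigidity_integral:
  assumes "0 < \<alpha>"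
  shows "ennreal (frac_torsional_rigidity \<alpha> G) * resolvent_kernel_integral \<alpha>
    = (\<integral>\<^sup>+t. ennreal (t powr (- \<alpha>) * (\<Sum>n. (c\<^sub>G n)\<^sup>2 / (\<mu>\<^sub>G n + t))) * indicator {0<..} t \<partial>lborel)"
proof -
  have "ennreal (frac_torsional_rigidity \<alpha> G) = (\<Sum>n. ennreal (\<mu>\<^sub>G n powr (- \<alpha>) * (c\<^sub>G n)\<^sup>2))"
    by (rule suminf_ennreal_eq[OF _ frac_torsional_rigidity_sums[OF assms], symmetric]) simp
  then have "ennreal (frac_torsional_rigidity \<alpha> G) * resolvent_kernel_integral \<alpha>
    = (\<Sum>n. ennreal (\<mu>\<^sub>G n powr (- \<alpha>) * (c\<^sub>G n)\<^sup>2) * resolvent_kernel_integral \<alpha>)"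
    by simp
  also have "\<dots> = (\<Sum>n. \<integral>\<^sup>+t. ennreal ((c\<^sub>G n)\<^sup>2) * (ennreal (t powr (- \<alpha>) / (\<mu>\<^sub>G n + t)) * indicator {0<..} t) \<partial>lborel)"
  proof (rule suminf_cong)
    fix n
    have "(\<integral>\<^sup>+t. ennreal ((c\<^sub>G n)\<^sup>2) * (ennreal (t powr (- \<alpha>) / (\<mu>\<^sub>G n + t)) * indicator {0<..} t) \<partial>lborel)
      = ennreal ((c\<^sub>G n)\<^sup>2) * (ennreal (\<mu>\<^sub>G n powr (- \<alpha>)) * resolvent_kernel_integral \<alpha>)"
      unfolding nn_integral_resolvent_kernel[OF eigval_pos, symmetric] by (rule nn_integral_cmult) measurable
    then show "ennreal (\<mu>\<^sub>G n powr (- \<alpha>) * (c\<^sub>G n)\<^sup>2) * resolvent_kernel_integral \<alpha> =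
       (\<integral>\<^sup>+t. ennreal ((c\<^sub>G n)\<^sup>2) * (ennreal (t powr (- \<alpha>) / (\<mu>\<^sub>G n + t)) * indicator {0<..} t) \<partial>lborel)"
      by (simp add: ennreal_mult mult_ac)
  qed
  also have "\<dots> = (\<integral>\<^sup>+t. (\<Sum>n. ennreal ((c\<^sub>G n)\<^sup>2) * (ennreal (t powr (- \<alpha>) / (\<mu>\<^sub>G n + t)) * indicator {0<..} t)) \<partial>lborel)"
    by (rule nn_integral_suminf[symmetric]) measurable
  also have "\<dots> = (\<integral>\<^sup>+t. ennreal (t powr (- \<alpha>) * (\<Sum>n. (c\<^sub>G n)\<^sup>2 / (\<mu>\<^sub>G n + t))) * indicator {0<..} t \<partial>lborel)"
  proof (rule nn_integral_cong)
    fix t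
    show "(\<Sum>n. ennreal ((c\<^sub>G n)\<^sup>2) * (ennreal (t powr (- \<alpha>) / (\<mu>\<^sub>G n + t)) * indicator {0<..} t))
      = ennreal (t powr (- \<alpha>) * (\<Sum>n. (c\<^sub>G n)\<^sup>2 / (\<mu>\<^sub>G n + t))) * indicator {0<..} t"
    proof (cases "0 < t")
      case True
      have pos: "0 < \<mu>\<^sub>G n + t" for n using eigval_pos[of n] True by simp
      have "(\<Sum>n. ennreal ((c\<^sub>G n)\<^sup>2) * (ennreal (t powr (- \<alpha>) / (\<mu>\<^sub>G n + t)) * indicator {0<..} t))
        = (\<Sum>n. ennreal (t powr (- \<alpha>) * ((c\<^sub>G n)\<^sup>2 / (\<mu>\<^sub>G n + t))))"
        using True less_imp_le[OF pos] by (simp add: mult_ac flip: ennreal_mult)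
      also have "\<dots> = ennreal (\<Sum>n. t powr (- \<alpha>) * ((c\<^sub>G n)\<^sup>2 / (\<mu>\<^sub>G n + t)))"
        using True less_imp_le[OF pos] summable_resolvent[of t] by (intro suminf_ennreal2 summable_mult) auto
      also have "(\<Sum>n. t powr (- \<alpha>) * ((c\<^sub>G n)\<^sup>2 / (\<mu>\<^sub>G n + t))) = t powr (- \<alpha>) * (\<Sum>n. (c\<^sub>G n)\<^sup>2 / (\<mu>\<^sub>G n + t))"
        using True by (intro suminf_mult summable_resolvent) simp
      finally show ?thesis using True by simp
    qed simp
  qed
  finally show ?thesis .
qed

section \<open>Gluing two vertices\<close>

lemma compact_glue:
  assumes "compact_metric_graph G" shows "compact_metric_graph (glue v1 v2 G)"
proof -
  interpret fin_digraph "skeleton G" using assms by (simp add: compact_metric_graph_def)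
  have "fin_digraph (skeleton (glue v1 v2 G))" by unfold_locales (auto simp: glue_def Let_def)
  then show ?thesis using assms by (auto simp: compact_metric_graph_def glue_def Let_def)
qed

text \<open>The renaming of vertices maps each step of an undirected path to a step in the glued
  graph.\<close>

lemma connected_glue:
  assumes "connected_metric_graph G" shows "connected_metric_graph (glue v1 v2 G)"
proof -
  let ?q = "id(v2 := v1)" and ?H = "skeleton G" and ?H' = "skeleton (glue v1 v2 G)"
  have verts: "verts ?H' = ?q ` verts ?H" by (simp add: glue_def Let_def)
  have "(?q u, ?q v) \<in> rtrancl_on (verts ?H') ((arcs_ends ?H')\<^sup>s)" if "(u, v) \<in> rtrancl_on (verts ?H) ((arcs_ends ?H)\<^sup>s)" for u v
    using that
  proof (induction rule: rtrancl_on_induct)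
    case base then show ?case by (auto simp only: verts intro!: rtrancl_on_refl)
  next
    case (step y z)
    have "(?q y, ?q z) \<in> (arcs_ends ?H')\<^sup>s"
      using step(2) by (auto simp: symcl_def arcs_ends_conv glue_def Let_def image_iff)
    moreover have "?q z \<in> verts ?H'" unfolding verts using step(4) by (rule imageI)
    ultimately show ?case by (rule rtrancl_on_into_rtrancl_on[OF step(5)])
  qed
  then show ?thesis using assms unfolding connected_metric_graph_def connected_conv verts by blast
qed

text \<open>A path between distinct vertices uses at least one edge; this supplies the edge that
  \<open>dirichlet_graph\<close> asks for.\<close>

lemma arcs_nonempty_if_connected:
  assumes "connected_metric_graph G" "v1 \<in> verts (skeleton G)" "v2 \<in> verts (skeleton G)" "v1 \<noteq> v2"
  shows "arcs (skeleton G) \<noteq> {}"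
proof
  assume "arcs (skeleton G) = {}"
  then have "(arcs_ends (skeleton G))\<^sup>s = {}" by (simp add: symcl_def arcs_ends_conv)
  moreover have "(v1, v2) \<in> rtrancl_on (verts (skeleton G)) ((arcs_ends (skeleton G))\<^sup>s)"
    using assms by (simp add: connected_metric_graph_def connected_conv)
  ultimately show False using assms(4) by (auto elim: rtrancl_on.cases)
qed

text \<open>Vertex values pull back along the renaming, and Dirichlet vertices map to Dirichlet
  vertices. This is the inclusion of form domains.\<close>

lemma vertex_continuous_glueD:
  assumes "vertex_continuous (glue v1 v2 G) u" shows "vertex_continuous G u"
proof -
  let ?q = "id(v2 := v1)"
  obtain val where val: "\<forall>e\<in>arcs (skeleton G). u e 0 = val (?q (tail (skeleton G) e)) \<and> u e (len G e) = val (?q (head (skeleton G) e))"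
    "\<forall>v\<in>?q ` dirichlet G. val v = 0"
    using assms unfolding vertex_continuous_def glue_def Let_def metric_graph.select_convs pre_digraph.select_convs comp_apply
    by blast
  then show ?thesis unfolding vertex_continuous_def by (intro exI[of _ "val \<circ> ?q"]) (simp only: comp_apply, blast)
qed

theorem theorem6p4:
  fixes \<alpha> :: real and G :: "('v, 'e) metric_graph" and v1 v2 :: 'v
  assumes "0 < \<alpha>" and "\<alpha> < 1"
    and "compact_metric_graph G" and "connected_metric_graph G"
    and "dirichlet G \<noteq> {}"
    and "v1 \<in> verts (skeleton G)" and "v2 \<in> verts (skeleton G)" and "v1 \<noteq> v2"
  shows "frac_torsional_rigidity \<alpha> (glue v1 v2 G) \<le> frac_torsional_rigidity \<alpha> G"
proof -
  let ?G' = "glue v1 v2 G"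
  have arcs: "arcs (skeleton G) \<noteq> {}" by (rule arcs_nonempty_if_connected[OF assms(4,6,7,8)])
  interpret A: dirichlet_graph G using assms arcs by unfold_locales
  \<comment> \<open>Edges keep their names and lengths, so the two graphs have equal inner products
    as functions, and no transport between two L^2 spaces is involved.\<close>
  have same: "arcs (skeleton ?G') = arcs (skeleton G)" "len ?G' = len G" by (simp_all add: glue_def Let_def)
  interpret A': dirichlet_graph ?G'
  proof
    show "dirichlet ?G' \<noteq> {}" using assms(5)
      by (simp only: glue_def Let_def metric_graph.select_convs image_is_empty not_False_eq_True)
    show "compact_metric_graph ?G'" by (rule compact_glue[OF assms(3)])
    show "connected_metric_graph ?G'" by (rule connected_glue[OF assms(4)])
    show "arcs (skeleton ?G') \<noteq> {}" using arcs same by simp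
  qed
  have inner: "L2_inner ?G' = L2_inner G" by (simp add: L2_inner_def graph_integral_def fun_eq_iff same)
  have resolvent: "(\<Sum>n. (L2_inner ?G' (\<lambda>e x. 1) (eigfun ?G' n))\<^sup>2 / (eigval ?G' n + t))
    \<le> (\<Sum>n. (L2_inner G (\<lambda>e x. 1) (eigfun G n))\<^sup>2 / (eigval G n + t))" if "0 < t" for t
    using that
    by (intro resolvent_mono A.dirichlet_graph_axioms A'.dirichlet_graph_axioms inner)
       (auto simp: edgewise_C1_def same dest: vertex_continuous_glueD)
  have le: "ennreal (frac_torsional_rigidity \<alpha> ?G') * resolvent_kernel_integral \<alpha>
    \<le> ennreal (frac_torsional_rigidity \<alpha> G) * resolvent_kernel_integral \<alpha>"
    unfolding A.frac_torsional_rigidity_integral[OF assms(1)] A'.frac_torsional_rigidity_integral[OF assms(1)]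
    by (intro nn_integral_mono)
       (auto simp: indicator_def intro!: ennreal_leI mult_left_mono resolvent)
  obtain r where r: "resolvent_kernel_integral \<alpha> = ennreal r" "0 < r"
    using resolvent_kernel_integral_finite[OF assms(1,2)] resolvent_kernel_integral_pos[OF assms(1)]
    by (cases "resolvent_kernel_integral \<alpha>" rule: ennreal_cases) auto
  \<comment> \<open>\<open>ennreal\<close> sends negative reals to 0, so the comparison returns to
    the reals only for nonnegative rigidities.\<close>
  have nonneg: "0 \<le> frac_torsional_rigidity \<alpha> G" "0 \<le> frac_torsional_rigidity \<alpha> ?G'"
    using sums_le[OF _ sums_zero A.frac_torsional_rigidity_sums[OF assms(1)]]
      sums_le[OF _ sums_zero A'.frac_torsional_rigidity_sums[OF assms(1)]] by auto
  have "ennreal (frac_torsional_rigidity \<alpha> ?G' * r) \<le> ennreal (frac_torsional_rigidity \<alpha> G * r)"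
    using le nonneg r by (simp add: ennreal_mult)
  then show ?thesis using nonneg r(2) by (simp add: ennreal_le_iff)
qed

end
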